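(* Let $\alpha>0$ and $\nu>-1$, and put $q=e^{-2\pi\alpha}$ and $x=e^{-2\pi(1+\nu)\alpha}$ (so $q,x\in(0,1)$). Then $$\log(x;q)_\infty=-\frac{\pi}{12\alpha}+\log\frac{\sqrt{2\pi}}{\Gamma(\nu+1)}+\frac{\pi}{12}\,\alpha-\Bigl(\nu+\frac12\Bigr)\log\frac{1-e^{-2\pi\nu\alpha}}{\nu}+\int_0^{\nu}\Bigl(\frac{2\pi\alpha t}{e^{2\pi\alpha t}-1}-1\Bigr)\,dt+M(\alpha,\nu),$$ where $$M(\alpha,\nu)=-\sum_{n=1}^\infty\frac{\cos 2n\pi\nu}{n\,(e^{2n\pi/\alpha}-1)}-\frac{2}{\pi}\,\mathrm{PV}\!\int_0^\infty\sum_{n=1}^\infty\frac{\sin 2n\nu\pi t}{n\,(e^{2n\pi t/\alpha}-1)}\,\frac{dt}{1-t^2}.$$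
   Context: For $|q|<1$, $(x;q)_\infty=\prod_{n\ge0}(1-xq^n)$. Here $\log$ is the real logarithm (for $q,x\in(0,1)$ the product lies in $(0,1)$), $\Gamma$ is Euler's Gamma function, and $\mathrm{PV}\int$ denotes the Cauchy principal value of the integral (the singularity being at $t=1$). *)

theory Defs
  imports "HOL-Analysis.Analysis"
begin

definition qpochhammer_inf :: "real \<Rightarrow> real \<Rightarrow> real" where
  "qpochhammer_inf x q = (\<Prod>n. 1 - x * q ^ n)"

text \<open>Cauchy principal value over \<open>S\<close> with a singularity at \<open>c\<close>: the symmetric
  neighbourhood \<open>[c - \<epsilon>, c + \<epsilon>]\<close> is cut out, and \<open>\<epsilon>\<close> tends to \<open>0\<close> from the right.\<close>

definition has_pv_integral :: "(real \<Rightarrow> real) \<Rightarrow> real set \<Rightarrow> real \<Rightarrow> real \<Rightarrow> bool" where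
  "has_pv_integral f S c I \<longleftrightarrow>
     (\<forall>\<epsilon>>0. set_integrable lborel (S - {c - \<epsilon>..c + \<epsilon>}) f) \<and>
     ((\<lambda>\<epsilon>. LBINT t:S - {c - \<epsilon>..c + \<epsilon>}. f t) \<longlongrightarrow> I) (at_right 0)"

definition pv_integral :: "(real \<Rightarrow> real) \<Rightarrow> real set \<Rightarrow> real \<Rightarrow> real" where
  "pv_integral f S c = (THE I. has_pv_integral f S c I)"

lemma has_pv_integral_unique:
  assumes "has_pv_integral f S c I" "has_pv_integral f S c J"
  shows "I = J"
  using assms tendsto_unique[OF trivial_limit_at_right_real[of 0]]
  unfolding has_pv_integral_def by blast

lemma pv_integral_eq:
  assumes "has_pv_integral f S c I"
  shows "pv_integral f S c = I"
  unfolding pv_integral_def using assms has_pv_integral_unique by blast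

text \<open>The function \<open>(1 - exp (-2 \<pi> \<nu> \<alpha>)) / \<nu>\<close> has a removable singularity at \<open>\<nu> = 0\<close>,
  which is an admissible parameter; its value there is the limit \<open>2 \<pi> \<alpha>\<close>
  (and not \<open>0 / 0 = 0\<close>).\<close>

definition exp_quotient :: "real \<Rightarrow> real \<Rightarrow> real" where
  "exp_quotient \<alpha> \<nu> =
     (if \<nu> = 0 then 2 * pi * \<alpha> else (1 - exp (- 2 * pi * \<nu> * \<alpha>)) / \<nu>)"

text \<open>The series below start at index \<open>1\<close>, so their terms are taken at \<open>Suc n\<close>.\<close>

definition cos_term :: "real \<Rightarrow> real \<Rightarrow> nat \<Rightarrow> real" where
  "cos_term \<alpha> \<nu> n = cos (2 * real n * pi * \<nu>) / (real n * (exp (2 * real n * pi / \<alpha>) - 1))"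

definition sin_term :: "real \<Rightarrow> real \<Rightarrow> real \<Rightarrow> nat \<Rightarrow> real" where
  "sin_term \<alpha> \<nu> t n =
     sin (2 * real n * \<nu> * pi * t) / (real n * (exp (2 * real n * pi * t / \<alpha>) - 1))"

definition M_integrand :: "real \<Rightarrow> real \<Rightarrow> real \<Rightarrow> real" where
  "M_integrand \<alpha> \<nu> t = (\<Sum>n. sin_term \<alpha> \<nu> t (Suc n)) * (1 / (1 - t\<^sup>2))"

definition M :: "real \<Rightarrow> real \<Rightarrow> real" where
  "M \<alpha> \<nu> = - (\<Sum>n. cos_term \<alpha> \<nu> (Suc n)) - 2 / pi * pv_integral (M_integrand \<alpha> \<nu>) {0<..} 1"

end

theory Submission
  imports Defs "HOL-Probability.Sinc_Integral" "HOL-Real_Asymp.Real_Asymp"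
begin

text \<open>
  Fix \<open>\<alpha>\<close>; both sides are functions of \<open>\<nu>\<close>, and their difference \<open>D\<close> is shown to be invariant under
  \<open>\<nu> \<mapsto> \<nu> + 1\<close> and to tend to \<open>0\<close> along \<open>\<nu> + N\<close>.

  Periodicity: substituting \<open>s = n t\<close> in the \<open>n\<close>-th summand, the sum over \<open>n\<close> of the principal value
  integrals has the kernel \<open>\<Sum>n. 1 / (n\<^sup>2 - s\<^sup>2) = 1 / (2 s\<^sup>2) - \<pi> cot (\<pi> s) / (2 s)\<close>. The increment
  \<open>sin (2 \<pi> (\<nu> + 1) s) - sin (2 \<pi> \<nu> s)\<close> contains the factor \<open>sin (\<pi> s)\<close>, which cancels the poles, and what
  remains is \<open>2 \<pi>\<^sup>2\<close> times the integral of \<open>(u - \<nu> - 1/2) sin (2 \<pi> u s)\<close> over \<open>u\<close> in \<open>[\<nu>, \<nu> + 1]\<close>.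
  By Fubini and the sine transform of \<open>1 / (e\<^bsup>2\<pi>s/\<alpha>\<^esup> - 1)\<close> the increment of the principal value is the error
  of the trapezoidal rule for \<open>\<nu> \<mapsto> log ((1 - e\<^bsup>-2\<pi>\<nu>\<alpha>\<^esup>) / \<nu>)\<close>, an elementary expression.

  Limit: by the Riemann--Lebesgue lemma only the singularities of \<open>1 / (t (1 - t\<^sup>2))\<close> at \<open>0\<close> and \<open>1\<close>
  contribute to the principal value, each through the Dirichlet integral \<open>\<pi> / 2\<close>; they yield
  \<open>\<pi> \<alpha> / 12\<close> and the cosine series. The remaining terms are controlled by Stirling's formula.
  Since \<open>D\<close> is constant along \<open>\<nu> + N\<close>, the limit may be taken in Cesaro mean, for which the
  Riemann--Lebesgue lemma is immediate from dominated convergence.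
\<close>

section \<open>Dominated series and Cesaro means\<close>

text \<open>Exchanging sums and integrals is limited by the \<open>n\<close>-th sine term: its
  frequency and the argument of its Bose factor both scale with \<open>n\<close>. With the weight
  \<open>1 / n^2\<close> left after factoring out \<open>t\<close>, Lipschitz constants add up to
  the divergent sum of \<open>1 / n\<close>. Interpolating between Lipschitz and bounded gives
  Hoelder exponent 1/2, which costs only \<open>sqrt n\<close>: the constants become summable, and
  the remaining singularities \<open>1 / sqrt t\<close> and \<open>1 / sqrt |1 - t|\<close> are
  integrable.

  The substitution s = n t would turn one symmetric cut-out into cut-outs of different widths around
  all s = n. It is therefore applied only to the increment in \<nu>, whose integrand is absolutely
  integrable.

  An antiderivative of \<open>ln (exp_quotient \<alpha> \<nu>)\<close> enters both the interval
  integral and the increment of the principal value. The two occurrences cancel, so it is never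
  evaluated.

  That the principal value converges along \<nu> + N is deduced from the constancy of D and the
  limits of all other terms; the Cesaro mean only identifies its limit.\<close>

lemma suminf_dominated_abs_le:
  fixes f :: "nat \<Rightarrow> real"
  assumes "\<And>n. \<bar>f n\<bar> \<le> w n * g" "summable w"
  shows "summable f" "\<bar>suminf f\<bar> \<le> suminf w * g"
proof -
  have sw: "summable (\<lambda>n. w n * g)" by (rule summable_mult2[OF assms(2)])
  have sa: "summable (\<lambda>n. \<bar>f n\<bar>)"
    by (rule summable_comparison_test'[OF sw]) (use assms(1) in auto)
  show "summable f" using sa by (rule summable_rabs_cancel)
  have "\<bar>suminf f\<bar> \<le> (\<Sum>n. \<bar>f n\<bar>)" by (rule summable_rabs[OF sa])
  also have "\<dots> \<le> (\<Sum>n. w n * g)" by (rule suminf_le[OF assms(1) sa sw])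
  also have "\<dots> = suminf w * g" by (rule suminf_mult2[OF assms(2), symmetric])
  finally show "\<bar>suminf f\<bar> \<le> suminf w * g" .
qed

text \<open>The product form of the majorant separates the variables: the integrals of the absolute
  values are at most \<open>w n\<close> times one fixed integral, which is the summability needed to
  integrate a series termwise. This summability is kept as the last conclusion, to be carried
  through a change of variables later.\<close>

lemma set_integral_sums_dominated:
  fixes f :: "nat \<Rightarrow> real \<Rightarrow> real"
  assumes [measurable]: "\<And>n. f n \<in> borel_measurable borel" "S \<in> sets borel"
    and bd: "\<And>n t. t \<in> S \<Longrightarrow> \<bar>f n t\<bar> \<le> w n * G t"
    and w: "summable w" and G: "set_integrable lborel S G"
  shows "\<And>n. set_integrable lborel S (f n)"
    and "set_integrable lborel S (\<lambda>t. \<Sum>n. f n t)"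
    and "(\<lambda>n. LBINT t:S. f n t) sums (LBINT t:S. \<Sum>n. f n t)"
    and "summable (\<lambda>n. LBINT t:S. \<bar>f n t\<bar>)"
proof -
  show int: "set_integrable lborel S (f n)" for n
    using set_integrable_mult_right[OF G, of "w n"] unfolding set_integrable_def
    by (rule Bochner_Integration.integrable_bound)
       (auto simp: indicator_def intro!: AE_I2 order_trans[OF bd] abs_ge_self)
  have AEs: "AE t in lborel. summable (\<lambda>n. norm (indicator S t *\<^sub>R f n t))"
  proof (rule AE_I2)
    fix t show "summable (\<lambda>n. norm (indicator S t *\<^sub>R f n t))"
    proof (cases "t \<in> S")
      case True
      have "summable (\<lambda>n. \<bar>f n t\<bar>)"
        by (rule suminf_dominated_abs_le(1)[OF _ w, of _ "G t"]) (use bd True in auto)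
      then show ?thesis using True by simp
    qed simp
  qed
  have le: "(LBINT t:S. \<bar>f n t\<bar>) \<le> w n * (LBINT t:S. G t)" for n
  proof -
    have "(LBINT t:S. \<bar>f n t\<bar>) \<le> (LBINT t:S. w n * G t)"
      by (rule set_integral_mono) (use int G bd in \<open>auto intro: set_integrable_abs\<close>)
    then show ?thesis by simp
  qed
  have nn: "0 \<le> (LBINT t:S. \<bar>f n t\<bar>)" for n
    unfolding set_lebesgue_integral_def by (rule integral_nonneg_AE) auto
  show sm: "summable (\<lambda>n. LBINT t:S. \<bar>f n t\<bar>)"
    by (rule suminf_dominated_abs_le(1)[OF _ w]) (use le nn in auto)
  have sm': "summable (\<lambda>n. \<integral>t. norm (indicator S t *\<^sub>R f n t) \<partial>lborel)"
    using sm by (simp add: set_lebesgue_integral_def abs_mult)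
  have eq: "(\<Sum>n. indicator S t *\<^sub>R f n t) = indicator S t *\<^sub>R (\<Sum>n. f n t)" for t
    by (auto simp: indicator_def)
  show "set_integrable lborel S (\<lambda>t. \<Sum>n. f n t)"
    using integrable_suminf[OF int[unfolded set_integrable_def] AEs sm']
    by (simp only: set_integrable_def eq)
  show "(\<lambda>n. LBINT t:S. f n t) sums (LBINT t:S. \<Sum>n. f n t)"
    using sums_integral[OF int[unfolded set_integrable_def] AEs sm']
    by (simp only: set_lebesgue_integral_def eq)
qed

section \<open>Averages of sines and a Riemann-Lebesgue lemma in Cesaro mean\<close>

lemma sum_sin_arith_progression:
  "2 * sin (y / 2) * (\<Sum>N<K. sin (x + real N * y)) = cos (x - y / 2) - cos (x + real K * y - y / 2)"
proof (induction K)
  case (Suc K)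
  have "2 * sin (y / 2) * sin (x + real K * y) = 
      cos (x + real K * y - y / 2) - cos (x + real (Suc K) * y - y / 2)"
  proof -
    have "x + real (Suc K) * y - y / 2 = (x + real K * y) + y / 2" by (simp add: algebra_simps)
    then show ?thesis by (simp only: cos_add cos_diff) (simp add: algebra_simps)
  qed
  then show ?case using Suc by (simp add: distrib_left)
qed simp

text \<open>By the telescoped sum the numerators stay below \<open>1 / |sin (y / 2)|\<close> for all
  \<open>K\<close>.\<close>

lemma cesaro_sin_tendsto_0:
  assumes "sin (y / 2) \<noteq> 0"
  shows "(\<lambda>K. (\<Sum>N<K. sin (x + real N * y)) / real K) \<longlonglongrightarrow> 0"
proof (rule Lim_null_comparison)
  let ?C = "1 / \<bar>sin (y / 2)\<bar>"
  show "(\<lambda>K. ?C * (1 / real K)) \<longlonglongrightarrow> 0"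
    by (rule tendsto_mult_right_zero) (rule lim_1_over_n)
  have "\<bar>\<Sum>N<K. sin (x + real N * y)\<bar> \<le> ?C" for K
  proof -
    have "\<bar>2 * sin (y / 2) * (\<Sum>N<K. sin (x + real N * y))\<bar> \<le> 2"
      unfolding sum_sin_arith_progression
      using abs_cos_le_one[of "x - y / 2"] abs_cos_le_one[of "x + real K * y - y / 2"] by linarith
    then show ?thesis using assms by (simp add: abs_mult field_simps)
  qed
  then show "\<forall>\<^sub>F K in sequentially. norm ((\<Sum>N<K. sin (x + real N * y)) / real K) \<le> ?C * (1 / real K)"
    by (intro always_eventually allI) (auto simp only: real_norm_def abs_divide abs_of_nat times_divide_eq_right mult_1_right intro!: divide_right_mono)
qed

lemma cesaro_sin_abs_le: "\<bar>(\<Sum>N<K. sin (x N)) / real K\<bar> \<le> (1::real)"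
proof -
  have "\<bar>\<Sum>N<K. sin (x N)\<bar> \<le> (\<Sum>N<K. 1)"
    by (rule order_trans[OF sum_abs]) (rule sum_mono, simp)
  then show ?thesis by (cases "K = 0") (auto simp: divide_le_eq)
qed

lemma cesaro_tendsto:
  fixes f :: "nat \<Rightarrow> real"
  assumes "f \<longlonglongrightarrow> L"
  shows "(\<lambda>K. (\<Sum>N<K. f N) / real K) \<longlonglongrightarrow> L"
proof -
  have "(\<lambda>K. (\<Sum>N<K. f N - L) / real K) \<longlonglongrightarrow> 0"
  proof (rule LIMSEQ_I)
    fix r :: real assume r: "r > 0"
    have "(\<lambda>N. f N - L) \<longlonglongrightarrow> 0" using assms by (simp add: LIM_zero)
    from LIMSEQ_D[OF this, of "r / 2"] r obtain m where m: "\<And>N. N \<ge> m \<Longrightarrow> \<bar>f N - L\<bar> < r / 2" by auto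
    define C where "C = (\<Sum>N<m. \<bar>f N - L\<bar>)"
    \<comment> \<open>Beyond \<open>p\<close> the fixed head \<open>C\<close> of the sum costs less
      than half of \<open>real K * r\<close>.\<close>
    obtain p :: nat where p: "real p > 2 * C / r" using reals_Archimedean2 by blast
    show "\<exists>no. \<forall>K\<ge>no. norm ((\<Sum>N<K. f N - L) / real K - 0) < r"
    proof (intro exI allI impI)
      fix K assume K: "K \<ge> max (max m p) 1"
      have Kpos: "real K > 0" and "real K \<ge> real p" using K by auto
      then have "2 * C / r < real K" using p by linarith
      then have CK: "2 * C < real K * r" using r by (simp add: field_simps)
      have "\<bar>\<Sum>N<K. f N - L\<bar> \<le> (\<Sum>N<K. \<bar>f N - L\<bar>)" by (rule sum_abs)
      also have "\<dots> = C + (\<Sum>N=m..<K. \<bar>f N - L\<bar>)" 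
        unfolding C_def using K by (metis lessThan_atLeast0 max.boundedE sum.atLeastLessThan_concat zero_le)
      also have "(\<Sum>N=m..<K. \<bar>f N - L\<bar>) \<le> (\<Sum>N=m..<K. r / 2)"
        by (rule sum_mono) (use m in \<open>auto intro: less_imp_le\<close>)
      also have "\<dots> \<le> real K * (r / 2)" using r by (simp add: mult_right_mono)
      finally have "\<bar>\<Sum>N<K. f N - L\<bar> \<le> C + real K * (r / 2)" by simp
      then have "\<bar>\<Sum>N<K. f N - L\<bar> < real K * r" using CK by linarith
      then show "norm ((\<Sum>N<K. f N - L) / real K - 0) < r" using Kpos by (simp add: field_simps)
    qed
  qed
  then have "(\<lambda>K. (\<Sum>N<K. f N - L) / real K + L) \<longlonglongrightarrow> 0 + L" by (intro tendsto_intros)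
  moreover have "\<forall>\<^sub>F K in sequentially. (\<Sum>N<K. f N - L) / real K + L = (\<Sum>N<K. f N) / real K"
    using eventually_gt_at_top[of 0] by eventually_elim (simp add: sum_subtractf field_simps)
  ultimately show ?thesis by (simp add: tendsto_cong)
qed

text \<open>All exceptional points are rational. They are the points where a phase step is a
  multiple of 2 pi, so that averaging has no effect; the case \<open>n = 0\<close> also excludes the
  poles of the cotangent.\<close>

lemma AE_no_multiple_in_Ints: "AE t in lborel. \<forall>n. real (Suc n) * t \<notin> \<int>"
proof -
  have sub: "{t. \<exists>n. real (Suc n) * t \<in> \<int>} \<subseteq> \<rat>"
  proof
    fix t assume "t \<in> {t. \<exists>n. real (Suc n) * t \<in> \<int>}"
    then obtain n where "real (Suc n) * t \<in> \<int>" by auto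
    then have "real (Suc n) * t / real (Suc n) \<in> \<rat>" using Ints_subset_Rats by (intro Rats_divide) auto
    then show "t \<in> \<rat>" by (simp del: of_nat_Suc)
  qed
  have "\<rat> \<in> null_sets (lborel :: real measure)"
    by (rule countable_imp_null_set_lborel) (rule countable_rat)
  then have "AE t in lborel. t \<notin> (\<rat> :: real set)" by (rule AE_not_in)
  then show ?thesis by eventually_elim (use sub in blast)
qed

text \<open>For almost every \<open>t\<close> each averaged sine tends to 0. Tannery's theorem
  passes this through the series over \<open>n\<close>, and dominated convergence through the
  integral, with majorant \<open>suminf w * G t\<close>. Only size and measurability of the
  amplitudes \<open>d n\<close> enter, no smoothness.\<close>

lemma cesaro_Riemann_Lebesgue:
  fixes d \<phi> :: "nat \<Rightarrow> real \<Rightarrow> real"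
  assumes [measurable]: "\<And>n. d n \<in> borel_measurable borel" "\<And>n. \<phi> n \<in> borel_measurable borel"
      "S \<in> sets borel"
    and bd: "\<And>n t. t \<in> S \<Longrightarrow> \<bar>d n t\<bar> \<le> w n * G t"
    and w: "summable w" and G: "set_integrable lborel S G"
  shows "(\<lambda>K. (\<Sum>N<K. LBINT t:S. \<Sum>n. d n t * sin (\<phi> n t + real N * (2 * pi * real (Suc n) * t))) / real K)
     \<longlonglongrightarrow> 0"
proof -
  define e where "e N n t = d n t * sin (\<phi> n t + real N * (2 * pi * real (Suc n) * t))" for N n t
  have [measurable]: "e N n \<in> borel_measurable borel" for N n unfolding e_def by measurable
  have ebd: "\<bar>e N n t\<bar> \<le> w n * G t" if "t \<in> S" for N n t
  proof -
    have "\<bar>e N n t\<bar> \<le> \<bar>d n t\<bar> * 1" unfolding e_def abs_mult by (rule mult_left_mono) auto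
    then show ?thesis using bd[OF that, of n] by linarith
  qed
  note swap = set_integral_sums_dominated[OF _ _ ebd w G]
  have int: "set_integrable lborel S (\<lambda>t. \<Sum>n. e N n t)" for N
    by (rule swap(2)) auto
  define s where "s K t = indicator S t * ((\<Sum>N<K. \<Sum>n. e N n t) / real K)" for K t
  have "(\<lambda>K. \<integral>t. s K t \<partial>lborel) \<longlonglongrightarrow> (\<integral>(t::real). (0::real) \<partial>lborel)"
  proof (rule integral_dominated_convergence[where w = "\<lambda>t. indicator S t * (suminf w * G t)"])
    show "integrable lborel (\<lambda>t. indicator S t * (suminf w * G t))"
      using set_integrable_mult_right[OF G, of "suminf w"] by (simp add: set_integrable_def)
    show "s K \<in> borel_measurable lborel" for K unfolding s_def by measurable
    show "AE t in lborel. norm (s K t) \<le> indicator S t * (suminf w * G t)" for K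
    proof (rule AE_I2)
      fix t
      have "\<bar>(\<Sum>N<K. \<Sum>n. e N n t) / real K\<bar> \<le> suminf w * G t" if t: "t \<in> S"
      proof -
        have nn: "0 \<le> suminf w * G t" using suminf_dominated_abs_le(2)[OF ebd[OF t, of 0] w] by linarith
        have "\<bar>\<Sum>N<K. \<Sum>n. e N n t\<bar> \<le> (\<Sum>N<K. suminf w * G t)"
          by (rule order_trans[OF sum_abs]) (rule sum_mono, rule suminf_dominated_abs_le(2)[OF ebd[OF t] w])
        then show ?thesis using nn by (cases "K = 0") (auto simp: divide_le_eq mult_ac)
      qed
      then show "norm (s K t) \<le> indicator S t * (suminf w * G t)"
        by (auto simp: s_def indicator_def)
    qed
    show "AE t in lborel. (\<lambda>K. s K t) \<longlonglongrightarrow> 0"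
      using AE_no_multiple_in_Ints
    proof eventually_elim
      case (elim t)
      show ?case
      proof (cases "t \<in> S")
        case t: True
        \<comment> \<open>The average over \<open>N\<close> is moved inside the series, so that it
          acts on one sine at a time.\<close>
        define a where "a K n = d n t * ((\<Sum>N<K. sin (\<phi> n t + real N * (2 * pi * real (Suc n) * t))) / real K)" for K n
        have eq: "s K t = (\<Sum>n. a K n)" for K
        proof -
          have "(\<Sum>N<K. \<Sum>n. e N n t) = (\<Sum>n. \<Sum>N<K. e N n t)"
            by (rule suminf_sum[symmetric]) (rule suminf_dominated_abs_le(1)[OF ebd[OF t] w])
          moreover have sm: "summable (\<lambda>n. \<Sum>N<K. e N n t)"
            by (rule summable_sum) (rule suminf_dominated_abs_le(1)[OF ebd[OF t] w])
          ultimately have "s K t = (\<Sum>n. (\<Sum>N<K. e N n t) / real K)"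
            using t suminf_divide[OF sm] by (simp add: s_def)
          then show ?thesis by (simp add: a_def e_def sum_distrib_left)
        qed
        have a0: "(\<lambda>K. a K n) \<longlonglongrightarrow> 0" for n
        proof -
          have "sin ((2 * pi * real (Suc n) * t) / 2) \<noteq> 0"
          proof
            assume "sin ((2 * pi * real (Suc n) * t) / 2) = 0"
            then obtain i :: int where "2 * pi * real (Suc n) * t / 2 = of_int i * pi"
              unfolding sin_zero_iff_int2 by blast
            then have "real (Suc n) * t = of_int i" by (simp del: of_nat_Suc)
            then show False using elim by (metis Ints_of_int)
          qed
          from tendsto_mult_left[OF cesaro_sin_tendsto_0[OF this], of "d n t" "\<phi> n t"]
          show ?thesis by (simp add: a_def)
        qed
        have abd: "\<bar>a K n\<bar> \<le> w n * G t" for K n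
        proof -
          have "\<bar>a K n\<bar> \<le> \<bar>d n t\<bar> * 1" unfolding a_def abs_mult
            by (rule mult_left_mono) (rule cesaro_sin_abs_le, simp)
          then show ?thesis using bd[OF t, of n] by linarith
        qed
        have "\<forall>\<^sub>F (n, K) in at_top \<times>\<^sub>F sequentially. norm (a K n) \<le> w n * G t"
          by (rule always_eventually) (use abd in auto)
        from tannerys_theorem[where a = "\<lambda>n K. a K n" and b = "\<lambda>_. 0", OF a0 this summable_mult2[OF w]]
        have "(\<lambda>K. \<Sum>n. a K n) \<longlonglongrightarrow> (\<Sum>n. 0)" by simp
        then show ?thesis by (simp add: eq)
      qed (simp add: s_def)
    qed
  qed auto
  moreover have "(\<integral>t. s K t \<partial>lborel) = (\<Sum>N<K. LBINT t:S. \<Sum>n. e N n t) / real K" for K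
  proof -
    have "(\<integral>t. s K t \<partial>lborel) = (\<integral>t. (\<Sum>N<K. indicator S t *\<^sub>R (\<Sum>n. e N n t)) / real K \<partial>lborel)"
      by (rule Bochner_Integration.integral_cong) (auto simp: s_def indicator_def)
    also have "\<dots> = (\<Sum>N<K. \<integral>t. indicator S t *\<^sub>R (\<Sum>n. e N n t) \<partial>lborel) / real K"
      unfolding integral_divide_zero 
      by (subst Bochner_Integration.integral_sum) (use int in \<open>auto simp: set_integrable_def\<close>)
    finally show ?thesis by (simp add: set_lebesgue_integral_def)
  qed
  ultimately show ?thesis by (simp add: e_def)
qed

section \<open>Principal values\<close>

text \<open>The interpolation device: one bound by boundedness and one by a Lipschitz estimate
  combine into a Hoelder bound of exponent 1/2.\<close>

lemma abs_le_sqrt_mult: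
  fixes z :: real
  assumes "\<bar>z\<bar> \<le> A" "\<bar>z\<bar> \<le> B"
  shows "\<bar>z\<bar> \<le> sqrt (A * B)"
proof (rule real_le_rsqrt)
  have "\<bar>z\<bar>\<^sup>2 \<le> A * B" unfolding power2_eq_square using assms
    by (intro mult_mono) auto
  then show "\<bar>z\<bar>\<^sup>2 \<le> A * B" .
qed

lemma abs_sin_diff_le: "\<bar>sin x - sin y\<bar> \<le> \<bar>x - y :: real\<bar>"
proof -
  have "\<bar>sin x - sin y\<bar> = 2 * \<bar>sin ((x - y) / 2)\<bar> * \<bar>cos ((x + y) / 2)\<bar>"
    by (simp add: sin_diff_sin abs_mult)
  also have "\<dots> \<le> 2 * \<bar>(x - y) / 2\<bar> * 1"
    by (intro mult_mono abs_sin_x_le_abs_x) auto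
  finally show ?thesis by simp
qed

lemma set_integrable_majorant:
  fixes f :: "real \<Rightarrow> real"
  assumes G: "set_integrable lborel S G" and [measurable]: "f \<in> borel_measurable borel" "S \<in> sets borel"
    and bd: "\<And>t. t \<in> S \<Longrightarrow> \<bar>f t\<bar> \<le> C * G t"
  shows "set_integrable lborel S f"
  using set_integrable_mult_right[OF G, of C] unfolding set_integrable_def
proof (rule Bochner_Integration.integrable_bound)
  have "\<bar>f t\<bar> \<le> \<bar>C * G t\<bar>" if "t \<in> S" for t using bd[OF that] by linarith
  then show "AE t in lborel. norm (indicator S t *\<^sub>R f t) \<le> norm (indicator S t *\<^sub>R (C * G t))"
    by (intro AE_I2) (simp add: indicator_def)
qed auto

text \<open>The total of the Hoelder constants: \<open>sqrt n\<close> from the scaling of the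
  argument by \<open>n\<close>, \<open>1 / n^2\<close> from the coefficient.\<close>

lemma summable_sqrt_over_square: "summable (\<lambda>n. sqrt (real (Suc n)) / (real (Suc n))\<^sup>2)"
proof -
  have "summable (\<lambda>n. real n powr (- 3 / 2))" by (subst summable_real_powr_iff) auto
  then have "summable (\<lambda>n. real (Suc n) powr (- 3 / 2))" by (subst summable_Suc_iff)
  moreover have "real (Suc n) powr (- 3 / 2) = sqrt (real (Suc n)) / (real (Suc n))\<^sup>2" for n
  proof -
    have "real (Suc n) powr (- 3 / 2) = real (Suc n) powr (1 / 2 - 2)" by simp
    also have "\<dots> = real (Suc n) powr (1 / 2) / real (Suc n) powr 2" by (rule powr_diff)
    finally show ?thesis by (simp add: powr_half_sqrt del: of_nat_Suc)
  qed
  ultimately show ?thesis by simp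
qed

lemma summable_inverse_square: "summable (\<lambda>n. 1 / (real (Suc n))\<^sup>2)"
  using inverse_squares_sums by (simp add: sums_iff add.commute)

lemma set_integrable_one_over_sqrt: "set_integrable lborel {0<..<c} (\<lambda>t. 1 / sqrt t)"
proof (cases "c \<ge> 0")
  case True
  have "(\<lambda>t. t powr (- (1/2))) absolutely_integrable_on {0..c}"
    by (rule nonnegative_absolutely_integrable_1) (use True in \<open>auto intro!: integrable_on_powr_from_0\<close>)
  then have "set_integrable lebesgue {0<..<c} (\<lambda>t. t powr (- (1/2)))"
    by (rule set_integrable_subset) auto
  also have "?this \<longleftrightarrow> set_integrable lebesgue {0<..<c} (\<lambda>t. 1 / sqrt t)"
    by (rule set_integrable_cong) (simp_all only: powr_minus powr_half_sqrt inverse_eq_divide greaterThanLessThan_iff less_imp_le)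
  finally show ?thesis unfolding set_integrable_def by (subst (asm) integrable_completion) auto
qed simp

lemma set_integrable_one_over_square: "c > 0 \<Longrightarrow> set_integrable lborel {c..} (\<lambda>t::real. 1 / t\<^sup>2)"
proof -
  assume c: "c > 0"
  have "(\<lambda>t. t powr (-2)) absolutely_integrable_on {c..}"
    by (rule nonnegative_absolutely_integrable_1)
       (use c has_integral_powr_to_inf[of "-2" c] in \<open>auto simp: integrable_on_def\<close>)
  also have "?this \<longleftrightarrow> set_integrable lebesgue {c..} (\<lambda>t. 1 / t\<^sup>2)"
    by (rule set_integrable_cong) (use c in \<open>auto simp: powr_minus_divide\<close>)
  finally show ?thesis unfolding set_integrable_def by (subst (asm) integrable_completion) auto
qed

text \<open>Dominates the regular part of the kernel times a bounded function that vanishes like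
  \<open>sqrt t\<close> at 0. The branches meet at 2 rather than 1 because the interval (0, 2) is
  symmetric about the singularity at 1.\<close>

definition pv_majorant :: "real \<Rightarrow> real" where
  "pv_majorant t = (if t < 2 then 1 / sqrt t else 1 / t\<^sup>2)"

lemma pv_majorant_measurable [measurable]: "pv_majorant \<in> borel_measurable borel"
  unfolding pv_majorant_def by measurable

lemma set_integrable_pv_majorant: "set_integrable lborel {0<..} pv_majorant"
proof -
  have "set_integrable lborel ({0<..<2} \<union> {2..}) pv_majorant"
  proof (rule set_integrable_Un)
    show "set_integrable lborel {0<..<2} pv_majorant"
      by (rule set_integrable_majorant[OF set_integrable_one_over_sqrt, where C = 1]) (auto simp: pv_majorant_def)
    show "set_integrable lborel {2..} pv_majorant"
      by (rule set_integrable_majorant[OF set_integrable_one_over_square, where C = 1]) (auto simp: pv_majorant_def)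
  qed auto
  also have "{0<..<2} \<union> {2..} = ({0<..} :: real set)" by auto
  finally show ?thesis .
qed

text \<open>Dominated convergence, as only the null set {c} is lost in the limit. It serves both for
  ordinary integrals read as principal values and for the folded integral below, where the cut is
  around 0.\<close>

lemma set_integral_cut_out_tendsto:
  fixes g :: "real \<Rightarrow> real"
  assumes g: "set_integrable lborel A g" and A: "A \<in> sets borel"
  shows "((\<lambda>\<epsilon>. LBINT t:A - {c - \<epsilon>..c + \<epsilon>}. g t) \<longlongrightarrow> (LBINT t:A. g t)) (at_right 0)"
proof (rule tendsto_at_right_sequentially[of 0 1])
  fix S :: "nat \<Rightarrow> real"
  assume S: "\<And>n. 0 < S n" "S \<longlonglongrightarrow> 0"
  let ?B = "\<lambda>n. A - {c - S n..c + S n}"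
  have int: "set_integrable lborel (?B n) g" for n
    using g by (rule set_integrable_subset) (use A in auto)
  show "(\<lambda>n. LBINT t:?B n. g t) \<longlonglongrightarrow> (LBINT t:A. g t)"
    unfolding set_lebesgue_integral_def
  proof (rule integral_dominated_convergence[where w = "\<lambda>t. norm (indicator A t *\<^sub>R g t)"])
    show "(\<lambda>t. indicator A t *\<^sub>R g t) \<in> borel_measurable lborel"
      using g unfolding set_integrable_def by (rule borel_measurable_integrable)
    show "(\<lambda>t. indicator (?B n) t *\<^sub>R g t) \<in> borel_measurable lborel" for n
      using int[of n] unfolding set_integrable_def by (rule borel_measurable_integrable)
    show "integrable lborel (\<lambda>t. norm (indicator A t *\<^sub>R g t))"
      using g unfolding set_integrable_def by (rule integrable_norm)
    show "AE t in lborel. norm (indicator (?B n) t *\<^sub>R g t) \<le> norm (indicator A t *\<^sub>R g t)" for n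
      by (rule AE_I2) (auto simp: indicator_def)
    show "AE t in lborel. (\<lambda>n. indicator (?B n) t *\<^sub>R g t) \<longlonglongrightarrow> indicator A t *\<^sub>R g t"
      using AE_lborel_singleton[of c]
    proof eventually_elim
      case (elim t)
      have "\<forall>\<^sub>F n in sequentially. S n < \<bar>t - c\<bar>"
        using order_tendstoD(2)[OF S(2), of "\<bar>t - c\<bar>"] elim by auto
      then have "\<forall>\<^sub>F n in sequentially. indicator (?B n) t *\<^sub>R g t = indicator A t *\<^sub>R g t"
        by eventually_elim (auto simp: indicator_def)
      then show ?case by (rule tendsto_eventually)
    qed
  qed
qed simp

lemma has_pv_integral_set_integrable:
  assumes "set_integrable lborel A g" "A \<in> sets borel"
  shows "has_pv_integral g A c (LBINT t:A. g t)"
  unfolding has_pv_integral_def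
  using set_integral_cut_out_tendsto[OF assms] assms
  by (auto intro: set_integrable_subset)

lemma has_pv_integral_diff:
  assumes "has_pv_integral f A c I" "has_pv_integral g A c J"
  shows "has_pv_integral (\<lambda>t. f t - g t) A c (I - J)"
  unfolding has_pv_integral_def
proof (intro conjI allI impI)
  fix \<epsilon> :: real assume "\<epsilon> > 0"
  then show "set_integrable lborel (A - {c - \<epsilon>..c + \<epsilon>}) (\<lambda>t. f t - g t)"
    using assms unfolding has_pv_integral_def by (auto intro: set_integral_diff)
next
  have "((\<lambda>\<epsilon>. (LBINT t:A - {c - \<epsilon>..c + \<epsilon>}. f t) - (LBINT t:A - {c - \<epsilon>..c + \<epsilon>}. g t)) \<longlongrightarrow> I - J) (at_right 0)"
    using assms unfolding has_pv_integral_def by (intro tendsto_diff) auto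
  moreover have "\<forall>\<^sub>F \<epsilon> in at_right 0. (LBINT t:A - {c - \<epsilon>..c + \<epsilon>}. f t) - (LBINT t:A - {c - \<epsilon>..c + \<epsilon>}. g t)
      = (LBINT t:A - {c - \<epsilon>..c + \<epsilon>}. f t - g t)"
    using eventually_at_right_less[of 0]
    by eventually_elim (use assms in \<open>auto simp: has_pv_integral_def set_integral_diff\<close>)
  ultimately show "((\<lambda>\<epsilon>. LBINT t:A - {c - \<epsilon>..c + \<epsilon>}. f t - g t) \<longlongrightarrow> I - J) (at_right 0)"
    by (simp add: tendsto_cong)
qed

lemma has_pv_integral_cong:
  assumes "\<And>t. t \<in> A \<Longrightarrow> f t = g t"
  shows "has_pv_integral f A c I \<longleftrightarrow> has_pv_integral g A c I"
proof -
  have "set_integrable lborel (A - B) f \<longleftrightarrow> set_integrable lborel (A - B) g" for B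
    by (rule set_integrable_cong) (use assms in auto)
  moreover have "(LBINT t:A - B. f t) = (LBINT t:A - B. g t)" for B
    unfolding set_lebesgue_integral_def 
    by (rule Bochner_Integration.integral_cong) (use assms in \<open>auto simp: indicator_def\<close>)
  ultimately show ?thesis by (simp add: has_pv_integral_def)
qed

text \<open>The kernel \<open>1 / (t (1 - t\<^sup>2)) = 1 / t + 1 / (2 (1 - t)) - 1 / (2 (1 + t))\<close>
  without its singular part \<open>1 / (2 (1 - t))\<close> on \<open>(0, 2)\<close>.\<close>
definition pv_weight :: "real \<Rightarrow> real" where
  "pv_weight t = (if t < 2 then 1 / t - 1 / (2 * (1 + t)) else 1 / (t * (1 - t\<^sup>2)))"

lemma pv_weight_measurable [measurable]: "pv_weight \<in> borel_measurable borel"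
  unfolding pv_weight_def by measurable

lemma pv_kernel_decomp:
  assumes "t > 0" "t \<noteq> 1"
  shows "1 / (t * (1 - t\<^sup>2)) = pv_weight t + (if t < 2 then 1 / (2 * (1 - t)) else 0)"
proof -
  have "1 - t\<^sup>2 = (1 - t) * (1 + t)" by (simp add: power2_eq_square algebra_simps)
  moreover have "1 - t \<noteq> 0" "1 + t \<noteq> 0" "t \<noteq> 0" using assms by auto
  ultimately show ?thesis by (simp add: pv_weight_def divide_simps) (simp add: algebra_simps)
qed

lemma abs_pv_weight_le:
  assumes "t > 0"
  shows "t < 2 \<Longrightarrow> \<bar>pv_weight t\<bar> \<le> 1 / t" "t \<ge> 2 \<Longrightarrow> \<bar>pv_weight t\<bar> \<le> 1 / t\<^sup>2"
proof -
  assume "t < 2"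
  have "1 / (2 * (1 + t)) \<le> 1 / t" "0 \<le> 1 / (2 * (1 + t))" using assms by (auto simp: field_simps)
  then show "\<bar>pv_weight t\<bar> \<le> 1 / t" using \<open>t < 2\<close> assms by (simp add: pv_weight_def)
next
  assume t: "t \<ge> 2"
  have "t * 2 \<le> t * t" using t by (intro mult_left_mono) auto
  then have "t \<le> t\<^sup>2 - 1" using t unfolding power2_eq_square by linarith
  then have "t * t \<le> t * (t\<^sup>2 - 1)" using t by (intro mult_left_mono) auto
  then have "1 / (t * (t\<^sup>2 - 1)) \<le> 1 / (t * t)" using t by (intro divide_left_mono) auto
  moreover have "\<bar>t * (1 - t\<^sup>2)\<bar> = t * (t\<^sup>2 - 1)" using t \<open>t \<le> t\<^sup>2 - 1\<close> by (auto simp: abs_mult)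
  ultimately show "\<bar>pv_weight t\<bar> \<le> 1 / t\<^sup>2" using t by (simp add: pv_weight_def power2_eq_square)
qed

lemma sqrt_divide_self: "t \<ge> 0 \<Longrightarrow> sqrt t / t = 1 / sqrt t"
  by (cases "t = 0") (simp_all add: divide_eq_eq real_div_sqrt)

lemma pv_majorant_eq: "0 < t \<Longrightarrow> t < 2 \<Longrightarrow> pv_majorant t = sqrt t / t"
  by (simp add: pv_majorant_def sqrt_divide_self)

text \<open>The singular part \<open>1 / (2 (1 - t))\<close> on (0, 2) is folded at 1: the points 1
  - u and 1 + u combine into a difference quotient which is O(1 / sqrt u) by the Hoelder bound. The
  rest is integrable because \<open>U\<close> vanishes at 0 and is bounded. The value thus consists
  of two ordinary integrals, accessible to dominated convergence.\<close>

lemma has_pv_integral_Hoelder: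
  fixes U :: "real \<Rightarrow> real"
  assumes [measurable]: "U \<in> borel_measurable borel"
    and hol: "\<And>x y. x \<ge> 0 \<Longrightarrow> y \<ge> 0 \<Longrightarrow> \<bar>U x - U y\<bar> \<le> H * sqrt \<bar>x - y\<bar>"
    and U0: "U 0 = 0" and bdd: "\<And>x. x \<ge> 0 \<Longrightarrow> \<bar>U x\<bar> \<le> B"
  shows "has_pv_integral (\<lambda>t. U t / (t * (1 - t\<^sup>2))) {0<..} 1
      ((LBINT t:{0<..}. U t * pv_weight t) + 1 / 2 * (LBINT u:{0<..<1}. (U (1 - u) - U (1 + u)) / u))"
proof -
  have H: "H \<ge> 0" using hol[of 1 0] by simp
  have B: "B \<ge> 0" using bdd[of 0] by simp
  have bd1: "\<bar>U t * pv_weight t\<bar> \<le> (H + B) * pv_majorant t" if t: "t > 0" for t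
  proof (cases "t < 2")
    case True
    have "\<bar>U t\<bar> \<le> H * sqrt t" using hol[of t 0] t U0 by simp
    then have "\<bar>U t\<bar> * \<bar>pv_weight t\<bar> \<le> (H * sqrt t) * (1 / t)"
      using abs_pv_weight_le(1)[OF t True] H t by (intro mult_mono) auto
    also have "\<dots> = H * (sqrt t / t)" by simp
    also have "\<dots> \<le> (H + B) * pv_majorant t" 
      using pv_majorant_eq[OF t True] H B t by (intro mult_mono) auto
    finally show ?thesis by (simp add: abs_mult)
  next
    case False
    have "\<bar>U t\<bar> * \<bar>pv_weight t\<bar> \<le> (H + B) * (1 / t\<^sup>2)"
      using bdd[of t] abs_pv_weight_le(2)[OF t] False H B t by (intro mult_mono) auto
    then show ?thesis using False by (simp add: abs_mult pv_majorant_def)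
  qed
  have int1: "set_integrable lborel {0<..} (\<lambda>t. U t * pv_weight t)"
    by (rule set_integrable_majorant[OF set_integrable_pv_majorant]) (use bd1 in auto)
  have bd2: "\<bar>(U (1 - u) - U (1 + u)) / u\<bar> \<le> 2 * H * (1 / sqrt u)" if u: "0 < u" "u < 1" for u
  proof -
    have "\<bar>U (1 - u) - U (1 + u)\<bar> \<le> H * sqrt \<bar>(1 - u) - (1 + u)\<bar>" using u by (intro hol) auto
    also have "\<dots> = H * (sqrt 2 * sqrt u)" using u by (simp add: real_sqrt_mult)
    also have "\<dots> \<le> H * (2 * sqrt u)" 
      using H u sqrt2_less_2 by (intro mult_left_mono mult_right_mono) auto
    finally have "\<bar>U (1 - u) - U (1 + u)\<bar> / u \<le> H * (2 * sqrt u) / u"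
      using u by (intro divide_right_mono) auto
    also have "\<dots> = 2 * H * (sqrt u / u)" by simp
    also have "sqrt u / u = 1 / sqrt u" using u by (simp add: sqrt_divide_self)
    finally show ?thesis using u by (simp add: abs_divide)
  qed
  have int2: "set_integrable lborel {0<..<1} (\<lambda>u. (U (1 - u) - U (1 + u)) / u)"
    by (rule set_integrable_majorant[OF set_integrable_one_over_sqrt, where C = "2 * H"])
       (use bd2 in \<open>auto simp only: greaterThanLessThan_iff\<close>, measurable)
  let ?S = "\<lambda>\<epsilon>. {0<..} - {1 - \<epsilon>..1 + \<epsilon> :: real}"
  \<comment> \<open>The singular part; away from the cut-out it is bounded by
    \<open>B / (2 * \<epsilon>)\<close> and lives on (0, 2).\<close>
  define g where "g t = (if t < 2 then U t / (2 * (1 - t)) else 0)" for t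
  have [measurable]: "g \<in> borel_measurable borel" unfolding g_def by measurable
  have intg: "set_integrable lborel (?S \<epsilon>) g" if \<epsilon>: "\<epsilon> > 0" for \<epsilon>
  proof -
    have "set_integrable lborel (?S \<epsilon>) (indicator {0<..<2} :: real \<Rightarrow> real)"
    proof -
      have eq: "(\<lambda>t. indicator (?S \<epsilon>) t *\<^sub>R (indicator {0<..<2} t :: real)) = indicator (?S \<epsilon> \<inter> {0<..<2})"
        by (auto simp: indicator_def)
      have "emeasure lborel (?S \<epsilon> \<inter> {0<..<2}) \<le> emeasure lborel {0<..<2::real}"
        by (rule emeasure_mono) auto
      then have "emeasure lborel (?S \<epsilon> \<inter> {0<..<2}) < \<infinity>" by (rule order.strict_trans1) simp
      then show ?thesis unfolding set_integrable_def eq by (intro integrable_real_indicator) auto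
    qed
    then show ?thesis
    proof (rule set_integrable_majorant)
      fix t assume t: "t \<in> ?S \<epsilon>"
      then have "\<bar>U t\<bar> / \<bar>2 * (1 - t)\<bar> \<le> B / (2 * \<epsilon>)"
        using \<epsilon> B bdd[of t] by (intro frac_le) auto
      then show "\<bar>g t\<bar> \<le> B / (2 * \<epsilon>) * indicator {0<..<2} t"
        using t unfolding g_def by (simp add: abs_divide)
    qed auto
  qed
  have fdec: "U t / (t * (1 - t\<^sup>2)) = U t * pv_weight t + g t" if "t > 0" "t \<noteq> 1" for t
    using arg_cong[OF pv_kernel_decomp[OF that], of "\<lambda>x. U t * x"] 
    by (simp add: g_def distrib_left)
  have int1': "set_integrable lborel (?S \<epsilon>) (\<lambda>t. U t * pv_weight t)" for \<epsilon>
    using int1 by (rule set_integrable_subset) auto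
  have fint: "set_integrable lborel (?S \<epsilon>) (\<lambda>t. U t / (t * (1 - t\<^sup>2)))
      \<and> (LBINT t:?S \<epsilon>. U t / (t * (1 - t\<^sup>2))) = (LBINT t:?S \<epsilon>. U t * pv_weight t) + (LBINT t:?S \<epsilon>. g t)"
    if \<epsilon>: "\<epsilon> > 0" for \<epsilon>
  proof -
    have eq: "indicator (?S \<epsilon>) t *\<^sub>R (U t / (t * (1 - t\<^sup>2))) = indicator (?S \<epsilon>) t *\<^sub>R (U t * pv_weight t + g t)" for t
      using fdec[of t] \<epsilon> by (auto simp: indicator_def)
    show ?thesis using set_integral_add[OF int1' intg[OF \<epsilon>]]
      unfolding set_integrable_def set_lebesgue_integral_def eq by simp
  qed
  \<comment> \<open>After t = 1 - u and t = 1 + u the cut around 1 becomes a cut around 0; it is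
    written \<open>{0 - \<epsilon>..0 + \<epsilon>}\<close> to fit
    \<open>set_integral_cut_out_tendsto\<close> with \<open>c = 0\<close>.\<close>
  have gint: "(LBINT t:?S \<epsilon>. g t) = 1 / 2 * (LBINT u:{0<..<1} - {0 - \<epsilon>..0 + \<epsilon>}. (U (1 - u) - U (1 + u)) / u)"
    if \<epsilon>: "0 < \<epsilon>" "\<epsilon> < 1" for \<epsilon>
  proof -
    define h1 where "h1 t = indicator {0<..<1-\<epsilon>} t * g t" for t
    define h2 where "h2 t = indicator {1+\<epsilon><..<2} t * g t" for t
    have sub: "set_integrable lborel {0<..<1-\<epsilon>} g" "set_integrable lborel {1+\<epsilon><..<2} g"
      by (rule set_integrable_subset[OF intg[OF \<epsilon>(1)]]; use \<epsilon> in auto)+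
    then have ih: "integrable lborel h1" "integrable lborel h2"
      by (simp_all add: h1_def[abs_def] h2_def[abs_def] set_integrable_def)
    have "(LBINT t:?S \<epsilon>. g t) = (\<integral>t. h1 t + h2 t \<partial>lborel)"
      unfolding set_lebesgue_integral_def h1_def h2_def
    proof (rule Bochner_Integration.integral_cong)
      fix t show "indicator (?S \<epsilon>) t *\<^sub>R g t = indicator {0<..<1-\<epsilon>} t * g t + indicator {1+\<epsilon><..<2} t * g t"
        using \<epsilon> by (auto simp: indicator_def g_def)
    qed auto
    also have "\<dots> = (\<integral>t. h1 t \<partial>lborel) + (\<integral>t. h2 t \<partial>lborel)" using ih by simp
    also have "(\<integral>t. h1 t \<partial>lborel) = (\<integral>u. h1 (1 - u) \<partial>lborel)"
      using lborel_integral_real_affine[of "-1" h1 1] by simp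
    also have "(\<integral>t. h2 t \<partial>lborel) = (\<integral>u. h2 (1 + u) \<partial>lborel)"
      using lborel_integral_real_affine[of 1 h2 1] by simp
    also have "(\<integral>u. h1 (1 - u) \<partial>lborel) + (\<integral>u. h2 (1 + u) \<partial>lborel) = (\<integral>u. h1 (1 - u) + h2 (1 + u) \<partial>lborel)"
      using ih lborel_integrable_real_affine[OF ih(1), of "-1" 1] lborel_integrable_real_affine[OF ih(2), of 1 1] by simp
    also have "\<dots> = (\<integral>u. indicator ({0<..<1} - {0 - \<epsilon>..0 + \<epsilon>}) u *\<^sub>R (1 / 2 * ((U (1 - u) - U (1 + u)) / u)) \<partial>lborel)"
    proof (rule Bochner_Integration.integral_cong)
      fix u
      show "h1 (1 - u) + h2 (1 + u) = indicator ({0<..<1} - {0 - \<epsilon>..0 + \<epsilon>}) u *\<^sub>R (1 / 2 * ((U (1 - u) - U (1 + u)) / u))"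
      proof (cases "\<epsilon> < u \<and> u < 1")
        case True
        then have "u \<noteq> 0" using \<epsilon> by auto
        then show ?thesis using True \<epsilon> by (simp add: h1_def h2_def g_def field_simps)
      next
        case False
        then show ?thesis using \<epsilon> by (auto simp: h1_def h2_def indicator_def)
      qed
    qed auto
    also have "\<dots> = 1 / 2 * (LBINT u:{0<..<1} - {0 - \<epsilon>..0 + \<epsilon>}. (U (1 - u) - U (1 + u)) / u)"
      by (simp add: set_lebesgue_integral_def flip: Bochner_Integration.integral_mult_right_zero)
    finally show ?thesis .
  qed
  show "has_pv_integral (\<lambda>t. U t / (t * (1 - t\<^sup>2))) {0<..} 1
      ((LBINT t:{0<..}. U t * pv_weight t) + 1 / 2 * (LBINT u:{0<..<1}. (U (1 - u) - U (1 + u)) / u))"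
    unfolding has_pv_integral_def
  proof (intro conjI allI impI)
    fix \<epsilon> :: real assume "\<epsilon> > 0"
    then show "set_integrable lborel ({0<..} - {1 - \<epsilon>..1 + \<epsilon>}) (\<lambda>t. U t / (t * (1 - t\<^sup>2)))"
      using fint by blast
  next
    have "((\<lambda>\<epsilon>. (LBINT t:?S \<epsilon>. U t * pv_weight t) + 1 / 2 * (LBINT u:{0<..<1} - {0 - \<epsilon>..0 + \<epsilon>}. (U (1 - u) - U (1 + u)) / u))
       \<longlongrightarrow> (LBINT t:{0<..}. U t * pv_weight t) + 1 / 2 * (LBINT u:{0<..<1}. (U (1 - u) - U (1 + u)) / u)) (at_right 0)"
      by (intro tendsto_intros set_integral_cut_out_tendsto int1 int2) auto
    moreover have "\<forall>\<^sub>F \<epsilon> in at_right (0::real). 0 < \<epsilon> \<and> \<epsilon> < 1"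
      using eventually_at_right_real[of 0 1] by simp
    then have "\<forall>\<^sub>F \<epsilon> in at_right 0. 
       (LBINT t:?S \<epsilon>. U t * pv_weight t) + 1 / 2 * (LBINT u:{0<..<1} - {0 - \<epsilon>..0 + \<epsilon>}. (U (1 - u) - U (1 + u)) / u)
       = (LBINT t:?S \<epsilon>. U t / (t * (1 - t\<^sup>2)))"
      by eventually_elim (use fint gint in auto)
    ultimately show "((\<lambda>\<epsilon>. LBINT t:?S \<epsilon>. U t / (t * (1 - t\<^sup>2))) \<longlongrightarrow>
      (LBINT t:{0<..}. U t * pv_weight t) + 1 / 2 * (LBINT u:{0<..<1}. (U (1 - u) - U (1 + u)) / u)) (at_right 0)"
      by (rule Lim_transform_eventually)
  qed
qed

section \<open>The sine series\<close>

text \<open>The Bose function times \<open>s\<close>, with its removable singularity filled by the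
  limit at 0. The factor \<open>s\<close> makes it bounded and Lipschitz on the nonnegative axis.
  With parameter \<open>1 / \<alpha>\<close> it also describes the integrand
  \<open>2 * pi * \<alpha> * t / (exp (2 * pi * \<alpha> * t) - 1)\<close> of the interval
  integral.\<close>

definition planck :: "real \<Rightarrow> real \<Rightarrow> real" where
  "planck \<alpha> s = (if s = 0 then \<alpha> / (2 * pi) else s / (exp (2 * pi * s / \<alpha>) - 1))"

lemma planck_measurable [measurable]: "planck \<alpha> \<in> borel_measurable borel"
  unfolding planck_def[abs_def] by measurable

lemma exp_minus_one_le_mult_exp: "exp x - 1 \<le> x * exp (x::real)"
proof -
  have "(1 - x) * exp x \<le> exp (- x) * exp x"
    using exp_ge_add_one_self[of "-x"] by (intro mult_right_mono) auto
  then show ?thesis by (simp add: algebra_simps flip: exp_add)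
qed

lemma planck_bounds:
  assumes "\<alpha> > 0" "s \<ge> 0"
  shows "0 \<le> planck \<alpha> s" "planck \<alpha> s \<le> \<alpha> / (2 * pi)" "\<alpha> / (2 * pi) - planck \<alpha> s \<le> s"
proof -
  define a where "a = 2 * pi / \<alpha>"
  have a: "a > 0" using assms by (simp add: a_def)
  have eq: "planck \<alpha> s = s / (exp (a * s) - 1)" if "s \<noteq> 0" using that by (simp add: planck_def a_def)
  have a': "\<alpha> / (2 * pi) = 1 / a" using assms by (simp add: a_def)
  show "0 \<le> planck \<alpha> s" using assms a by (auto simp: planck_def)
  show "planck \<alpha> s \<le> \<alpha> / (2 * pi)"
  proof (cases "s = 0")
    case False
    then have s: "s > 0" "a * s > 0" using assms a by auto
    have "a * s \<le> exp (a * s) - 1" using exp_ge_add_one_self[of "a * s"] by linarith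
    then have "s / (exp (a * s) - 1) \<le> s / (a * s)" using s a by (intro divide_left_mono mult_pos_pos) auto
    then show ?thesis using False s a by (simp add: eq a')
  qed (simp add: planck_def)
  show "\<alpha> / (2 * pi) - planck \<alpha> s \<le> s"
  proof (cases "s = 0")
    case False
    then have s: "s > 0" "a * s > 0" using assms a by auto
    have E: "exp (a * s) - 1 > 0" using s by simp
    have "exp (a * s) - 1 \<le> (a * s) * exp (a * s)" by (rule exp_minus_one_le_mult_exp)
    then have "1 / a - s / (exp (a * s) - 1) \<le> s" using E a s by (simp add: field_simps)
    then show ?thesis using False by (simp add: eq a')
  qed (simp add: planck_def)
qed

text \<open>Away from 0 the derivative lies in [-1, 0], which reduces to 1 + y <= exp y and exp y -
  1 <= y exp y, so the mean value theorem gives constant 1 for every \<alpha>. The endpoint 0, where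
  the quotient formula fails, is covered by the last of the \<open>planck_bounds\<close>.\<close>

lemma planck_lipschitz:
  assumes \<alpha>: "\<alpha> > 0" and "s \<ge> 0" "s' \<ge> 0"
  shows "\<bar>planck \<alpha> s - planck \<alpha> s'\<bar> \<le> \<bar>s - s'\<bar>"
proof -
  have main: "\<bar>planck \<alpha> s - planck \<alpha> s'\<bar> \<le> \<bar>s - s'\<bar>" if ss: "0 \<le> s" "s < s'" for s s'
  proof (cases "s = 0")
    case True
    have "planck \<alpha> s = \<alpha> / (2 * pi)" using True by (simp add: planck_def)
    then show ?thesis using planck_bounds[OF \<alpha>, of s'] ss True by auto
  next
    case False
    define a where "a = 2 * pi / \<alpha>"
    have a: "a > 0" using \<alpha> by (simp add: a_def)
    define f where "f s = s / (exp (a * s) - 1)" for s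
    define f' where "f' s = ((exp (a * s) - 1) - s * (a * exp (a * s))) / (exp (a * s) - 1)\<^sup>2" for s
    have df: "(f has_real_derivative f' x) (at x)" if "x > 0" for x
      unfolding f_def f'_def using that a
      by (auto intro!: derivative_eq_intros simp: power2_eq_square)
    have bd: "\<bar>f' x\<bar> \<le> 1" if x: "x > 0" for x
    proof -
      define y where "y = a * x"
      have y: "y > 0" using a x by (simp add: y_def)
      then have E: "exp y - 1 > 0" by simp
      have 1: "exp y - 1 \<le> y * exp y" by (rule exp_minus_one_le_mult_exp)
      have 2: "y * exp y - (exp y - 1) \<le> (exp y - 1)\<^sup>2"
      proof -
        have "(1 + y) * exp y \<le> exp y * exp y" 
          using exp_ge_add_one_self[of y] by (intro mult_right_mono) auto
        then show ?thesis by (simp add: power2_eq_square algebra_simps)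
      qed
      have "f' x = - ((y * exp y - (exp y - 1)) / (exp y - 1)\<^sup>2)"
        unfolding f'_def y_def by (simp add: minus_divide_left mult_ac)
      moreover have "0 \<le> (y * exp y - (exp y - 1)) / (exp y - 1)\<^sup>2"
        using 1 by (intro divide_nonneg_nonneg) auto
      moreover have "(y * exp y - (exp y - 1)) / (exp y - 1)\<^sup>2 \<le> 1"
        using 2 E by (simp add: divide_le_eq)
      ultimately show ?thesis by simp
    qed
    have "\<exists>z. s < z \<and> z < s' \<and> f s' - f s = (s' - s) * f' z"
      using ss False by (intro MVT2 df) auto
    then obtain z where z: "s < z" "f s' - f s = (s' - s) * f' z" by blast
    have "\<bar>f s' - f s\<bar> \<le> \<bar>s' - s\<bar> * 1"
      unfolding z(2) abs_mult using bd[of z] z ss by (intro mult_left_mono) auto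
    moreover have "planck \<alpha> s = f s" "planck \<alpha> s' = f s'" using False ss by (auto simp: planck_def f_def a_def)
    ultimately show ?thesis by simp
  qed
  show ?thesis using main[of s s'] main[of s' s] assms by (cases s s' rule: linorder_cases) (auto simp: abs_minus_commute)
qed

lemma planck_hoelder:
  assumes \<alpha>: "\<alpha> > 0" and "s \<ge> 0" "s' \<ge> 0"
  shows "\<bar>planck \<alpha> s - planck \<alpha> s'\<bar> \<le> sqrt (\<alpha> * \<bar>s - s'\<bar>)"
proof (rule abs_le_sqrt_mult)
  have "\<alpha> / (2 * pi) \<le> \<alpha> / 1" using \<alpha> pi_gt3 by (intro divide_left_mono) auto
  then show "\<bar>planck \<alpha> s - planck \<alpha> s'\<bar> \<le> \<alpha>"
    using planck_bounds[OF assms(1,2)] planck_bounds[OF assms(1,3)] by auto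
qed (rule planck_lipschitz[OF assms])

lemma planck_le: "\<alpha> > 0 \<Longrightarrow> s \<ge> 0 \<Longrightarrow> \<bar>planck \<alpha> s\<bar> \<le> \<alpha>"
proof -
  assume *: "\<alpha> > 0" "s \<ge> 0"
  have "\<alpha> / (2 * pi) \<le> \<alpha> / 1" using * pi_gt3 by (intro divide_left_mono) auto
  then show ?thesis using planck_bounds[OF *] by auto
qed

text \<open>This is \<open>t\<close> times the sine series in \<open>M\<close>. Unlike that series it is bounded, and Hoelder
  continuous with exponent \<open>1/2\<close> on \<open>[0, \<infinity>)\<close>.\<close>
definition planck_series :: "real \<Rightarrow> real \<Rightarrow> real \<Rightarrow> real" where
  "planck_series \<alpha> \<nu> t = (\<Sum>n. planck \<alpha> (real (Suc n) * t) / (real (Suc n))\<^sup>2 * sin (2 * pi * real (Suc n) * \<nu> * t))"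

lemma planck_series_measurable [measurable]: "planck_series \<alpha> \<nu> \<in> borel_measurable borel"
  unfolding planck_series_def[abs_def] by measurable

lemma planck_series_term_le:
  assumes "\<alpha> > 0" "t \<ge> 0"
  shows "\<bar>planck \<alpha> (real (Suc n) * t) / (real (Suc n))\<^sup>2 * sin x\<bar> \<le> 1 / (real (Suc n))\<^sup>2 * \<alpha>"
proof -
  have "\<bar>planck \<alpha> (real (Suc n) * t)\<bar> / (real (Suc n))\<^sup>2 * \<bar>sin x\<bar> \<le> \<alpha> / (real (Suc n))\<^sup>2 * 1"
    using assms by (intro mult_mono divide_right_mono planck_le) auto
  then show ?thesis by (simp add: abs_mult)
qed

lemma planck_series_bounds:
  assumes "\<alpha> > 0" "t \<ge> 0"
  shows "summable (\<lambda>n. planck \<alpha> (real (Suc n) * t) / (real (Suc n))\<^sup>2 * sin (2 * pi * real (Suc n) * \<nu> * t))"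
    and "\<bar>planck_series \<alpha> \<nu> t\<bar> \<le> (\<Sum>n. 1 / (real (Suc n))\<^sup>2) * \<alpha>"
  unfolding planck_series_def
  using suminf_dominated_abs_le[OF planck_series_term_le[OF assms] summable_inverse_square, of "\<lambda>n. 2 * pi * real (Suc n) * \<nu> * t"] by auto

lemma abs_sin_diff_le_sqrt: "\<bar>sin x - sin y\<bar> \<le> sqrt (2 * \<bar>x - y\<bar>)" for x y :: real
proof (rule abs_le_sqrt_mult[OF _ abs_sin_diff_le])
  show "\<bar>sin x - sin y\<bar> \<le> 2" using abs_sin_le_one[of x] abs_sin_le_one[of y] by linarith
qed

text \<open>Both factors of the \<open>n\<close>-th term are Hoelder with constant of order
  \<open>sqrt n\<close>: the sine because its frequency is proportional to \<open>n\<close>, the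
  Bose factor because its argument is scaled by \<open>n\<close>. Over \<open>n^2\<close> these
  constants are summable.\<close>

lemma planck_series_hoelder:
  assumes \<alpha>: "\<alpha> > 0"
  obtains H where "\<And>x y. x \<ge> 0 \<Longrightarrow> y \<ge> 0 \<Longrightarrow> 
    \<bar>planck_series \<alpha> \<nu> x - planck_series \<alpha> \<nu> y\<bar> \<le> H * sqrt \<bar>x - y\<bar>"
proof
  \<comment> \<open>First summand: \<open>planck\<close> at most \<alpha>, times the sine increment
    at frequency 2 pi n \<nu>. Second summand: the increment of \<open>planck\<close>, times a sine
    at most 1.\<close>
  define C where "C = \<alpha> * sqrt (4 * pi * \<bar>\<nu>\<bar>) + sqrt \<alpha>"
  let ?w = "\<lambda>n. sqrt (real (Suc n)) / (real (Suc n))\<^sup>2"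
  define f where "f t n = planck \<alpha> (real (Suc n) * t) / (real (Suc n))\<^sup>2 * sin (2 * pi * real (Suc n) * \<nu> * t)" for t n
  fix x y :: real assume xy: "x \<ge> 0" "y \<ge> 0"
  have bd: "\<bar>f x n - f y n\<bar> \<le> ?w n * (C * sqrt \<bar>x - y\<bar>)" for n
  proof -
    define K where "K = real (Suc n)"
    have K: "K > 0" by (simp add: K_def)
    let ?sx = "sin (2 * pi * K * \<nu> * x)" and ?sy = "sin (2 * pi * K * \<nu> * y)"
    let ?px = "planck \<alpha> (K * x)" and ?py = "planck \<alpha> (K * y)"
    have "\<bar>?px * (?sx - ?sy)\<bar> \<le> \<alpha> * sqrt (2 * \<bar>2 * pi * K * \<nu> * x - 2 * pi * K * \<nu> * y\<bar>)"
      unfolding abs_mult using xy K \<alpha>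
      by (intro mult_mono planck_le abs_sin_diff_le_sqrt) auto
    also have "2 * \<bar>2 * pi * K * \<nu> * x - 2 * pi * K * \<nu> * y\<bar> = 4 * pi * \<bar>\<nu>\<bar> * (K * \<bar>x - y\<bar>)"
      using K by (simp add: abs_mult flip: right_diff_distrib)
    finally have 1: "\<bar>?px * (?sx - ?sy)\<bar> \<le> \<alpha> * sqrt (4 * pi * \<bar>\<nu>\<bar>) * (sqrt K * sqrt \<bar>x - y\<bar>)"
      by (simp add: real_sqrt_mult mult_ac)
    have "\<bar>(?px - ?py) * ?sy\<bar> \<le> sqrt (\<alpha> * \<bar>K * x - K * y\<bar>) * 1"
      unfolding abs_mult using xy K \<alpha> by (intro mult_mono planck_hoelder) auto
    also have "\<bar>K * x - K * y\<bar> = K * \<bar>x - y\<bar>" using K by (simp add: abs_mult flip: right_diff_distrib)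
    finally have 2: "\<bar>(?px - ?py) * ?sy\<bar> \<le> sqrt \<alpha> * (sqrt K * sqrt \<bar>x - y\<bar>)"
      by (simp add: real_sqrt_mult)
    have "f x n - f y n = (?px * (?sx - ?sy) + (?px - ?py) * ?sy) / K\<^sup>2"
      by (simp add: f_def K_def algebra_simps add_divide_distrib diff_divide_distrib del: of_nat_Suc)
    then have "\<bar>f x n - f y n\<bar> = \<bar>?px * (?sx - ?sy) + (?px - ?py) * ?sy\<bar> / K\<^sup>2" by simp
    also have "\<dots> \<le> (C * (sqrt K * sqrt \<bar>x - y\<bar>)) / K\<^sup>2"
      using 1 2 unfolding C_def by (intro divide_right_mono) (auto simp: distrib_right)
    finally show ?thesis by (simp add: K_def mult_ac)
  qed
  have "planck_series \<alpha> \<nu> x - planck_series \<alpha> \<nu> y = (\<Sum>n. f x n - f y n)"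
    unfolding planck_series_def f_def using planck_series_bounds(1)[OF \<alpha>] xy by (intro suminf_diff) auto
  also have "\<bar>\<dots>\<bar> \<le> suminf ?w * (C * sqrt \<bar>x - y\<bar>)"
    by (rule suminf_dominated_abs_le(2)[OF bd summable_sqrt_over_square])
  finally show "\<bar>planck_series \<alpha> \<nu> x - planck_series \<alpha> \<nu> y\<bar> \<le> (suminf ?w * C) * sqrt \<bar>x - y\<bar>"
    by (simp add: mult_ac)
qed

text \<open>\<open>planck\<close> absorbs a factor n t in the numerator, hence the square of
  \<open>n\<close> and the extra \<open>1 / t\<close>. This \<open>1 / t\<close> is why the kernel
  becomes \<open>1 / (t * (1 - t\<^sup>2))\<close>, with a second singularity at 0.\<close>

lemma sin_term_eq_planck:
  assumes "t > 0"
  shows "sin_term \<alpha> \<nu> t (Suc n) = 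
    planck \<alpha> (real (Suc n) * t) / (real (Suc n))\<^sup>2 * sin (2 * pi * real (Suc n) * \<nu> * t) / t"
proof -
  define K where "K = real (Suc n)"
  have K: "K > 0" by (simp add: K_def)
  show ?thesis using assms K unfolding sin_term_def planck_def K_def[symmetric]
    by (simp add: power2_eq_square mult_ac)
qed

lemma summable_sin_term:
  assumes "\<alpha> > 0" "t > 0"
  shows "summable (\<lambda>n. sin_term \<alpha> \<nu> t (Suc n))"
  unfolding sin_term_eq_planck[OF assms(2)]
  by (intro summable_divide planck_series_bounds(1)) (use assms in auto)

lemma M_integrand_eq:
  assumes "\<alpha> > 0" "t > 0"
  shows "M_integrand \<alpha> \<nu> t = planck_series \<alpha> \<nu> t / (t * (1 - t\<^sup>2))"
proof -
  have "(\<Sum>n. sin_term \<alpha> \<nu> t (Suc n)) = planck_series \<alpha> \<nu> t / t"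
    unfolding sin_term_eq_planck[OF assms(2)] planck_series_def
    by (intro suminf_divide planck_series_bounds(1)) (use assms in auto)
  then show ?thesis by (simp add: M_integrand_def)
qed

text \<open>The explicit value supplied by \<open>has_pv_integral_Hoelder\<close> for
  \<open>planck_series\<close>; it replaces the description operator in \<open>pv_integral\<close>
  from here on.\<close>

definition pv_value :: "real \<Rightarrow> real \<Rightarrow> real" where
  "pv_value \<alpha> \<nu> = (LBINT t:{0<..}. planck_series \<alpha> \<nu> t * pv_weight t) +
     1 / 2 * (LBINT u:{0<..<1}. (planck_series \<alpha> \<nu> (1 - u) - planck_series \<alpha> \<nu> (1 + u)) / u)"

lemma planck_series_0 [simp]: "planck_series \<alpha> \<nu> 0 = 0"
  by (simp add: planck_series_def)

lemma has_pv_integral_M_integrand: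
  assumes \<alpha>: "\<alpha> > 0"
  shows "has_pv_integral (M_integrand \<alpha> \<nu>) {0<..} 1 (pv_value \<alpha> \<nu>)"
proof -
  obtain H where H: "\<And>x y. x \<ge> 0 \<Longrightarrow> y \<ge> 0 \<Longrightarrow> 
    \<bar>planck_series \<alpha> \<nu> x - planck_series \<alpha> \<nu> y\<bar> \<le> H * sqrt \<bar>x - y\<bar>"
    using planck_series_hoelder[OF \<alpha>] by blast
  have "has_pv_integral (\<lambda>t. planck_series \<alpha> \<nu> t / (t * (1 - t\<^sup>2))) {0<..} 1 (pv_value \<alpha> \<nu>)"
    unfolding pv_value_def
    by (rule has_pv_integral_Hoelder[OF planck_series_measurable H planck_series_0 planck_series_bounds(2)[OF \<alpha>]])
  then show "has_pv_integral (M_integrand \<alpha> \<nu>) {0<..} 1 (pv_value \<alpha> \<nu>)"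
    by (subst has_pv_integral_cong[OF M_integrand_eq[OF \<alpha>]]) auto
qed

section \<open>The limit of the principal value\<close>

lemma set_integral_sin_over: 
  assumes "\<theta> > 0"
  shows "(LBINT t:{0<..<1}. sin (\<theta> * t) / t) = Si \<theta>"
  using LBINT_I0c_sin_scale_divide[of 1 \<theta>] assms
  by (simp add: interval_lebesgue_integral_def einterval_eq zero_ereal_def mult.commute)

text \<open>The model for both singularities, with the Bose factor frozen to a constant
  \<open>a n\<close>. Integrability comes from |sin x| <= sqrt (2 |x|), which leaves the summable
  weight times \<open>1 / sqrt t\<close>; the value is termwise the sine integral.\<close>

lemma sinc_series:
  fixes a :: "nat \<Rightarrow> real"
  assumes a: "\<And>n. \<bar>a n\<bar> \<le> A / (real (Suc n))\<^sup>2"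
  shows "set_integrable lborel {0<..<1} (\<lambda>t. \<Sum>n. a n * (sin (2 * pi * real (Suc n) * \<mu> * t) / t))"
    and "\<mu> > 0 \<Longrightarrow> (LBINT t:{0<..<1}. \<Sum>n. a n * (sin (2 * pi * real (Suc n) * \<mu> * t) / t))
      = (\<Sum>n. a n * Si (2 * pi * real (Suc n) * \<mu>))"
proof -
  let ?w = "\<lambda>n. sqrt (real (Suc n)) / (real (Suc n))\<^sup>2"
  define C where "C = A * sqrt (4 * pi * \<bar>\<mu>\<bar>)"
  have G: "set_integrable lborel {0<..<1} (\<lambda>t. C * (1 / sqrt t))"
    by (intro set_integrable_mult_right set_integrable_one_over_sqrt)
  have bd: "\<bar>a n * (sin (2 * pi * real (Suc n) * \<mu> * t) / t)\<bar> \<le> ?w n * (C * (1 / sqrt t))"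
    if t: "t \<in> {0<..<1}" for n t
  proof -
    define K where "K = real (Suc n)"
    have K: "K > 0" by (simp add: K_def)
    have "\<bar>a n\<bar> * (\<bar>sin (2 * pi * K * \<mu> * t)\<bar> / t) \<le> A / K\<^sup>2 * (sqrt (2 * \<bar>2 * pi * K * \<mu> * t\<bar>) / t)"
      using abs_sin_diff_le_sqrt[of "2 * pi * K * \<mu> * t" 0] a[of n] t
      by (intro mult_mono divide_right_mono) (auto simp: K_def)
    also have "2 * \<bar>2 * pi * K * \<mu> * t\<bar> = 4 * pi * \<bar>\<mu>\<bar> * K * t"
      using K t by (simp add: abs_mult)
    also have "A / K\<^sup>2 * (sqrt (4 * pi * \<bar>\<mu>\<bar> * K * t) / t) = (sqrt K / K\<^sup>2) * (C * (sqrt t / t))"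
      unfolding C_def real_sqrt_mult by (simp only: times_divide_eq_left times_divide_eq_right mult_ac)
    also have "sqrt t / t = 1 / sqrt t" using t by (simp add: sqrt_divide_self)
    finally show ?thesis using t by (simp add: K_def abs_mult)
  qed
  note sw = set_integral_sums_dominated[OF _ _ bd summable_sqrt_over_square G]
  show "set_integrable lborel {0<..<1} (\<lambda>t. \<Sum>n. a n * (sin (2 * pi * real (Suc n) * \<mu> * t) / t))"
    by (rule sw(2)) auto
  have "(\<lambda>n. LBINT t:{0<..<1}. a n * (sin (2 * pi * real (Suc n) * \<mu> * t) / t)) sums
     (LBINT t:{0<..<1}. \<Sum>n. a n * (sin (2 * pi * real (Suc n) * \<mu> * t) / t))"
    by (rule sw(3)) auto
  moreover assume "\<mu> > 0"
  then have "(LBINT t:{0<..<1}. a n * (sin (2 * pi * real (Suc n) * \<mu> * t) / t)) = a n * Si (2 * pi * real (Suc n) * \<mu>)" for n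
    by (subst set_integral_mult_right, subst set_integral_sin_over) (auto simp del: of_nat_Suc)
  ultimately show "(LBINT t:{0<..<1}. \<Sum>n. a n * (sin (2 * pi * real (Suc n) * \<mu> * t) / t))
      = (\<Sum>n. a n * Si (2 * pi * real (Suc n) * \<mu>))" by (simp add: sums_iff)
qed

text \<open>\<open>Si\<close> is bounded and tends to pi / 2 at infinity, so Tannery's theorem
  applies. This is the only source of nonzero contributions to the limit of the principal
  value.\<close>

lemma sinc_series_tendsto:
  fixes a :: "nat \<Rightarrow> real"
  assumes a: "\<And>n. \<bar>a n\<bar> \<le> A / (real (Suc n))\<^sup>2"
  shows "(\<lambda>N. LBINT t:{0<..<1}. \<Sum>n. a n * (sin (2 * pi * real (Suc n) * (\<nu> + real N) * t) / t))
    \<longlonglongrightarrow> (\<Sum>n. a n) * (pi / 2)"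
proof -
  have \<mu>: "filterlim (\<lambda>N. \<nu> + real N) at_top sequentially"
    by (rule filterlim_tendsto_add_at_top[OF tendsto_const filterlim_real_sequentially])
  obtain B where B: "\<And>T. \<bar>Si T\<bar> \<le> B" using bounded_Si by blast
  have A: "A \<ge> 0" using a[of 0] by simp
  have lim: "(\<lambda>N. a n * Si (2 * pi * real (Suc n) * (\<nu> + real N))) \<longlonglongrightarrow> a n * (pi / 2)" for n
    by (intro tendsto_mult tendsto_const filterlim_compose[OF Si_at_top]
        filterlim_tendsto_pos_mult_at_top[OF tendsto_const _ \<mu>]) (auto simp del: of_nat_Suc)
  have bd: "\<forall>\<^sub>F (n, N) in at_top \<times>\<^sub>F sequentially. 
      norm (a n * Si (2 * pi * real (Suc n) * (\<nu> + real N))) \<le> 1 / (real (Suc n))\<^sup>2 * (A * B)"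
  proof (intro always_eventually allI, clarify)
    fix n N
    have "\<bar>a n\<bar> * \<bar>Si (2 * pi * real (Suc n) * (\<nu> + real N))\<bar> \<le> A / (real (Suc n))\<^sup>2 * B"
      using A by (intro mult_mono a B) auto
    then show "norm (a n * Si (2 * pi * real (Suc n) * (\<nu> + real N))) \<le> 1 / (real (Suc n))\<^sup>2 * (A * B)"
      by (simp add: abs_mult)
  qed
  have sm: "summable a"
    by (rule suminf_dominated_abs_le(1)[OF _ summable_inverse_square, of _ A]) (use a in simp)
  have "(\<lambda>N. \<Sum>n. a n * Si (2 * pi * real (Suc n) * (\<nu> + real N))) \<longlonglongrightarrow> (\<Sum>n. a n * (pi / 2))"
    using tannerys_theorem[OF lim bd summable_mult2[OF summable_inverse_square]] by simp
  also have "(\<Sum>n. a n * (pi / 2)) = (\<Sum>n. a n) * (pi / 2)" by (rule suminf_mult2[OF sm, symmetric])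
  finally have "(\<lambda>N. \<Sum>n. a n * Si (2 * pi * real (Suc n) * (\<nu> + real N))) \<longlonglongrightarrow> (\<Sum>n. a n) * (pi / 2)" .
  \<comment> \<open>The evaluation by \<open>Si\<close> requires a positive frequency, and \<nu> + N
    is positive only eventually.\<close>
  moreover have "\<forall>\<^sub>F N in sequentially. (\<Sum>n. a n * Si (2 * pi * real (Suc n) * (\<nu> + real N)))
      = (LBINT t:{0<..<1}. \<Sum>n. a n * (sin (2 * pi * real (Suc n) * (\<nu> + real N) * t) / t))"
    using filterlim_at_top_dense[THEN iffD1, OF \<mu>, rule_format, of 0]
    by eventually_elim (use sinc_series(2)[OF a] in simp)
  ultimately show ?thesis by (rule Lim_transform_eventually)
qed

lemma cos_term_eq_planck:
  "cos_term \<alpha> \<nu> (Suc n) = planck \<alpha> (real (Suc n)) / (real (Suc n))\<^sup>2 * cos (2 * pi * real (Suc n) * \<nu>)"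
proof -
  define K where "K = real (Suc n)"
  have K: "K > 0" by (simp add: K_def)
  show ?thesis using K unfolding cos_term_def planck_def K_def[symmetric]
    by (simp add: power2_eq_square mult_ac)
qed

lemma planck_cos_le: "\<alpha> > 0 \<Longrightarrow> \<bar>planck \<alpha> (real (Suc n)) / (real (Suc n))\<^sup>2 * cos x\<bar> \<le> \<alpha> / (real (Suc n))\<^sup>2"
proof -
  assume "\<alpha> > 0"
  then have "\<bar>planck \<alpha> (real (Suc n))\<bar> / (real (Suc n))\<^sup>2 * \<bar>cos x\<bar> \<le> \<alpha> / (real (Suc n))\<^sup>2 * 1"
    by (intro mult_mono divide_right_mono planck_le) auto
  then show ?thesis by (simp add: abs_mult)
qed

lemma summable_cos_term: "\<alpha> > 0 \<Longrightarrow> summable (\<lambda>n. cos_term \<alpha> \<nu> (Suc n))"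
  unfolding cos_term_eq_planck
  by (rule suminf_dominated_abs_le(1)[OF _ summable_inverse_square, of _ \<alpha>])
     (use planck_cos_le in simp)

lemma cesaro_planck_series_origin:
  assumes \<alpha>: "\<alpha> > 0"
  shows "(\<lambda>K. (\<Sum>N<K. LBINT t:{0<..}. planck_series \<alpha> (\<nu> + real N) t * pv_weight t) / real K)
    \<longlonglongrightarrow> pi\<^sup>2 * \<alpha> / 24"
proof -
  define c0 where "c0 = \<alpha> / (2 * pi)"
  have c0: "planck \<alpha> 0 = c0" by (simp add: planck_def c0_def)
  have c0b: "\<bar>c0\<bar> \<le> \<alpha>" using planck_le[OF \<alpha>, of 0] c0 by simp
  let ?w = "\<lambda>n. sqrt (real (Suc n)) / (real (Suc n))\<^sup>2"
  \<comment> \<open>\<open>sqrt \<alpha>\<close> pays for the Hoelder increment of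
    \<open>planck\<close> at 0, \<alpha> for the bounded part of the weight and for the range t >=
    1.\<close>
  define C where "C = sqrt \<alpha> + \<alpha>"
  have C: "C \<ge> 0" "C \<ge> \<alpha>" using \<alpha> by (auto simp: C_def)
  define d where "d n t = (planck \<alpha> (real (Suc n) * t) * pv_weight t - (if t < 1 then c0 / t else 0)) / (real (Suc n))\<^sup>2" for n t
  have [measurable]: "d n \<in> borel_measurable borel" for n unfolding d_def[abs_def] by measurable
  have dbd: "\<bar>d n t\<bar> \<le> ?w n * (C * pv_majorant t)" if "t \<in> {0<..}" for n t
  proof -
    define K where "K = real (Suc n)"
    have K: "K \<ge> 1" by (simp add: K_def)
    then have sK: "sqrt K \<ge> 1" by simp
    have t: "t > 0" using that by simp
    have p: "\<bar>planck \<alpha> (K * t)\<bar> \<le> \<alpha>" using \<alpha> K t by (intro planck_le) auto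
    have M0: "pv_majorant t \<ge> 0" using t by (auto simp: pv_majorant_def)
    have "\<bar>planck \<alpha> (K * t) * pv_weight t - (if t < 1 then c0 / t else 0)\<bar> \<le> sqrt K * (C * pv_majorant t)"
    proof (cases "t < 1")
      case True
      have eq: "planck \<alpha> (K * t) * pv_weight t - (if t < 1 then c0 / t else 0) =
          (planck \<alpha> (K * t) - planck \<alpha> 0) / t - planck \<alpha> (K * t) / (2 * (1 + t))"
        using True by (simp add: pv_weight_def c0 diff_divide_distrib right_diff_distrib)
      have "\<bar>(planck \<alpha> (K * t) - planck \<alpha> 0) / t\<bar> \<le> sqrt (\<alpha> * \<bar>K * t - 0\<bar>) / t"
        unfolding abs_divide using planck_hoelder[OF \<alpha>, of "K * t" 0] t K
        by (simp add: divide_right_mono)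
      also have "\<dots> = sqrt K * (sqrt \<alpha> * (sqrt t / t))" using K t by (simp add: real_sqrt_mult abs_mult)
      finally have 1: "\<bar>(planck \<alpha> (K * t) - planck \<alpha> 0) / t\<bar> \<le> sqrt K * (sqrt \<alpha> * pv_majorant t)"
        using pv_majorant_eq[OF t] True by simp
      have "1 \<le> pv_majorant t" using True t real_sqrt_le_1_iff[of t] by (simp add: pv_majorant_def)
      then have "1 * (\<alpha> * 1) \<le> sqrt K * (\<alpha> * pv_majorant t)"
        using sK \<alpha> by (intro mult_mono) auto
      moreover have "\<bar>planck \<alpha> (K * t)\<bar> / \<bar>2 * (1 + t)\<bar> \<le> \<alpha> / 1"
        using p t \<alpha> by (intro frac_le) auto
      ultimately have 2: "\<bar>planck \<alpha> (K * t) / (2 * (1 + t))\<bar> \<le> sqrt K * (\<alpha> * pv_majorant t)"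
        unfolding abs_divide by linarith
      show ?thesis unfolding eq C_def using 1 2 abs_triangle_ineq4[of "(planck \<alpha> (K * t) - planck \<alpha> 0) / t" "planck \<alpha> (K * t) / (2 * (1 + t))"]
        by (simp add: distrib_left distrib_right)
    next
      case t1: False
      have "\<bar>pv_weight t\<bar> \<le> pv_majorant t"
      proof (cases "t < 2")
        case True
        have "sqrt t \<ge> 1" using t1 by simp
        then have "1 / t \<le> sqrt t / t" using t by (intro divide_right_mono) auto
        then show ?thesis using abs_pv_weight_le(1)[OF t True] pv_majorant_eq[OF t True] by simp
      next
        case False
        then show ?thesis using abs_pv_weight_le(2)[OF t] by (simp add: pv_majorant_def)
      qed
      then have "\<bar>planck \<alpha> (K * t)\<bar> * \<bar>pv_weight t\<bar> \<le> C * pv_majorant t"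
        using p C \<alpha> by (intro mult_mono) auto
      also have "\<dots> \<le> sqrt K * (C * pv_majorant t)" 
        using mult_right_mono[OF sK, of "C * pv_majorant t"] C M0 by simp
      finally show ?thesis using t1 by (simp add: abs_mult)
    qed
    then have "\<bar>d n t\<bar> \<le> (sqrt K * (C * pv_majorant t)) / K\<^sup>2"
      unfolding d_def abs_divide K_def by (intro order_trans[OF eq_refl divide_right_mono]) auto
    then show ?thesis by (simp add: K_def)
  qed
  have G: "set_integrable lborel {0<..} (\<lambda>t. C * pv_majorant t)"
    by (intro set_integrable_mult_right set_integrable_pv_majorant)
  \<comment> \<open>The phase at parameter \<nu> + N splits into a fixed phase and N equal steps, as
    \<open>cesaro_Riemann_Lebesgue\<close> requires.\<close>
  define \<phi> where "\<phi> n t = 2 * pi * real (Suc n) * \<nu> * t" for n :: nat and t :: real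
  have [measurable]: "\<phi> n \<in> borel_measurable borel" for n unfolding \<phi>_def[abs_def] by measurable
  have RL: "(\<lambda>K. (\<Sum>N<K. LBINT t:{0<..}. \<Sum>n. d n t * sin (\<phi> n t + real N * (2 * pi * real (Suc n) * t))) / real K) \<longlonglongrightarrow> 0"
    by (rule cesaro_Riemann_Lebesgue[OF _ _ _ dbd summable_sqrt_over_square G]) auto
  have ph: "\<phi> n t + real N * (2 * pi * real (Suc n) * t) = 2 * pi * real (Suc n) * (\<nu> + real N) * t" for n t N
    by (simp add: \<phi>_def algebra_simps del: of_nat_Suc)
  define a where "a n = c0 / (real (Suc n))\<^sup>2" for n
  have a: "\<bar>a n\<bar> \<le> \<alpha> / (real (Suc n))\<^sup>2" for n
    unfolding a_def abs_divide using c0b by (intro order_trans[OF eq_refl divide_right_mono]) auto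
  note sl = sinc_series_tendsto[OF a, of \<nu>]
  have dec: "(LBINT t:{0<..}. planck_series \<alpha> (\<nu> + real N) t * pv_weight t) =
     (LBINT t:{0<..}. \<Sum>n. d n t * sin (\<phi> n t + real N * (2 * pi * real (Suc n) * t))) +
     (LBINT t:{0<..<1}. \<Sum>n. a n * (sin (2 * pi * real (Suc n) * (\<nu> + real N) * t) / t))" for N
  proof -
    let ?s = "\<lambda>n t. sin (2 * pi * real (Suc n) * (\<nu> + real N) * t)"
    have db: "\<bar>d n t * ?s n t\<bar> \<le> ?w n * (C * pv_majorant t)" if "t \<in> {0<..}" for n t
    proof -
      have "\<bar>d n t\<bar> * \<bar>?s n t\<bar> \<le> \<bar>d n t\<bar> * 1" by (intro mult_left_mono) auto
      then show ?thesis using dbd[OF that, of n] by (simp add: abs_mult)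
    qed
    have i1: "set_integrable lborel {0<..} (\<lambda>t. \<Sum>n. d n t * ?s n t)"
      by (rule set_integral_sums_dominated(2)[OF _ _ db summable_sqrt_over_square G]) auto
    have i2: "set_integrable lborel {0<..<1} (\<lambda>t. \<Sum>n. a n * (?s n t / t))"
      by (rule sinc_series(1)[OF a])
    have pt: "indicator {0<..} t *\<^sub>R (planck_series \<alpha> (\<nu> + real N) t * pv_weight t) =
      indicator {0<..} t *\<^sub>R (\<Sum>n. d n t * ?s n t) + indicator {0<..<1} t *\<^sub>R (\<Sum>n. a n * (?s n t / t))" for t
    proof (cases "t > 0")
      case t: True
      have ds: "summable (\<lambda>n. d n t * ?s n t)"
        by (rule suminf_dominated_abs_le(1)[OF db summable_sqrt_over_square]) (use t in auto)
      have "planck_series \<alpha> (\<nu> + real N) t * pv_weight t = 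
         (\<Sum>n. planck \<alpha> (real (Suc n) * t) / (real (Suc n))\<^sup>2 * ?s n t * pv_weight t)"
        unfolding planck_series_def using planck_series_bounds(1)[OF \<alpha>] t by (intro suminf_mult2) auto
      also have "\<dots> = (\<Sum>n. d n t * ?s n t + (if t < 1 then 1 else 0) * (a n * (?s n t / t)))"
        by (rule suminf_cong) (simp add: d_def a_def diff_divide_distrib left_diff_distrib)
      also have "\<dots> = (\<Sum>n. d n t * ?s n t) + (\<Sum>n. (if t < 1 then 1 else 0) * (a n * (?s n t / t)))"
      proof (rule suminf_add[symmetric, OF ds])
        have "\<bar>a n * (?s n t / t)\<bar> \<le> 1 / (real (Suc n))\<^sup>2 * (\<alpha> / t)" for n
        proof -
          have "\<bar>a n\<bar> * (\<bar>?s n t\<bar> / t) \<le> \<alpha> / (real (Suc n))\<^sup>2 * (1 / t)"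
            using t \<alpha> by (intro mult_mono a divide_right_mono) auto
          then show ?thesis using t by (simp add: abs_mult)
        qed
        then have "summable (\<lambda>n. a n * (?s n t / t))"
          by (rule suminf_dominated_abs_le(1)[OF _ summable_inverse_square])
        then show "summable (\<lambda>n. (if t < 1 then 1 else 0) * (a n * (?s n t / t)))"
          by (rule summable_mult)
      qed
      finally show ?thesis using t by (auto simp: indicator_def)
    qed simp
    have "(LBINT t:{0<..}. planck_series \<alpha> (\<nu> + real N) t * pv_weight t) =
      (\<integral>t. indicator {0<..} t *\<^sub>R (\<Sum>n. d n t * ?s n t) + indicator {0<..<1} t *\<^sub>R (\<Sum>n. a n * (?s n t / t)) \<partial>lborel)"
      unfolding set_lebesgue_integral_def pt ..
    also have "\<dots> = (LBINT t:{0<..}. \<Sum>n. d n t * ?s n t) + (LBINT t:{0<..<1}. \<Sum>n. a n * (?s n t / t))"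
      unfolding set_lebesgue_integral_def 
      by (rule Bochner_Integration.integral_add) (use i1 i2 in \<open>auto simp only: set_integrable_def\<close>)
    finally show ?thesis unfolding ph .
  qed
  have suma: "(\<Sum>n. a n) * (pi / 2) = pi\<^sup>2 * \<alpha> / 24"
  proof -
    have "(\<Sum>n. a n) = c0 * (pi\<^sup>2 / 6)"
      using sums_mult[OF inverse_squares_sums, of c0] by (simp add: sums_iff a_def[abs_def] add.commute)
    then show ?thesis using pi_gt_zero by (simp add: c0_def power2_eq_square mult_ac)
  qed
  have "(\<lambda>K. (\<Sum>N<K. LBINT t:{0<..}. planck_series \<alpha> (\<nu> + real N) t * pv_weight t) / real K)
    \<longlonglongrightarrow> 0 + (\<Sum>n. a n) * (pi / 2)"
    unfolding dec sum.distrib add_divide_distrib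
    by (rule tendsto_add[OF RL cesaro_tendsto[OF sl]])
  then show ?thesis by (simp only: suma add_0)
qed

lemma sin_cos_plus_of_nat_2pi:
  fixes x :: real
  shows "sin (x + real n * (2 * pi)) = sin x" "cos (x + real n * (2 * pi)) = cos x"
  using sin.plus_of_nat[of x n] cos.plus_of_nat[of x n] by (simp_all only: of_real_eq_id id_apply)

text \<open>Here \<open>planck\<close> is frozen at t = 1. The two frozen sines satisfy sin (x (1 -
  u)) - sin (x (1 + u)) = - 2 cos x sin (x u), and cos x with x = 2 pi n (\<nu> + N) does not depend
  on N. Divided by u this is a \<open>sinc_series\<close> with coefficients -2
  \<open>cos_term\<close>, whence the factor - pi. The increments of \<open>planck\<close> over u
  are integrable and average to 0.\<close>

lemma cesaro_planck_series_one:
  assumes \<alpha>: "\<alpha> > 0"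
  shows "(\<lambda>K. (\<Sum>N<K. LBINT u:{0<..<1}. (planck_series \<alpha> (\<nu> + real N) (1 - u) - planck_series \<alpha> (\<nu> + real N) (1 + u)) / u) / real K)
    \<longlonglongrightarrow> - pi * (\<Sum>n. cos_term \<alpha> \<nu> (Suc n))"
proof -
  let ?w = "\<lambda>n. sqrt (real (Suc n)) / (real (Suc n))\<^sup>2"
  let ?c = "\<lambda>n u. planck \<alpha> (real (Suc n) * (1 + u)) - planck \<alpha> (real (Suc n))"
  define d1 where "d1 n u = - (?c n (- u) / (real (Suc n))\<^sup>2 / u)" for n u
  define d2 where "d2 n u = - (?c n u / (real (Suc n))\<^sup>2 / u)" for n u
  \<comment> \<open>Modulo 2 pi, N enters the phase at 1 - u through the step - 2 pi n u. The sine
    is therefore negated to obtain positive steps, and \<open>d1\<close> carries the compensating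
    sign; the sign in \<open>d2\<close> is that of the difference.\<close>
  define \<phi>1 where "\<phi>1 n u = - (2 * pi * real (Suc n) * \<nu> * (1 - u))" for n :: nat and u :: real
  define \<phi>2 where "\<phi>2 n u = 2 * pi * real (Suc n) * \<nu> * (1 + u)" for n :: nat and u :: real
  have [measurable]: "d1 n \<in> borel_measurable borel" "d2 n \<in> borel_measurable borel"
    "\<phi>1 n \<in> borel_measurable borel" "\<phi>2 n \<in> borel_measurable borel" for n 
    unfolding d1_def[abs_def] d2_def[abs_def] \<phi>1_def[abs_def] \<phi>2_def[abs_def] by measurable
  have cbd: "\<bar>?c n v / (real (Suc n))\<^sup>2 / u\<bar> \<le> ?w n * (sqrt \<alpha> * (1 / sqrt u))"
    if u: "u \<in> {0<..<1}" "v = u \<or> v = - u" for n u v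
  proof -
    define K where "K = real (Suc n)"
    have K: "K > 0" by (simp add: K_def)
    have "\<bar>planck \<alpha> (K * (1 + v)) - planck \<alpha> K\<bar> \<le> sqrt (\<alpha> * \<bar>K * (1 + v) - K\<bar>)"
      using u K by (intro planck_hoelder[OF \<alpha>]) auto
    also have "\<bar>K * (1 + v) - K\<bar> = K * u" using u K by (auto simp: algebra_simps)
    finally have "\<bar>planck \<alpha> (K * (1 + v)) - planck \<alpha> K\<bar> / K\<^sup>2 / u \<le> sqrt (\<alpha> * (K * u)) / K\<^sup>2 / u"
      using u by (intro divide_right_mono) auto
    also have "\<dots> = sqrt K / K\<^sup>2 * (sqrt \<alpha> * (sqrt u / u))" by (simp add: real_sqrt_mult)
    also have "sqrt u / u = 1 / sqrt u" using u by (simp add: sqrt_divide_self)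
    finally show ?thesis using u by (simp add: K_def)
  qed
  have d1: "\<bar>d1 n u\<bar> \<le> ?w n * (sqrt \<alpha> * (1 / sqrt u))" if "u \<in> {0<..<1}" for n u
    using cbd[OF that, of "- u" n] by (simp add: d1_def)
  have d2: "\<bar>d2 n u\<bar> \<le> ?w n * (sqrt \<alpha> * (1 / sqrt u))" if "u \<in> {0<..<1}" for n u
    using cbd[OF that, of u n] by (simp add: d2_def)
  have G: "set_integrable lborel {0<..<1} (\<lambda>u. sqrt \<alpha> * (1 / sqrt u))"
    by (intro set_integrable_mult_right set_integrable_one_over_sqrt)
  have RL1: "(\<lambda>K. (\<Sum>N<K. LBINT u:{0<..<1}. \<Sum>n. d1 n u * sin (\<phi>1 n u + real N * (2 * pi * real (Suc n) * u))) / real K) \<longlonglongrightarrow> 0"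
    by (rule cesaro_Riemann_Lebesgue[OF _ _ _ d1 summable_sqrt_over_square G]) auto
  have RL2: "(\<lambda>K. (\<Sum>N<K. LBINT u:{0<..<1}. \<Sum>n. d2 n u * sin (\<phi>2 n u + real N * (2 * pi * real (Suc n) * u))) / real K) \<longlonglongrightarrow> 0"
    by (rule cesaro_Riemann_Lebesgue[OF _ _ _ d2 summable_sqrt_over_square G]) auto
  define a where "a n = - 2 * cos_term \<alpha> \<nu> (Suc n)" for n
  have a: "\<bar>a n\<bar> \<le> (2 * \<alpha>) / (real (Suc n))\<^sup>2" for n
    using planck_cos_le[OF \<alpha>, of n "2 * pi * real (Suc n) * \<nu>"]
    unfolding a_def cos_term_eq_planck by (simp add: abs_mult)
  note sl = sinc_series_tendsto[OF a, of \<nu>]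
  have s1: "sin (\<phi>1 n u + real N * (2 * pi * real (Suc n) * u)) = - sin (2 * pi * real (Suc n) * (\<nu> + real N) * (1 - u))" for n u N
  proof -
    have "- sin (2 * pi * real (Suc n) * (\<nu> + real N) * (1 - u)) = sin (- (2 * pi * real (Suc n) * (\<nu> + real N) * (1 - u)) + real (Suc n * N) * (2 * pi))"
      by (simp only: sin_cos_plus_of_nat_2pi sin_minus)
    also have "- (2 * pi * real (Suc n) * (\<nu> + real N) * (1 - u)) + real (Suc n * N) * (2 * pi) = \<phi>1 n u + real N * (2 * pi * real (Suc n) * u)"
      by (simp add: \<phi>1_def algebra_simps)
    finally show ?thesis by simp
  qed
  have s2: "sin (\<phi>2 n u + real N * (2 * pi * real (Suc n) * u)) = sin (2 * pi * real (Suc n) * (\<nu> + real N) * (1 + u))" for n u N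
  proof -
    have "sin (\<phi>2 n u + real N * (2 * pi * real (Suc n) * u)) = sin (\<phi>2 n u + real N * (2 * pi * real (Suc n) * u) + real (Suc n * N) * (2 * pi))"
      by (simp only: sin_cos_plus_of_nat_2pi)
    also have "\<phi>2 n u + real N * (2 * pi * real (Suc n) * u) + real (Suc n * N) * (2 * pi) = 2 * pi * real (Suc n) * (\<nu> + real N) * (1 + u)"
      by (simp add: \<phi>2_def algebra_simps)
    finally show ?thesis .
  qed
  have c1: "cos (2 * pi * real (Suc n) * (\<nu> + real N)) = cos (2 * pi * real (Suc n) * \<nu>)" for n N
  proof -
    have "2 * pi * real (Suc n) * (\<nu> + real N) = 2 * pi * real (Suc n) * \<nu> + real (Suc n * N) * (2 * pi)"
      by (simp add: algebra_simps)
    then show ?thesis by (simp only: sin_cos_plus_of_nat_2pi)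
  qed
  have dec: "(LBINT u:{0<..<1}. (planck_series \<alpha> (\<nu> + real N) (1 - u) - planck_series \<alpha> (\<nu> + real N) (1 + u)) / u) =
     (LBINT u:{0<..<1}. \<Sum>n. d1 n u * sin (\<phi>1 n u + real N * (2 * pi * real (Suc n) * u))) +
     (LBINT u:{0<..<1}. \<Sum>n. d2 n u * sin (\<phi>2 n u + real N * (2 * pi * real (Suc n) * u))) +
     (LBINT u:{0<..<1}. \<Sum>n. a n * (sin (2 * pi * real (Suc n) * (\<nu> + real N) * u) / u))" for N
  proof -
    let ?s = "\<lambda>n t. sin (2 * pi * real (Suc n) * (\<nu> + real N) * t)"
    let ?e1 = "\<lambda>n u. d1 n u * sin (\<phi>1 n u + real N * (2 * pi * real (Suc n) * u))"
    let ?e2 = "\<lambda>n u. d2 n u * sin (\<phi>2 n u + real N * (2 * pi * real (Suc n) * u))"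
    have db: "\<bar>d * sin x\<bar> \<le> B" if "\<bar>d\<bar> \<le> B" for d x B :: real
    proof -
      have "\<bar>d\<bar> * \<bar>sin x\<bar> \<le> \<bar>d\<bar> * 1" by (intro mult_left_mono) auto
      then show ?thesis using that by (simp add: abs_mult)
    qed
    have i1: "set_integrable lborel {0<..<1} (\<lambda>u. \<Sum>n. ?e1 n u)"
      by (rule set_integral_sums_dominated(2)[OF _ _ db[OF d1] summable_sqrt_over_square G]) auto
    have i2: "set_integrable lborel {0<..<1} (\<lambda>u. \<Sum>n. ?e2 n u)"
      by (rule set_integral_sums_dominated(2)[OF _ _ db[OF d2] summable_sqrt_over_square G]) auto
    have i3: "set_integrable lborel {0<..<1} (\<lambda>t. \<Sum>n. a n * (?s n t / t))"
      by (rule sinc_series(1)[OF a])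
    have pt: "(planck_series \<alpha> (\<nu> + real N) (1 - u) - planck_series \<alpha> (\<nu> + real N) (1 + u)) / u =
      (\<Sum>n. ?e1 n u) + (\<Sum>n. ?e2 n u) + (\<Sum>n. a n * (?s n u / u))" if u: "u \<in> {0<..<1}" for u
    proof -
      have sm1: "summable (\<lambda>n. ?e1 n u)"
        by (rule suminf_dominated_abs_le(1)[OF db[OF d1[OF u]] summable_sqrt_over_square])
      have sm2: "summable (\<lambda>n. ?e2 n u)"
        by (rule suminf_dominated_abs_le(1)[OF db[OF d2[OF u]] summable_sqrt_over_square])
      have "\<bar>a n * (?s n u / u)\<bar> \<le> 1 / (real (Suc n))\<^sup>2 * (2 * \<alpha> / u)" for n
      proof -
        have "\<bar>a n\<bar> * (\<bar>?s n u\<bar> / u) \<le> 2 * \<alpha> / (real (Suc n))\<^sup>2 * (1 / u)"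
          using u \<alpha> by (intro mult_mono a divide_right_mono) auto
        then show ?thesis using u by (simp add: abs_mult)
      qed
      then have sm3: "summable (\<lambda>n. a n * (?s n u / u))"
        by (rule suminf_dominated_abs_le(1)[OF _ summable_inverse_square])
      let ?p = "\<lambda>n t. planck \<alpha> (real (Suc n) * t) / (real (Suc n))\<^sup>2 * ?s n t"
      have smm: "summable (\<lambda>n. ?p n (1 - u))" "summable (\<lambda>n. ?p n (1 + u))"
        using u by (intro planck_series_bounds(1) \<alpha>; simp)+
      have "(planck_series \<alpha> (\<nu> + real N) (1 - u) - planck_series \<alpha> (\<nu> + real N) (1 + u)) / u =
          (\<Sum>n. (?p n (1 - u) - ?p n (1 + u)) / u)"
        unfolding planck_series_def by (simp only: suminf_diff[OF smm] suminf_divide[OF summable_diff[OF smm]])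
      also have "\<dots> = (\<Sum>n. ?e1 n u + ?e2 n u + a n * (?s n u / u))"
      proof (rule suminf_cong)
        fix n
        define K where "K = real (Suc n)"
        define x where "x = 2 * pi * K * (\<nu> + real N)"
        \<comment> \<open>The identity that merges the two frozen parts; \<open>c1\<close> then
          removes N from the cosine.\<close>
        have ss: "?s n (1 - u) - ?s n (1 + u) = - 2 * cos (2 * pi * real (Suc n) * \<nu>) * ?s n u"
        proof -
          have "sin (x * (1 - u)) - sin (x * (1 + u)) = - 2 * cos x * sin (x * u)"
            by (simp add: algebra_simps sin_add sin_diff)
          then show ?thesis using c1[of n N] unfolding x_def K_def by simp
        qed
        have "?e1 n u + ?e2 n u = 
           (planck \<alpha> (real (Suc n) * (1 - u)) - planck \<alpha> (real (Suc n))) / (real (Suc n))\<^sup>2 / u * ?s n (1 - u)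
           - (planck \<alpha> (real (Suc n) * (1 + u)) - planck \<alpha> (real (Suc n))) / (real (Suc n))\<^sup>2 / u * ?s n (1 + u)"
          unfolding s1 s2 d1_def d2_def by simp
        also have "\<dots> = (?p n (1 - u) - ?p n (1 + u)) / u - planck \<alpha> (real (Suc n)) / (real (Suc n))\<^sup>2 / u * (?s n (1 - u) - ?s n (1 + u))"
          by (simp add: diff_divide_distrib left_diff_distrib right_diff_distrib)
        also have "planck \<alpha> (real (Suc n)) / (real (Suc n))\<^sup>2 / u * (?s n (1 - u) - ?s n (1 + u)) = a n * (?s n u / u)"
          unfolding ss a_def cos_term_eq_planck by simp
        finally show "(?p n (1 - u) - ?p n (1 + u)) / u = ?e1 n u + ?e2 n u + a n * (?s n u / u)" by simp
      qed
      also have "\<dots> = (\<Sum>n. ?e1 n u) + (\<Sum>n. ?e2 n u) + (\<Sum>n. a n * (?s n u / u))"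
        by (simp only: suminf_add[OF sm1 sm2] suminf_add[OF summable_add[OF sm1 sm2] sm3])
      finally show ?thesis .
    qed
    have "(LBINT u:{0<..<1}. (planck_series \<alpha> (\<nu> + real N) (1 - u) - planck_series \<alpha> (\<nu> + real N) (1 + u)) / u) =
      (LBINT u:{0<..<1}. (\<Sum>n. ?e1 n u) + (\<Sum>n. ?e2 n u) + (\<Sum>n. a n * (?s n u / u)))"
      by (rule set_lebesgue_integral_cong) (use pt in auto)
    also have "\<dots> = (LBINT u:{0<..<1}. \<Sum>n. ?e1 n u) + (LBINT u:{0<..<1}. \<Sum>n. ?e2 n u) + (LBINT u:{0<..<1}. \<Sum>n. a n * (?s n u / u))"
      by (simp only: set_integral_add(2)[OF set_integral_add(1)[OF i1 i2] i3] set_integral_add(2)[OF i1 i2])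
    finally show ?thesis .
  qed
  have "(\<lambda>K. (\<Sum>N<K. LBINT u:{0<..<1}. (planck_series \<alpha> (\<nu> + real N) (1 - u) - planck_series \<alpha> (\<nu> + real N) (1 + u)) / u) / real K)
    \<longlonglongrightarrow> 0 + 0 + (\<Sum>n. a n) * (pi / 2)"
    unfolding dec sum.distrib add_divide_distrib
    by (intro tendsto_add RL1 RL2 cesaro_tendsto[OF sl])
  moreover have "(\<Sum>n. a n) = - 2 * (\<Sum>n. cos_term \<alpha> \<nu> (Suc n))"
    unfolding a_def by (rule suminf_mult[OF summable_cos_term[OF \<alpha>]])
  ultimately show ?thesis by (simp add: mult_ac)
qed

lemma cesaro_pv_value:
  assumes \<alpha>: "\<alpha> > 0"
  shows "(\<lambda>K. (\<Sum>N<K. pv_value \<alpha> (\<nu> + real N)) / real K)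
    \<longlonglongrightarrow> pi\<^sup>2 * \<alpha> / 24 - pi / 2 * (\<Sum>n. cos_term \<alpha> \<nu> (Suc n))"
proof -
  have eq: "(\<Sum>N<K. pv_value \<alpha> (\<nu> + real N)) / real K =
     (\<Sum>N<K. LBINT t:{0<..}. planck_series \<alpha> (\<nu> + real N) t * pv_weight t) / real K +
     1 / 2 * ((\<Sum>N<K. LBINT u:{0<..<1}. (planck_series \<alpha> (\<nu> + real N) (1 - u) - planck_series \<alpha> (\<nu> + real N) (1 + u)) / u) / real K)" for K
    by (simp add: pv_value_def sum.distrib add_divide_distrib flip: sum_divide_distrib)
  have "(\<lambda>K. (\<Sum>N<K. pv_value \<alpha> (\<nu> + real N)) / real K)
    \<longlonglongrightarrow> pi\<^sup>2 * \<alpha> / 24 + 1 / 2 * (- pi * (\<Sum>n. cos_term \<alpha> \<nu> (Suc n)))"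
    unfolding eq by (intro tendsto_add cesaro_planck_series_origin[OF \<alpha>] tendsto_mult tendsto_const cesaro_planck_series_one[OF \<alpha>])
  then show ?thesis by simp
qed

section \<open>Stirling's formula and the partial fractions of the cotangent\<close>

text \<open>The terms are the successive decrements of the Stirling sequence, and (n + 1/2) ln (1 +
  1/n) - 1 = O(1 / n^2). Summability gives the existence of Stirling's constant.\<close>

lemma stirling_difference_summable:
  "summable (\<lambda>n. (real (Suc n) + 1 / 2) * (ln (real (Suc n) + 1) - ln (real (Suc n))) - 1)"
proof (rule summable_comparison_test_bigo)
  show "summable (\<lambda>n. norm (1 / (real (Suc n))\<^sup>2))"
    using inverse_squares_sums by (simp add: sums_iff add.commute)
  show "(\<lambda>n. (real (Suc n) + 1 / 2) * (ln (real (Suc n) + 1) - ln (real (Suc n))) - 1) \<in> O(\<lambda>n. 1 / (real (Suc n))\<^sup>2)"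
    by real_asymp
qed

text \<open>In terms of factorials the logarithm of Wallis' product becomes a combination of the
  Stirling sequence at n and at 2 n.\<close>

lemma wallis_product_fact:
  "(\<Prod>k=1..n. (4 * real k ^ 2) / (4 * real k ^ 2 - 1)) = 2 ^ (4 * n) * fact n ^ 4 / ((fact (2 * n))\<^sup>2 * (2 * real n + 1))"
proof (induction n)
  case (Suc n)
  define F where "F = (fact (2 * n) :: real)"
  define f where "f = (fact n :: real)"
  have F: "F > 0" by (simp add: F_def)
  have e: "fact (2 * Suc n) = (2 * real n + 2) * (2 * real n + 1) * F"
    by (simp add: F_def algebra_simps)
  have pos: "2 * real n + 1 > 0" "2 * real n + 3 > 0" "real n + 1 > 0" by linarith+
  have "(\<Prod>k=1..Suc n. (4 * real k ^ 2) / (4 * real k ^ 2 - 1)) = 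
    2 ^ (4 * n) * f ^ 4 / (F\<^sup>2 * (2 * real n + 1)) * ((4 * (real n + 1)\<^sup>2) / ((2 * real n + 1) * (2 * real n + 3)))"
    using Suc by (simp add: f_def F_def power2_eq_square algebra_simps)
  also have "\<dots> = (2 ^ (4 * n) * 16) * (((real n + 1) * f) ^ 4) / (((2 * real n + 2) * (2 * real n + 1) * F)\<^sup>2 * (2 * real n + 3))"
  proof -
    have "(2 * real n + 2) = 2 * (real n + 1)" by simp
    then have "((2 * real n + 2) * (2 * real n + 1) * F)\<^sup>2 = 4 * (real n + 1)\<^sup>2 * (2 * real n + 1)\<^sup>2 * F\<^sup>2"
      by (simp only: power_mult_distrib) simp
    then show ?thesis using pos F
      by (simp add: divide_simps power_mult_distrib) (simp add: power2_eq_square power4_eq_xxxx mult_ac)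
  qed
  also have "2 ^ (4 * n) * 16 = (2::real) ^ (4 * Suc n)" by (simp add: power_add)
  also have "(real n + 1) * f = fact (Suc n)" by (simp add: f_def add.commute)
  also have "2 * real n + 3 = 2 * real (Suc n) + 1" by simp
  finally show ?case unfolding e .
qed simp

text \<open>Telescoping shows that the limit c exists; Wallis' product identifies it, since it leads
  to ln (pi / 2) = 4 c - 2 c - 2 ln 2.\<close>

lemma stirling_fact:
  "(\<lambda>n. ln (fact n) - (real n + 1 / 2) * ln (real n) + real n) \<longlonglongrightarrow> ln (2 * pi) / 2"
proof -
  define a where "a n = ln (fact n) - (real n + 1 / 2) * ln (real n) + real n" for n :: nat
  have "convergent (\<lambda>n. a (Suc n))"
  proof -
    have "(\<Sum>k<n. (real (Suc k) + 1 / 2) * (ln (real (Suc k) + 1) - ln (real (Suc k))) - 1) = a 1 - a (Suc n)" for n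
    proof (induction n)
      case (Suc n)
      have "ln (fact (Suc (Suc n))) = ln (real (Suc n) + 1) + ln (fact (Suc n) :: real)"
        by (subst fact_Suc, subst ln_mult_pos) (auto simp: add_ac)
      then show ?case using Suc by (simp add: a_def algebra_simps)
    qed simp
    then have eq: "a (Suc n) = a 1 - (\<Sum>k<n. (real (Suc k) + 1 / 2) * (ln (real (Suc k) + 1) - ln (real (Suc k))) - 1)" for n by simp
    show ?thesis unfolding eq
      using stirling_difference_summable by (intro convergent_diff convergent_const) (simp add: summable_iff_convergent)
  qed
  then obtain c where "(\<lambda>n. a (Suc n)) \<longlonglongrightarrow> c" by (auto simp: convergent_def)
  then have c: "a \<longlonglongrightarrow> c" by (simp add: filterlim_sequentially_Suc)
  have c2: "(\<lambda>n. a (2 * n)) \<longlonglongrightarrow> c"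
    by (rule filterlim_compose[OF c]) (rule filterlim_subseq, simp add: strict_mono_def)
  have "(\<lambda>n. ln (\<Prod>k=1..n. (4 * real k ^ 2) / (4 * real k ^ 2 - 1))) \<longlonglongrightarrow> ln (pi / 2)"
    by (intro tendsto_ln wallis) auto
  moreover have "\<forall>\<^sub>F n in sequentially. ln (\<Prod>k=1..n. (4 * real k ^ 2) / (4 * real k ^ 2 - 1)) =
     4 * a n - 2 * a (2 * n) + (ln (real n) - ln 2 - ln (2 * real n + 1))"
    using eventually_gt_at_top[of 0]
  proof eventually_elim
    case (elim n)
    have "ln (\<Prod>k=1..n. (4 * real k ^ 2) / (4 * real k ^ 2 - 1)) = 
       real (4 * n) * ln 2 + 4 * ln (fact n) - (2 * ln (fact (2 * n)) + ln (2 * real n + 1))"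
      unfolding wallis_product_fact
      by (subst ln_divide_pos, simp, simp, subst ln_mult_pos, simp, simp, subst ln_mult_pos, simp, simp)
         (simp add: ln_realpow)
    moreover have "ln (real (2 * n)) = ln 2 + ln (real n)" using elim by (simp add: ln_mult_pos)
    ultimately show ?case by (simp add: a_def algebra_simps)
  qed
  ultimately have "(\<lambda>n. 4 * a n - 2 * a (2 * n) + (ln (real n) - ln 2 - ln (2 * real n + 1))) \<longlonglongrightarrow> ln (pi / 2)"
    by (rule Lim_transform_eventually)
  moreover have "(\<lambda>n. ln (real n) - ln 2 - ln (2 * real n + 1)) \<longlonglongrightarrow> - 2 * ln 2"
    by real_asymp
  then have "(\<lambda>n. 4 * a n - 2 * a (2 * n) + (ln (real n) - ln 2 - ln (2 * real n + 1))) \<longlonglongrightarrow> 4 * c - 2 * c + (- 2 * ln 2)"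
    by (intro tendsto_intros c c2)
  ultimately have "ln (pi / 2) = 4 * c - 2 * c + (- 2 * ln 2)" by (rule LIMSEQ_unique)
  then have "2 * c = ln pi + ln 2" by (simp add: ln_divide_pos)
  then have ceq: "c = ln (2 * pi) / 2" by (simp add: ln_mult_pos)
  show ?thesis using c unfolding ceq a_def[abs_def] .
qed

text \<open>Euler's limit says that Gamma (z + n + 1) is asymptotic to n! n^z, which transfers
  Stirling's formula from factorials to real arguments.\<close>

lemma stirling_Gamma:
  fixes \<nu> :: real
  assumes "\<nu> > -1"
  shows "(\<lambda>N. ln (Gamma (\<nu> + real N + 1)) - (\<nu> + real N + 1 / 2) * ln (\<nu> + real N) + (\<nu> + real N)) \<longlonglongrightarrow> ln (2 * pi) / 2"
proof -
  \<comment> \<open>Shifting by 1 makes \<open>z\<close> positive, away from the poles. Index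
    \<open>n\<close> then belongs to N = n + 1, and the shift is undone at the end.\<close>
  define z where "z = \<nu> + 1"
  have z: "z > 0" using assms by (simp add: z_def)
  have Gz: "Gamma z > 0" using z by simp
  have zn: "z \<notin> \<int>\<^sub>\<le>\<^sub>0" using z by (auto elim!: nonpos_Ints_cases)
  have "(\<lambda>n. ln (Gamma z / Gamma_series z n)) \<longlonglongrightarrow> ln (Gamma z / Gamma z)"
    using Gz by (intro tendsto_intros Gamma_series_LIMSEQ) auto
  then have "(\<lambda>n. ln (Gamma z / Gamma_series z n)) \<longlonglongrightarrow> 0" using Gz by simp
  moreover have "\<forall>\<^sub>F n in sequentially. ln (Gamma z / Gamma_series z n) = ln (Gamma (z + real n + 1)) - ln (fact n) - z * ln (real n)"
    using eventually_gt_at_top[of 0]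
  proof eventually_elim
    case (elim n)
    have "pochhammer z (n + 1) = Gamma (z + real n + 1) / Gamma z"
      using pochhammer_Gamma[OF zn, of "n + 1"] by (simp add: add_ac)
    then have "Gamma z / Gamma_series z n = Gamma (z + real n + 1) / (fact n * exp (z * ln (real n)))"
      using Gz by (simp add: Gamma_series_def)
    moreover have "Gamma (z + real n + 1) > 0" using z by (intro Gamma_real_pos) auto
    ultimately show ?case by (simp add: ln_divide_pos ln_mult_pos)
  qed
  ultimately have 1: "(\<lambda>n. ln (Gamma (z + real n + 1)) - ln (fact n) - z * ln (real n)) \<longlonglongrightarrow> 0"
    by (rule Lim_transform_eventually)
  \<comment> \<open>The correction for replacing ln n by ln (z + n) in Stirling's formula.\<close>
  have 2: "(\<lambda>n. (z + real n + 1 / 2) * (ln (real n) - ln (z + real n)) + z) \<longlonglongrightarrow> 0"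
    using z by real_asymp
  have "(\<lambda>n. (ln (Gamma (z + real n + 1)) - ln (fact n) - z * ln (real n)) 
      + (ln (fact n) - (real n + 1 / 2) * ln (real n) + real n)
      + ((z + real n + 1 / 2) * (ln (real n) - ln (z + real n)) + z)) \<longlonglongrightarrow> 0 + ln (2 * pi) / 2 + 0"
    by (intro tendsto_add 1 2 stirling_fact)
  moreover have "(ln (Gamma (z + real n + 1)) - ln (fact n) - z * ln (real n)) 
      + (ln (fact n) - (real n + 1 / 2) * ln (real n) + real n)
      + ((z + real n + 1 / 2) * (ln (real n) - ln (z + real n)) + z)
      = ln (Gamma (\<nu> + real (Suc n) + 1)) - (\<nu> + real (Suc n) + 1 / 2) * ln (\<nu> + real (Suc n)) + (\<nu> + real (Suc n))" for n
    by (simp add: z_def algebra_simps)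
  ultimately have "(\<lambda>n. ln (Gamma (\<nu> + real (Suc n) + 1)) - (\<nu> + real (Suc n) + 1 / 2) * ln (\<nu> + real (Suc n)) + (\<nu> + real (Suc n))) \<longlonglongrightarrow> ln (2 * pi) / 2"
    by (simp only: add_0 add_0_right)
  then show ?thesis by (subst (asm) filterlim_sequentially_Suc)
qed

section \<open>Partial fractions of cot and coth\<close>

text \<open>Obtained by differentiating the reflection formula rGamma z * rGamma (1 - z) = sin (pi
  z) / pi.\<close>

lemma Digamma_reflection_complex:
  fixes z :: complex
  assumes "z \<notin> \<int>"
  shows "(Digamma (1 - z) - Digamma z) * sin (of_real pi * z) = of_real pi * cos (of_real pi * z)"
proof -
  have z1: "z \<notin> \<int>\<^sub>\<le>\<^sub>0" "1 - z \<notin> \<int>\<^sub>\<le>\<^sub>0"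
    using assms nonpos_Ints_Int[of z] nonpos_Ints_Int[of "1 - z"] Ints_diff[of 1 "1 - z"] by auto
  have "((\<lambda>z. rGamma z * rGamma (1 - z)) has_field_derivative
      rGamma z * rGamma (1 - z) * (Digamma (1 - z) - Digamma z)) (at z)"
    by (rule derivative_eq_intros refl z1 | (simp add: algebra_simps; fail))+
  then have "((\<lambda>z. sin (of_real pi * z) / of_real pi) has_field_derivative
      rGamma z * rGamma (1 - z) * (Digamma (1 - z) - Digamma z)) (at z)"
    unfolding rGamma_reflection_complex .
  moreover have "((\<lambda>z. sin (of_real pi * z) / of_real pi) has_field_derivative cos (of_real pi * z)) (at z)"
    by (rule derivative_eq_intros refl | simp)+
  ultimately have "rGamma z * rGamma (1 - z) * (Digamma (1 - z) - Digamma z) = cos (of_real pi * z)"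
    by (rule DERIV_unique)
  then show ?thesis unfolding rGamma_reflection_complex by (simp add: field_simps)
qed

text \<open>Since 2 z / (n^2 - z^2) = 1 / (n - z) - 1 / (n + z), the sum is a difference of Digamma
  series at 1 + z and 1 - z; recurrence and reflection turn it into a cotangent. The complex form
  serves a real argument (the kernel) and an imaginary one (the sine transform).\<close>

lemma cot_partial_fractions:
  fixes z :: complex
  assumes z: "z \<notin> \<int>"
  shows "(\<lambda>n. 1 / ((of_nat (Suc n))\<^sup>2 - z\<^sup>2)) sums
    (1 / (2 * z\<^sup>2) - of_real pi * cos (of_real pi * z) / (2 * z * sin (of_real pi * z)))"
proof -
  have z0: "z \<noteq> 0" using z by auto
  have nz: "of_nat (Suc n) + z \<noteq> 0" "of_nat (Suc n) - z \<noteq> 0" for n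
  proof -
    have "z \<noteq> - of_nat (Suc n)" "z \<noteq> of_nat (Suc n)" using z by (metis Ints_minus Ints_of_nat)+
    then show "of_nat (Suc n) + z \<noteq> 0" "of_nat (Suc n) - z \<noteq> 0" by (auto simp: add_eq_0_iff2 simp del: of_nat_Suc)
  qed
  have D: "(\<lambda>n. inverse (of_nat (Suc n)) - inverse (w + of_nat n)) sums (Digamma w + euler_mascheroni)" if "w \<noteq> 0" for w :: complex
    using summable_sums[OF summable_Digamma[OF that]] by (simp add: Digamma_def)
  have w: "1 + z \<noteq> 0" "1 - z \<noteq> 0" using nz[of 0] by auto
  have "(\<lambda>n. (inverse (of_nat (Suc n)) - inverse ((1 + z) + of_nat n)) - (inverse (of_nat (Suc n)) - inverse ((1 - z) + of_nat n)))
     sums ((Digamma (1 + z) + euler_mascheroni) - (Digamma (1 - z) + euler_mascheroni))"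
    by (intro sums_diff D w)
  also have "(\<lambda>n. (inverse (of_nat (Suc n)) - inverse ((1 + z) + of_nat n)) - (inverse (of_nat (Suc n)) - inverse ((1 - z) + of_nat n)))
     = (\<lambda>n. 2 * z * (1 / ((of_nat (Suc n))\<^sup>2 - z\<^sup>2)))"
  proof
    fix n
    define K where "K = (of_nat (Suc n) :: complex)"
    have K: "K + z \<noteq> 0" "K - z \<noteq> 0" using nz[of n] by (simp_all add: K_def)
    have e: "(1 + z) + of_nat n = K + z" "(1 - z) + of_nat n = K - z" by (simp_all add: K_def)
    have "K\<^sup>2 - z\<^sup>2 = (K + z) * (K - z)" by (simp add: power2_eq_square algebra_simps)
    then show "(inverse (of_nat (Suc n)) - inverse ((1 + z) + of_nat n)) - (inverse (of_nat (Suc n)) - inverse ((1 - z) + of_nat n)) = 2 * z * (1 / ((of_nat (Suc n))\<^sup>2 - z\<^sup>2))"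
      unfolding e K_def[symmetric] using K by (simp add: divide_simps) (simp add: algebra_simps)
  qed
  finally have "(\<lambda>n. 2 * z * (1 / ((of_nat (Suc n))\<^sup>2 - z\<^sup>2))) sums (Digamma (1 + z) - Digamma (1 - z))" by simp
  then have "(\<lambda>n. 2 * z * (1 / ((of_nat (Suc n))\<^sup>2 - z\<^sup>2)) / (2 * z)) sums ((Digamma (1 + z) - Digamma (1 - z)) / (2 * z))"
    by (rule sums_divide)
  then have S: "(\<lambda>n. 1 / ((of_nat (Suc n))\<^sup>2 - z\<^sup>2)) sums ((Digamma (1 + z) - Digamma (1 - z)) / (2 * z))"
    using z0 by simp
  have s0: "sin (of_real pi * z) \<noteq> 0"
  proof
    assume "sin (of_real pi * z) = 0"
    then obtain i :: int where "of_real pi * z = of_real (of_int i * pi)"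
      unfolding sin_eq_0 by blast
    then have "z = of_int i" by simp
    then show False using z by simp
  qed
  have "Digamma (1 + z) = Digamma z + 1 / z" using Digamma_plus1[OF z0] by (simp add: add.commute)
  then have "Digamma (1 + z) - Digamma (1 - z) = 1 / z - (Digamma (1 - z) - Digamma z)" by simp
  also have "Digamma (1 - z) - Digamma z = of_real pi * cos (of_real pi * z) / sin (of_real pi * z)"
    using Digamma_reflection_complex[OF z] s0 by (simp add: field_simps)
  finally have "(Digamma (1 + z) - Digamma (1 - z)) / (2 * z) = 
     (1 / z - of_real pi * cos (of_real pi * z) / sin (of_real pi * z)) / (2 * z)" by simp
  also have "\<dots> = 1 / (2 * z\<^sup>2) - of_real pi * cos (of_real pi * z) / (2 * z * sin (of_real pi * z))"
    using z0 s0 by (simp add: diff_divide_distrib power2_eq_square mult_ac)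
  finally show ?thesis using S by simp
qed

lemma cot_partial_fractions_real:
  fixes s :: real
  assumes "s \<notin> \<int>"
  shows "(\<lambda>n. 1 / ((real (Suc n))\<^sup>2 - s\<^sup>2)) sums (1 / (2 * s\<^sup>2) - pi * cos (pi * s) / (2 * s * sin (pi * s)))"
proof -
  have "complex_of_real s \<notin> \<int>" using assms by simp
  moreover have "cos (of_real pi * complex_of_real s) = of_real (cos (pi * s))"
    "sin (of_real pi * complex_of_real s) = of_real (sin (pi * s))"
    by (simp_all flip: cos_of_real sin_of_real)
  note [simp] = this
  ultimately have "(\<lambda>n. complex_of_real (1 / ((real (Suc n))\<^sup>2 - s\<^sup>2))) sums of_real (1 / (2 * s\<^sup>2) - pi * cos (pi * s) / (2 * s * sin (pi * s)))"
    using cot_partial_fractions[of "of_real s"] by simp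
  then show ?thesis by (simp only: sums_of_real_iff)
qed

text \<open>The case z = i y of the cotangent series, with coth (pi y) rewritten so that the Bose
  factor shows.\<close>

lemma coth_partial_fractions:
  fixes y :: real
  assumes "y \<noteq> 0"
  shows "(\<lambda>n. 1 / ((real (Suc n))\<^sup>2 + y\<^sup>2)) sums (pi / (2 * y) * (1 + 2 / (exp (2 * pi * y) - 1)) - 1 / (2 * y\<^sup>2))"
proof -
  let ?z = "\<i> * complex_of_real y"
  have "?z \<notin> \<int>"
  proof
    assume "?z \<in> \<int>"
    then obtain i :: int where "?z = of_int i" by (auto elim: Ints_cases)
    then have "Im ?z = Im (of_int i)" by simp
    then show False using assms by simp
  qed
  from cot_partial_fractions[OF this]
  have *: "(\<lambda>n. 1 / ((of_nat (Suc n))\<^sup>2 - ?z\<^sup>2)) sums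
    (1 / (2 * ?z\<^sup>2) - of_real pi * cos (of_real pi * ?z) / (2 * ?z * sin (of_real pi * ?z)))" .
  have zz: "?z\<^sup>2 = of_real (- (y\<^sup>2))" by (simp add: power_mult_distrib)
  have pz: "of_real pi * ?z = \<i> * of_real (pi * y)" by simp
  have c: "cos (\<i> * of_real (pi * y)) = of_real (cosh (pi * y))"
    by (simp add: cos_exp_eq cosh_field_def exp_of_real[symmetric])
  have s: "sin (\<i> * of_real (pi * y)) = \<i> * of_real (sinh (pi * y))"
    by (simp add: sin_exp_eq sinh_field_def exp_of_real[symmetric] field_simps)
  have sh: "sinh (pi * y) \<noteq> 0" using assms by simp
  have "1 / (2 * ?z\<^sup>2) - of_real pi * cos (of_real pi * ?z) / (2 * ?z * sin (of_real pi * ?z))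
     = of_real (pi / (2 * y) * (cosh (pi * y) / sinh (pi * y)) - 1 / (2 * y\<^sup>2))"
    unfolding pz c s zz using assms sh by (simp add: field_simps)
  also have "cosh (pi * y) / sinh (pi * y) = 1 + 2 / (exp (2 * pi * y) - 1)"
  proof -
    define E where "E = exp (pi * y)"
    have E: "E > 0" "E\<^sup>2 = exp (2 * pi * y)" by (simp_all add: E_def power2_eq_square flip: exp_add)
    have ne: "E\<^sup>2 - 1 \<noteq> 0" using assms E(2) by simp
    have eqs: "sinh (pi * y) = (E\<^sup>2 - 1) / (2 * E)" "cosh (pi * y) = (E\<^sup>2 + 1) / (2 * E)"
      using E(1) by (simp_all add: sinh_field_def cosh_field_def E_def exp_minus field_simps power2_eq_square)
    have "(E\<^sup>2 + 1) / (E\<^sup>2 - 1) = 1 + 2 / (E\<^sup>2 - 1)" using ne by (simp add: divide_simps)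
    then show ?thesis using E(1) unfolding eqs E(2)[symmetric] by simp
  qed
  finally have val: "1 / (2 * ?z\<^sup>2) - of_real pi * cos (of_real pi * ?z) / (2 * ?z * sin (of_real pi * ?z)) =
     of_real (pi / (2 * y) * (1 + 2 / (exp (2 * pi * y) - 1)) - 1 / (2 * y\<^sup>2))" .
  have "(\<lambda>n. 1 / ((of_nat (Suc n))\<^sup>2 - ?z\<^sup>2)) = (\<lambda>n. complex_of_real (1 / ((real (Suc n))\<^sup>2 + y\<^sup>2)))"
    by (simp add: power_mult_distrib)
  with * have "(\<lambda>n. complex_of_real (1 / ((real (Suc n))\<^sup>2 + y\<^sup>2))) sums 
     of_real (pi / (2 * y) * (1 + 2 / (exp (2 * pi * y) - 1)) - 1 / (2 * y\<^sup>2))"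
    unfolding val by simp
  then show ?thesis by (simp only: sums_of_real_iff)
qed

section \<open>Integrals of the Bose function\<close>

text \<open>exp x is the square of exp (x / 2), and the cross term in the square of x / 2 + x^2 / 8
  is x^3 / 8. A cubic is what makes \<open>planck\<close> decay like 1 / x^2.\<close>

lemma exp_minus_one_ge_cubic: 
  assumes "x \<ge> 0" shows "x ^ 3 / 8 \<le> exp x - (1::real)"
proof -
  define p where "p = x / 2 + (x / 2)\<^sup>2 / 2"
  have p: "1 + p \<le> exp (x / 2)" unfolding p_def add.assoc[symmetric]
    using assms by (intro exp_lower_Taylor_quadratic) auto
  have p0: "p \<ge> 0" using assms by (simp add: p_def)
  have "1 + p\<^sup>2 \<le> (1 + p)\<^sup>2" using p0 by (simp add: power2_eq_square algebra_simps)
  also have "\<dots> \<le> (exp (x / 2))\<^sup>2" using p p0 by (intro power_mono) auto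
  also have "\<dots> = exp x" by (simp add: power2_eq_square flip: exp_add)
  finally have "p\<^sup>2 \<le> exp x - 1" by simp
  moreover have "x ^ 3 / 8 \<le> p\<^sup>2"
  proof -
    have "p\<^sup>2 = x ^ 3 / 8 + ((x / 2)\<^sup>2 + ((x / 2)\<^sup>2 / 2)\<^sup>2)"
      by (simp add: p_def power2_eq_square power3_eq_cube field_simps)
    then show ?thesis by simp
  qed
  ultimately show ?thesis by simp
qed

text \<open>The two bounds match the two branches of \<open>pv_majorant\<close>. The first is weaker
  at infinity than the second; it interpolates between boundedness and quadratic decay.\<close>

lemma planck_decay:
  assumes \<alpha>: "\<alpha> > 0"
  obtains C where "C \<ge> 0" "\<And>x. x > 0 \<Longrightarrow> planck \<alpha> x \<le> C / sqrt x" "\<And>x. x > 0 \<Longrightarrow> planck \<alpha> x \<le> C / x\<^sup>2"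
proof -
  define a where "a = 2 * pi / \<alpha>"
  have a: "a > 0" using \<alpha> by (simp add: a_def)
  define D where "D = 8 / a ^ 3"
  have D: "D \<ge> 0" using a by (simp add: D_def)
  have 1: "planck \<alpha> x \<le> D / x\<^sup>2" if x: "x > 0" for x
  proof -
    have "(a * x) ^ 3 / 8 \<le> exp (a * x) - 1" using a x by (intro exp_minus_one_ge_cubic) auto
    then have "x / (exp (a * x) - 1) \<le> x / ((a * x) ^ 3 / 8)"
      using a x by (intro divide_left_mono mult_pos_pos) auto
    also have "\<dots> = D / x\<^sup>2" using a x by (simp add: D_def power_mult_distrib power3_eq_cube power2_eq_square field_simps)
    finally show ?thesis using x by (simp add: planck_def a_def)
  qed
  have 2: "planck \<alpha> x \<le> \<alpha>" if "x > 0" for x using planck_le[OF \<alpha>, of x] that by auto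
  show ?thesis
  proof
    show "\<alpha> + D \<ge> 0" using \<alpha> D by simp
    show "planck \<alpha> x \<le> (\<alpha> + D) / sqrt x" if x: "x > 0" for x
    proof (cases "x \<le> 1")
      case True
      have "sqrt x \<le> 1" using True by simp
      then have "(\<alpha> + D) / 1 \<le> (\<alpha> + D) / sqrt x" using x \<alpha> D by (intro divide_left_mono) auto
      then have "\<alpha> + D \<le> (\<alpha> + D) / sqrt x" unfolding div_by_1 .
      moreover have "planck \<alpha> x \<le> \<alpha> + D" using 2[OF x] D by linarith
      ultimately show ?thesis by (rule order_trans[rotated])
    next
      case False
      have "x \<le> x * x" using False mult_left_mono[of 1 x x] by simp
      moreover have "sqrt x \<le> x" using False mult_left_mono[of 1 "sqrt x" "sqrt x"] by simp
      ultimately have "sqrt x \<le> x\<^sup>2" unfolding power2_eq_square by linarith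
      then have "D / x\<^sup>2 \<le> (\<alpha> + D) / sqrt x" using x \<alpha> D by (intro frac_le) auto
      then show ?thesis using 1[OF x] by linarith
    qed
    show "planck \<alpha> x \<le> (\<alpha> + D) / x\<^sup>2" if x: "x > 0" for x
    proof -
      have "D / x\<^sup>2 \<le> (\<alpha> + D) / x\<^sup>2" using \<alpha> by (intro divide_right_mono) auto
      then show ?thesis using 1[OF x] by linarith
    qed
  qed
qed

text \<open>A geometric series in exp (- 2 pi s / \<alpha>), integrated termwise. The linear bound
  on \<open>h\<close> compensates the pole of the Bose factor at 0.\<close>

lemma bose_expansion:
  fixes h :: "real \<Rightarrow> real"
  assumes \<alpha>: "\<alpha> > 0" and [measurable]: "h \<in> borel_measurable borel"
    and h: "\<And>s. s > 0 \<Longrightarrow> \<bar>h s\<bar> \<le> A * s"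
  shows "set_integrable lborel {0<..} (\<lambda>s. h s / (exp (2 * pi * s / \<alpha>) - 1))"
    and "\<And>n. set_integrable lborel {0<..} (\<lambda>s. h s * exp (- (2 * pi / \<alpha> * real (Suc n) * s)))"
    and "(\<lambda>n. LBINT s:{0<..}. h s * exp (- (2 * pi / \<alpha> * real (Suc n) * s))) sums
      (LBINT s:{0<..}. h s / (exp (2 * pi * s / \<alpha>) - 1))"
proof -
  define a where "a = 2 * pi / \<alpha>"
  have a: "a > 0" using \<alpha> by (simp add: a_def)
  have A: "A \<ge> 0" using h[of 1] by simp
  obtain C where C: "C \<ge> 0" "\<And>x. x > 0 \<Longrightarrow> planck \<alpha> x \<le> C / sqrt x" "\<And>x. x > 0 \<Longrightarrow> planck \<alpha> x \<le> C / x\<^sup>2"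
    using planck_decay[OF \<alpha>] by blast
  let ?w = "\<lambda>n. sqrt (real (Suc n)) / (real (Suc n))\<^sup>2"
  define f where "f n s = h s * exp (- (a * real (Suc n) * s))" for n s
  have [measurable]: "f n \<in> borel_measurable borel" for n unfolding f_def[abs_def] by measurable
  have bd: "\<bar>f n s\<bar> \<le> ?w n * (A * C * pv_majorant s)" if "s \<in> {0<..}" for n s
  proof -
    have s: "s > 0" using that by simp
    define K where "K = real (Suc n)"
    have K: "K \<ge> 1" by (simp add: K_def)
    then have sK: "sqrt K \<ge> 1" by simp
    have Ks: "K * s > 0" using K s by simp
    \<comment> \<open>Each exponential is compared with the Bose factor of the same argument, so
      that the bounds on \<open>planck\<close> provide the majorant.\<close>
    have "exp (- (a * K * s)) = 1 / exp (a * K * s)" by (simp add: exp_minus inverse_eq_divide)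
    also have "\<dots> \<le> 1 / (exp (a * K * s) - 1)" using a K s by (intro divide_left_mono mult_pos_pos) auto
    finally have "s * exp (- (a * K * s)) \<le> s * (1 / (exp (a * K * s) - 1))" using s by (intro mult_left_mono) auto
    also have "\<dots> = planck \<alpha> (K * s) / K" using K s by (simp add: planck_def a_def mult_ac)
    finally have 1: "s * exp (- (a * K * s)) \<le> planck \<alpha> (K * s) / K" .
    have 2: "planck \<alpha> (K * s) / K \<le> sqrt K / K\<^sup>2 * (C * pv_majorant s)"
    proof (cases "s < 2")
      case True
      have "planck \<alpha> (K * s) / K \<le> C / sqrt (K * s) / K" using C(2)[OF Ks] K by (intro divide_right_mono) auto
      also have "\<dots> = (1 / sqrt K) / K * (C * (1 / sqrt s))" by (simp add: real_sqrt_mult)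
      also have "1 / sqrt K = sqrt K / K" using K by (simp add: sqrt_divide_self)
      finally show ?thesis using True by (simp add: pv_majorant_def power2_eq_square)
    next
      case False
      have "planck \<alpha> (K * s) / K \<le> C / (K * s)\<^sup>2 / K" using C(3)[OF Ks] K by (intro divide_right_mono) auto
      also have "\<dots> = (1 / K) / K\<^sup>2 * (C * (1 / s\<^sup>2))" by (simp add: power_mult_distrib mult_ac)
      also have "\<dots> \<le> sqrt K / K\<^sup>2 * (C * (1 / s\<^sup>2))"
      proof -
        have "1 / K \<le> 1" using K by simp
        then have "1 / K \<le> sqrt K" using sK by linarith
        then show ?thesis using C(1) by (intro mult_right_mono divide_right_mono) auto
      qed
      finally show ?thesis using False by (simp add: pv_majorant_def)
    qed
    have "\<bar>f n s\<bar> \<le> (A * s) * exp (- (a * K * s))"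
      unfolding f_def abs_mult K_def using h[OF s] by (simp add: mult_right_mono)
    also have "\<dots> = A * (s * exp (- (a * K * s)))" by simp
    also have "\<dots> \<le> A * (sqrt K / K\<^sup>2 * (C * pv_majorant s))"
      using 1 2 A by (intro mult_left_mono) auto
    finally show ?thesis by (simp add: K_def mult_ac)
  qed
  have G: "set_integrable lborel {0<..} (\<lambda>s. A * C * pv_majorant s)"
    by (intro set_integrable_mult_right set_integrable_pv_majorant)
  note sw = set_integral_sums_dominated[OF _ _ bd summable_sqrt_over_square G]
  have sum: "(\<Sum>n. f n s) = h s / (exp (2 * pi * s / \<alpha>) - 1)" if s: "s > 0" for s
  proof -
    define r where "r = exp (- (a * s))"
    have r: "0 < r" "r < 1" using a s by (auto simp: r_def)
    have "(\<lambda>n. r ^ n) sums (1 / (1 - r))" using r by (intro geometric_sums) auto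
    then have "(\<lambda>n. h s * r * r ^ n) sums (h s * r * (1 / (1 - r)))" by (rule sums_mult)
    moreover have "h s * r * r ^ n = f n s" for n
      by (simp add: f_def r_def algebra_simps flip: exp_of_nat_mult exp_add)
    moreover have "h s * r * (1 / (1 - r)) = h s / (exp (a * s) - 1)"
    proof -
      have e: "exp (a * s) = 1 / r" by (simp add: r_def exp_minus inverse_eq_divide)
      have "1 / r - 1 = (1 - r) / r" using r by (simp add: diff_divide_distrib)
      then show ?thesis unfolding e by simp
    qed
    ultimately show ?thesis by (simp add: sums_iff a_def)
  qed
  show "\<And>n. set_integrable lborel {0<..} (\<lambda>s. h s * exp (- (2 * pi / \<alpha> * real (Suc n) * s)))"
    unfolding a_def[symmetric] f_def[symmetric] by (rule sw(1)) auto
  have "set_integrable lborel {0<..} (\<lambda>s. \<Sum>n. f n s)" by (rule sw(2)) auto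
  also have "?this \<longleftrightarrow> set_integrable lborel {0<..} (\<lambda>s. h s / (exp (2 * pi * s / \<alpha>) - 1))"
    by (rule set_integrable_cong) (use sum in auto)
  finally show "set_integrable lborel {0<..} (\<lambda>s. h s / (exp (2 * pi * s / \<alpha>) - 1))" .
  have "(\<lambda>n. LBINT s:{0<..}. f n s) sums (LBINT s:{0<..}. \<Sum>n. f n s)" by (rule sw(3)) auto
  also have "(LBINT s:{0<..}. \<Sum>n. f n s) = (LBINT s:{0<..}. h s / (exp (2 * pi * s / \<alpha>) - 1))"
    by (rule set_lebesgue_integral_cong) (use sum in auto)
  finally show "(\<lambda>n. LBINT s:{0<..}. h s * exp (- (2 * pi / \<alpha> * real (Suc n) * s))) sums
      (LBINT s:{0<..}. h s / (exp (2 * pi * s / \<alpha>) - 1))"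
    unfolding f_def a_def .
qed

lemma exp_neg_mult_at_top: "(c::real) > 0 \<Longrightarrow> ((\<lambda>s. exp (- (c * s))) \<longlongrightarrow> 0) at_top"
  by real_asymp

lemma set_integral_Ioi_FTC:
  fixes f F :: "real \<Rightarrow> real"
  assumes int: "set_integrable lborel {0<..} f"
    and F: "\<And>s. (F has_real_derivative f s) (at s)" and f: "\<And>s. isCont f s"
    and lim: "(F \<longlongrightarrow> B) at_top"
  shows "(LBINT s:{0<..}. f s) = B - F 0"
proof -
  have ei: "einterval 0 \<infinity> = {0<..}" by (auto simp: einterval_def)
  have "isCont F 0" using F by (rule DERIV_isCont)
  then have "(F \<longlongrightarrow> F 0) (at_right 0)" by (simp add: isCont_def filterlim_at_split)
  then have "(LBINT s=0..\<infinity>. f s) = B - F 0"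
    by (intro interval_integral_FTC_integrable[where F = F])
       (use F f int lim in \<open>auto simp: ei zero_ereal_def ereal_tendsto_simps simp flip: has_real_derivative_iff_has_vector_derivative\<close>)
  then show ?thesis by (simp add: interval_lebesgue_integral_0_infty)
qed

lemma set_integral_mult_exp:
  fixes c :: real
  assumes c: "c > 0" and int: "set_integrable lborel {0<..} (\<lambda>s. s * exp (- (c * s)))"
  shows "(LBINT s:{0<..}. s * exp (- (c * s))) = 1 / c\<^sup>2"
proof -
  let ?F = "\<lambda>s. - ((s / c + 1 / c\<^sup>2) * exp (- (c * s)))"
  have "(LBINT s:{0<..}. s * exp (- (c * s))) = 0 - ?F 0"
  proof (rule set_integral_Ioi_FTC[OF int])
    show "(?F has_real_derivative s * exp (- (c * s))) (at s)" for s
      using c by (auto intro!: derivative_eq_intros simp: field_simps power2_eq_square)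
    show "(?F \<longlongrightarrow> 0) at_top" using c by real_asymp
  qed auto
  then show ?thesis by simp
qed

lemma set_integral_sin_exp:
  fixes b c :: real
  assumes c: "c > 0" and int: "set_integrable lborel {0<..} (\<lambda>s. sin (b * s) * exp (- (c * s)))"
  shows "(LBINT s:{0<..}. sin (b * s) * exp (- (c * s))) = b / (b\<^sup>2 + c\<^sup>2)"
proof -
  let ?F = "\<lambda>s. - ((c * sin (b * s) + b * cos (b * s)) * exp (- (c * s)) / (b\<^sup>2 + c\<^sup>2))"
  have pos: "b\<^sup>2 + c\<^sup>2 > 0" using c by (simp add: add_nonneg_pos)
  have "(LBINT s:{0<..}. sin (b * s) * exp (- (c * s))) = 0 - ?F 0"
  proof (rule set_integral_Ioi_FTC[OF int])
    fix s
    have "(?F has_real_derivative - (((c * (cos (b * s) * b) - b * (sin (b * s) * b)) * exp (- (c * s)) 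
        + (c * sin (b * s) + b * cos (b * s)) * (exp (- (c * s)) * - c)) / (b\<^sup>2 + c\<^sup>2))) (at s)"
      using pos by (auto intro!: derivative_eq_intros)
    also have "(c * (cos (b * s) * b) - b * (sin (b * s) * b)) * exp (- (c * s)) 
        + (c * sin (b * s) + b * cos (b * s)) * (exp (- (c * s)) * - c)
      = - (sin (b * s) * exp (- (c * s)) * (b\<^sup>2 + c\<^sup>2))"
      by (simp add: algebra_simps power2_eq_square)
    finally show "(?F has_real_derivative sin (b * s) * exp (- (c * s))) (at s)" using c by simp
  next
    show "(?F \<longlongrightarrow> 0) at_top"
    proof (rule Lim_null_comparison)
      show "\<forall>\<^sub>F s in at_top. norm (?F s) \<le> (c + \<bar>b\<bar>) / (b\<^sup>2 + c\<^sup>2) * exp (- (c * s))"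
      proof (intro always_eventually allI)
        fix s
        have "\<bar>c * sin (b * s)\<bar> \<le> c * 1" unfolding abs_mult using c by (intro mult_mono) auto
        moreover have "\<bar>b * cos (b * s)\<bar> \<le> \<bar>b\<bar> * 1" unfolding abs_mult by (intro mult_left_mono) auto
        ultimately have "\<bar>c * sin (b * s) + b * cos (b * s)\<bar> \<le> c + \<bar>b\<bar>" by linarith
        then have "\<bar>c * sin (b * s) + b * cos (b * s)\<bar> * exp (- (c * s)) / (b\<^sup>2 + c\<^sup>2) \<le> (c + \<bar>b\<bar>) * exp (- (c * s)) / (b\<^sup>2 + c\<^sup>2)"
          using pos by (intro divide_right_mono mult_right_mono) auto
        then show "norm (?F s) \<le> (c + \<bar>b\<bar>) / (b\<^sup>2 + c\<^sup>2) * exp (- (c * s))"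
          using pos by (simp add: abs_mult)
      qed
      show "((\<lambda>s. (c + \<bar>b\<bar>) / (b\<^sup>2 + c\<^sup>2) * exp (- (c * s))) \<longlongrightarrow> 0) at_top"
        by (rule tendsto_mult_right_zero[OF exp_neg_mult_at_top[OF c]])
    qed
  qed auto
  then show ?thesis by simp
qed

text \<open>Termwise this is \<open>(\<alpha> / (2 * pi))\<^sup>2\<close> times the sum of 1 / n^2.
  Integrability supports the Fubini argument for the increment; the value, at parameter
  \<open>1 / \<alpha>\<close>, yields the term pi / (12 \<alpha>).\<close>

lemma planck_integral:
  assumes \<alpha>: "\<alpha> > 0"
  shows "set_integrable lborel {0<..} (planck \<alpha>)" "(LBINT s:{0<..}. planck \<alpha> s) = \<alpha>\<^sup>2 / 24"
proof -
  have eq: "s / (exp (2 * pi * s / \<alpha>) - 1) = planck \<alpha> s" if "s \<in> {0<..}" for s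
    using that by (simp add: planck_def)
  note be = bose_expansion[OF \<alpha>, of "\<lambda>s. s" 1]
  have "set_integrable lborel {0<..} (\<lambda>s. s / (exp (2 * pi * s / \<alpha>) - 1))" by (rule be(1)) auto
  also have "?this \<longleftrightarrow> set_integrable lborel {0<..} (planck \<alpha>)"
    by (rule set_integrable_cong) (use eq in auto)
  finally show "set_integrable lborel {0<..} (planck \<alpha>)" .
  have "(\<lambda>n. LBINT s:{0<..}. s * exp (- (2 * pi / \<alpha> * real (Suc n) * s))) sums
      (LBINT s:{0<..}. s / (exp (2 * pi * s / \<alpha>) - 1))" by (rule be(3)) auto
  moreover have "(LBINT s:{0<..}. s * exp (- (2 * pi / \<alpha> * real (Suc n) * s))) = (\<alpha> / (2 * pi))\<^sup>2 * (1 / (real (Suc n))\<^sup>2)" for n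
  proof -
    have "set_integrable lborel {0<..} (\<lambda>s. s * exp (- (2 * pi / \<alpha> * real (Suc n) * s)))"
      by (rule be(2)) auto
    then have "(LBINT s:{0<..}. s * exp (- (2 * pi / \<alpha> * real (Suc n) * s))) = 1 / (2 * pi / \<alpha> * real (Suc n))\<^sup>2"
      using \<alpha> by (intro set_integral_mult_exp) auto
    then show ?thesis by (simp add: power_mult_distrib power_divide del: of_nat_Suc)
  qed
  moreover have "(\<lambda>n. (\<alpha> / (2 * pi))\<^sup>2 * (1 / (real (Suc n))\<^sup>2)) sums ((\<alpha> / (2 * pi))\<^sup>2 * (pi\<^sup>2 / 6))"
    using sums_mult[OF inverse_squares_sums] by (simp add: add.commute)
  ultimately have "(LBINT s:{0<..}. s / (exp (2 * pi * s / \<alpha>) - 1)) = (\<alpha> / (2 * pi))\<^sup>2 * (pi\<^sup>2 / 6)"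
    by (simp add: sums_iff)
  also have "\<dots> = \<alpha>\<^sup>2 / 24" using pi_gt_zero by (simp add: power_divide power_mult_distrib)
  also have "(LBINT s:{0<..}. s / (exp (2 * pi * s / \<alpha>) - 1)) = (LBINT s:{0<..}. planck \<alpha> s)"
    by (rule set_lebesgue_integral_cong) (use eq in auto)
  finally show "(LBINT s:{0<..}. planck \<alpha> s) = \<alpha>\<^sup>2 / 24" .
qed

text \<open>Laplace transforms of the sine, summed by the coth series. The right side is arranged as
  a constant plus 1 / (4 pi) times the derivative of \<open>ln (exp_quotient \<alpha> u)\<close>;
  the constant will integrate to 0 against u - \<nu> - 1/2.\<close>

lemma bose_sine_transform:
  assumes \<alpha>: "\<alpha> > 0" and u: "u \<noteq> 0"
  shows "(LBINT s:{0<..}. sin (2 * pi * u * s) / (exp (2 * pi * s / \<alpha>) - 1)) =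
    \<alpha> / 4 + (2 * pi * \<alpha> / (exp (2 * pi * \<alpha> * u) - 1) - 1 / u) / (4 * pi)"
proof -
  define a where "a = 2 * pi / \<alpha>"
  define b where "b = 2 * pi * u"
  have a: "a > 0" using \<alpha> by (simp add: a_def)
  have b: "b \<noteq> 0" using u by (simp add: b_def)
  have hb: "\<bar>sin (b * s)\<bar> \<le> \<bar>b\<bar> * s" if "s > 0" for s
    using abs_sin_x_le_abs_x[of "b * s"] that by (simp add: abs_mult)
  note be = bose_expansion[OF \<alpha> _ hb]
  have "(\<lambda>n. LBINT s:{0<..}. sin (b * s) * exp (- (2 * pi / \<alpha> * real (Suc n) * s))) sums
      (LBINT s:{0<..}. sin (b * s) / (exp (2 * pi * s / \<alpha>) - 1))" by (rule be(3)) auto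
  moreover have "(LBINT s:{0<..}. sin (b * s) * exp (- (2 * pi / \<alpha> * real (Suc n) * s))) = 
      b / a\<^sup>2 * (1 / ((real (Suc n))\<^sup>2 + (\<alpha> * u)\<^sup>2))" for n
  proof -
    define K where "K = real (Suc n)"
    have K: "K > 0" by (simp add: K_def)
    have "(LBINT s:{0<..}. sin (b * s) * exp (- (2 * pi / \<alpha> * real (Suc n) * s))) = b / (b\<^sup>2 + (2 * pi / \<alpha> * real (Suc n))\<^sup>2)"
      using \<alpha> by (intro set_integral_sin_exp be(2)) auto
    also have "\<dots> = b / (b\<^sup>2 + (a * K)\<^sup>2)" by (simp add: a_def K_def)
    also have "b\<^sup>2 + (a * K)\<^sup>2 = a\<^sup>2 * (K\<^sup>2 + (\<alpha> * u)\<^sup>2)"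
    proof -
      have "b = a * (\<alpha> * u)" using \<alpha> by (simp add: a_def b_def)
      then show ?thesis by (simp add: power_mult_distrib algebra_simps)
    qed
    finally show ?thesis by (simp add: K_def)
  qed
  moreover have "(\<lambda>n. b / a\<^sup>2 * (1 / ((real (Suc n))\<^sup>2 + (\<alpha> * u)\<^sup>2))) sums 
     (b / a\<^sup>2 * (pi / (2 * (\<alpha> * u)) * (1 + 2 / (exp (2 * pi * (\<alpha> * u)) - 1)) - 1 / (2 * (\<alpha> * u)\<^sup>2)))"
    using \<alpha> u by (intro sums_mult coth_partial_fractions) auto
  ultimately have "(LBINT s:{0<..}. sin (b * s) / (exp (2 * pi * s / \<alpha>) - 1)) =
     b / a\<^sup>2 * (pi / (2 * (\<alpha> * u)) * (1 + 2 / (exp (2 * pi * (\<alpha> * u)) - 1)) - 1 / (2 * (\<alpha> * u)\<^sup>2))"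
    by (simp add: sums_iff)
  also have "\<dots> = \<alpha> / 4 + (2 * pi * \<alpha> / (exp (2 * pi * \<alpha> * u) - 1) - 1 / u) / (4 * pi)"
  proof -
    define E where "E = exp (2 * pi * \<alpha> * u) - 1"
    have E: "E \<noteq> 0" using \<alpha> u by (simp add: E_def)
    have 1: "b / a\<^sup>2 * (pi / (2 * (\<alpha> * u))) = \<alpha> / 4" "b / a\<^sup>2 * (1 / (2 * (\<alpha> * u)\<^sup>2)) = 1 / (4 * pi * u)"
      using \<alpha> u by (simp_all add: a_def b_def power2_eq_square field_simps)
    have dist: "b / a\<^sup>2 * (p * q - z) = (b / a\<^sup>2 * p) * q - b / a\<^sup>2 * z" for p q z
      by (simp only: right_diff_distrib mult.assoc)
    have "exp (2 * pi * (\<alpha> * u)) - 1 = E" by (simp add: E_def mult.assoc)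
    then have "b / a\<^sup>2 * (pi / (2 * (\<alpha> * u)) * (1 + 2 / (exp (2 * pi * (\<alpha> * u)) - 1)) - 1 / (2 * (\<alpha> * u)\<^sup>2)) =
       \<alpha> / 4 * (1 + 2 / E) - 1 / (4 * pi * u)"
      by (simp only: dist 1) 
    also have "\<dots> = \<alpha> / 4 + (2 * pi * \<alpha> / E - 1 / u) / (4 * pi)"
      using u E by (simp add: field_simps)
    finally show ?thesis unfolding E_def .
  qed
  finally show ?thesis by (simp add: b_def)
qed

section \<open>The logarithm of the exponential quotient, its derivative and its
  antiderivative\<close>

text \<open>Extends positivity and continuity to negative arguments, which occur because \<nu> may
  lie in (-1, 0).\<close>

lemma planck_uminus:
  assumes "\<beta> > 0" shows "planck \<beta> (- s) = planck \<beta> s + s"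
proof (cases "s = 0")
  case False
  define E where "E = exp (2 * pi * s / \<beta>)"
  have E: "E > 0" "E \<noteq> 1" using assms False by (auto simp: E_def)
  have "planck \<beta> (- s) = - s / (1 / E - 1)" using False by (simp add: planck_def E_def exp_minus inverse_eq_divide)
  also have "\<dots> = s / (E - 1) + s" using E by (simp add: divide_simps) (simp add: algebra_simps)
  finally show ?thesis using False by (simp add: planck_def E_def)
qed simp

lemma planck_pos:
  assumes "\<beta> > 0" shows "planck \<beta> s > 0"
proof -
  have pos: "planck \<beta> s > 0" if "s > 0" for s using that assms by (simp add: planck_def)
  show ?thesis
  proof (cases s "0::real" rule: linorder_cases)
    case less
    then show ?thesis using pos[of "- s"] planck_uminus[OF assms, of "- s"] by simp
  next
    case equal
    then show ?thesis using assms by (simp add: planck_def)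
  qed (rule pos)
qed

lemma isCont_planck:
  assumes \<beta>: "\<beta> > 0" shows "isCont (planck \<beta>) x"
proof (cases "x = 0")
  case True
  have "((\<lambda>s. planck \<beta> s - planck \<beta> 0) \<longlongrightarrow> 0) (at 0)"
  proof (rule Lim_null_comparison)
    \<comment> \<open>For negative \<open>s\<close> the reflection contributes a further |s| to the
      Lipschitz bound, hence the factor 2.\<close>
    have "\<bar>planck \<beta> s - planck \<beta> 0\<bar> \<le> 2 * \<bar>s\<bar>" for s
    proof (cases "s \<ge> 0")
      case True then show ?thesis using planck_lipschitz[OF \<beta>, of s 0] by simp
    next
      case False
      then show ?thesis using planck_lipschitz[OF \<beta>, of "- s" 0] planck_uminus[OF \<beta>, of s] by simp
    qed
    then show "\<forall>\<^sub>F s in at 0. norm (planck \<beta> s - planck \<beta> 0) \<le> 2 * \<bar>s\<bar>" by (intro always_eventually) simp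
    show "((\<lambda>s. 2 * \<bar>s\<bar>) \<longlongrightarrow> 0) (at (0::real))" by (auto intro!: tendsto_eq_intros)
  qed
  then show ?thesis unfolding True isCont_def by (simp add: LIM_zero_iff)
next
  case False
  have "isCont (\<lambda>s. s / (exp (2 * pi * s / \<beta>) - 1)) x" using False \<beta> by (intro continuous_intros) auto
  moreover have "\<forall>\<^sub>F s in nhds x. planck \<beta> s = s / (exp (2 * pi * s / \<beta>) - 1)"
    using t1_space_nhds[OF False] by eventually_elim (simp add: planck_def)
  ultimately show ?thesis by (simp add: isCont_cong)
qed

text \<open>Positivity and continuity of \<open>exp_quotient\<close>, also at the removable
  singularity, are inherited from \<open>planck\<close> at parameter
  \<open>1 / \<alpha>\<close>.\<close>

lemma exp_quotient_planck:
  assumes "\<alpha> > 0"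
  shows "exp_quotient \<alpha> \<nu> = exp (- 2 * pi * \<nu> * \<alpha>) / planck (1 / \<alpha>) \<nu>"
proof (cases "\<nu> = 0")
  case False
  have "exp (- 2 * pi * \<nu> * \<alpha>) * (exp (2 * pi * \<nu> / (1 / \<alpha>)) - 1) = 1 - exp (- 2 * pi * \<nu> * \<alpha>)"
    by (simp add: right_diff_distrib flip: exp_add)
  then show ?thesis using False by (simp add: exp_quotient_def planck_def)
qed (use assms in \<open>simp add: exp_quotient_def planck_def\<close>)

lemma exp_quotient_pos: "\<alpha> > 0 \<Longrightarrow> exp_quotient \<alpha> \<nu> > 0"
  by (simp add: exp_quotient_planck planck_pos)

lemma isCont_ln_exp_quotient:
  assumes \<alpha>: "\<alpha> > 0" shows "isCont (\<lambda>\<nu>. ln (exp_quotient \<alpha> \<nu>)) x"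
proof -
  have p: "planck (1 / \<alpha>) x > 0" using \<alpha> by (intro planck_pos) auto
  have c: "isCont (planck (1 / \<alpha>)) x" using \<alpha> by (intro isCont_planck) auto
  show ?thesis unfolding exp_quotient_planck[OF \<alpha>]
    using p by (intro continuous_intros c) auto
qed

text \<open>The derivative is the bracket in \<open>bose_sine_transform\<close>; this is how the
  principal value becomes tied to \<open>exp_quotient\<close>.\<close>

lemma DERIV_ln_exp_quotient:
  assumes \<alpha>: "\<alpha> > 0" and x: "x \<noteq> 0"
  shows "((\<lambda>\<nu>. ln (exp_quotient \<alpha> \<nu>)) has_real_derivative 2 * pi * \<alpha> / (exp (2 * pi * \<alpha> * x) - 1) - 1 / x) (at x)"
proof -
  define e where "e = exp (- (2 * pi * \<alpha> * x))"
  have e: "e \<noteq> 1" "e > 0" using \<alpha> x by (auto simp: e_def)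
  have q: "(1 - exp (- 2 * pi * x * \<alpha>)) / x > 0" using exp_quotient_pos[OF \<alpha>, of x] x by (simp add: exp_quotient_def)
  have qe: "exp (- 2 * pi * x * \<alpha>) = e" by (simp add: e_def mult_ac)
  have "((\<lambda>\<nu>. ln ((1 - exp (- 2 * pi * \<nu> * \<alpha>)) / \<nu>)) has_real_derivative
      1 / ((1 - e) / x) * (((2 * pi * \<alpha> * e) * x - (1 - e)) / (x * x))) (at x)"
    using q x unfolding qe[symmetric] by (auto intro!: derivative_eq_intros)
  also have "1 / ((1 - e) / x) * (((2 * pi * \<alpha> * e) * x - (1 - e)) / (x * x)) = 2 * pi * \<alpha> * (e / (1 - e)) - 1 / x"
    using x e by (simp add: field_simps)
  also have "e / (1 - e) = 1 / (exp (2 * pi * \<alpha> * x) - 1)"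
  proof -
    have "exp (2 * pi * \<alpha> * x) = 1 / e" by (simp add: e_def exp_minus inverse_eq_divide)
    moreover have "1 / e - 1 = (1 - e) / e" using e by (simp add: diff_divide_distrib)
    ultimately show ?thesis by simp
  qed
  finally have "((\<lambda>\<nu>. ln ((1 - exp (- 2 * pi * \<nu> * \<alpha>)) / \<nu>)) has_real_derivative 2 * pi * \<alpha> / (exp (2 * pi * \<alpha> * x) - 1) - 1 / x) (at x)"
    by simp
  moreover have "\<forall>\<^sub>F \<nu> in nhds x. ln (exp_quotient \<alpha> \<nu>) = ln ((1 - exp (- 2 * pi * \<nu> * \<alpha>)) / \<nu>)"
    using t1_space_nhds[OF x] by eventually_elim (simp add: exp_quotient_def)
  ultimately show ?thesis by (subst DERIV_cong_ev[OF refl _ refl])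
qed

text \<open>Existence from continuity is enough: only increments of \<Lambda> occur, and they cancel
  in the end.\<close>

lemma ln_exp_quotient_antiderivative:
  assumes "\<alpha> > 0"
  obtains \<Lambda> where "\<And>x. (\<Lambda> has_real_derivative ln (exp_quotient \<alpha> x)) (at x)"
proof -
  have "\<exists>F. \<forall>x :: real. -\<infinity> < ereal x \<longrightarrow> ereal x < \<infinity> \<longrightarrow> (F has_vector_derivative ln (exp_quotient \<alpha> x)) (at x)"
    by (rule einterval_antiderivative) (use isCont_ln_exp_quotient[OF assms] in auto)
  then show ?thesis using that by (auto simp: has_real_derivative_iff_has_vector_derivative)
qed

text \<open>Integration by parts: the integrand is t times the derivative of
  \<open>ln (exp_quotient \<alpha> t)\<close>.\<close>

lemma bose_interval_integral:
  assumes \<alpha>: "\<alpha> > 0" and \<Lambda>: "\<And>x. (\<Lambda> has_real_derivative ln (exp_quotient \<alpha> x)) (at x)"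
  shows "interval_lebesgue_integrable lborel 0 (ereal \<nu>) (\<lambda>t. 2 * pi * \<alpha> * t / (exp (2 * pi * \<alpha> * t) - 1) - 1)"
    and "(LBINT t=0..ereal \<nu>. (2 * pi * \<alpha> * t / (exp (2 * pi * \<alpha> * t) - 1) - 1)) = \<nu> * ln (exp_quotient \<alpha> \<nu>) - (\<Lambda> \<nu> - \<Lambda> 0)"
proof -
  \<comment> \<open>The continuous version. At t = 0 division by zero gives the original integrand
    the value -1, whereas \<open>g\<close> is 0 there; a single point does not affect the
    integral.\<close>
  define g where "g t = 2 * pi * \<alpha> * planck (1 / \<alpha>) t - 1" for t
  have eq: "2 * pi * \<alpha> * t / (exp (2 * pi * \<alpha> * t) - 1) - 1 = g t" if "t \<noteq> 0" for t
    using that by (simp add: g_def planck_def mult_ac)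
  have [measurable]: "g \<in> borel_measurable borel" unfolding g_def[abs_def] by measurable
  have cg: "isCont g t" for t
    unfolding g_def[abs_def] using \<alpha> by (intro continuous_intros isCont_planck) auto
  define F where "F t = t * ln (exp_quotient \<alpha> t) - \<Lambda> t" for t
  have dF: "(F has_real_derivative g t) (at t)" for t
  proof (cases "t = 0")
    case False
    have "(F has_real_derivative (1 * ln (exp_quotient \<alpha> t) + (2 * pi * \<alpha> / (exp (2 * pi * \<alpha> * t) - 1) - 1 / t) * t) - ln (exp_quotient \<alpha> t)) (at t)"
      unfolding F_def[abs_def] by (intro DERIV_diff DERIV_mult DERIV_ident DERIV_ln_exp_quotient[OF \<alpha> False] \<Lambda>)
    then show ?thesis using eq[OF False] False by (simp add: left_diff_distrib)
  next
    case True
    \<comment> \<open>The formula for the derivative of the logarithm excludes 0, but there the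
      difference quotient is the logarithm itself, so continuity suffices.\<close>
    have "((\<lambda>t. t * ln (exp_quotient \<alpha> t)) has_real_derivative ln (exp_quotient \<alpha> 0)) (at 0)"
    proof -
      have "((\<lambda>h. h * ln (exp_quotient \<alpha> h) / h) \<longlongrightarrow> ln (exp_quotient \<alpha> 0)) (at 0)"
        using isCont_ln_exp_quotient[OF \<alpha>, of 0] unfolding isCont_def
        by (rule Lim_transform_eventually) (auto simp: eventually_at_filter)
      then show ?thesis by (simp add: DERIV_def)
    qed
    from DERIV_diff[OF this \<Lambda>[of 0]] show ?thesis
      using \<alpha> unfolding True F_def[abs_def] by (simp add: g_def planck_def)
  qed
  have cong: "AE t in lborel. t \<in> S \<longrightarrow> 2 * pi * \<alpha> * t / (exp (2 * pi * \<alpha> * t) - 1) - 1 = g t" for S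
    using AE_lborel_singleton[of 0] by eventually_elim (use eq in auto)
  have gi: "interval_lebesgue_integrable lborel (ereal 0) (ereal \<nu>) g"
    by (rule interval_integrable_isCont) (rule cg)
  show "interval_lebesgue_integrable lborel 0 (ereal \<nu>) (\<lambda>t. 2 * pi * \<alpha> * t / (exp (2 * pi * \<alpha> * t) - 1) - 1)"
    using gi unfolding interval_lebesgue_integrable_def zero_ereal_def
    by (auto split: if_splits intro!: set_integrable_cong_AE[THEN iffD2, OF _ _ cong])
  have "(LBINT t=ereal 0..ereal \<nu>. (2 * pi * \<alpha> * t / (exp (2 * pi * \<alpha> * t) - 1) - 1)) = (LBINT t=ereal 0..ereal \<nu>. g t)"
    by (rule interval_integral_discrete_difference[of "{0}"]) (use eq in auto)
  also have "\<dots> = F \<nu> - F 0"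
  proof (rule interval_integral_FTC_finite)
    show "continuous_on {min 0 \<nu>..max 0 \<nu>} g" by (intro continuous_at_imp_continuous_on ballI cg)
    show "(F has_vector_derivative g x) (at x within {min 0 \<nu>..max 0 \<nu>})" for x
      using has_field_derivative_at_within[OF dF[of x]]
      by (simp only: has_real_derivative_iff_has_vector_derivative)
  qed
  finally show "(LBINT t=0..ereal \<nu>. (2 * pi * \<alpha> * t / (exp (2 * pi * \<alpha> * t) - 1) - 1)) = \<nu> * ln (exp_quotient \<alpha> \<nu>) - (\<Lambda> \<nu> - \<Lambda> 0)"
    by (simp add: F_def zero_ereal_def)
qed

text \<open>Integration by parts with a linear weight equal to -1/2 and 1/2 at the two ends, which
  leaves the trapezoidal mean minus the exact integral.\<close>

lemma trapezoid_ln_exp_quotient: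
  assumes \<alpha>: "\<alpha> > 0" and \<Lambda>: "\<And>x. (\<Lambda> has_real_derivative ln (exp_quotient \<alpha> x)) (at x)"
  shows "((\<lambda>u. (u - \<nu> - 1 / 2) * (2 * pi * \<alpha> / (exp (2 * pi * \<alpha> * u) - 1) - 1 / u)) has_integral
    (ln (exp_quotient \<alpha> \<nu>) + ln (exp_quotient \<alpha> (\<nu> + 1))) / 2 - (\<Lambda> (\<nu> + 1) - \<Lambda> \<nu>)) {\<nu>..\<nu> + 1}"
proof -
  define F where "F u = (u - \<nu> - 1 / 2) * ln (exp_quotient \<alpha> u) - \<Lambda> u" for u
  have "((\<lambda>u. (u - \<nu> - 1 / 2) * (2 * pi * \<alpha> / (exp (2 * pi * \<alpha> * u) - 1) - 1 / u)) has_integral F (\<nu> + 1) - F \<nu>) {\<nu>..\<nu> + 1}"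
  \<comment> \<open>The point 0, where the derivative formula fails, may lie inside the interval and
    is exempted.\<close>
  proof (rule fundamental_theorem_of_calculus_interior_strong[of "{0}"])
    show "continuous_on {\<nu>..\<nu> + 1} F"
      unfolding F_def[abs_def] using DERIV_isCont[OF \<Lambda>] isCont_ln_exp_quotient[OF \<alpha>]
      by (intro continuous_intros continuous_at_imp_continuous_on) auto
    fix u assume "u \<in> {\<nu><..<\<nu> + 1} - {0}"
    then have u: "u \<noteq> 0" by auto
    have "(F has_real_derivative ((1 - 0 - 0) * ln (exp_quotient \<alpha> u) + (2 * pi * \<alpha> / (exp (2 * pi * \<alpha> * u) - 1) - 1 / u) * (u - \<nu> - 1 / 2)) - ln (exp_quotient \<alpha> u)) (at u)"
      unfolding F_def[abs_def] by (intro DERIV_diff DERIV_mult DERIV_ident DERIV_const DERIV_ln_exp_quotient[OF \<alpha> u] \<Lambda>)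
    then show "(F has_vector_derivative (u - \<nu> - 1 / 2) * (2 * pi * \<alpha> / (exp (2 * pi * \<alpha> * u) - 1) - 1 / u)) (at u)"
      by (simp add: mult.commute flip: has_real_derivative_iff_has_vector_derivative)
  qed auto
  also have "F (\<nu> + 1) - F \<nu> = (ln (exp_quotient \<alpha> \<nu>) + ln (exp_quotient \<alpha> (\<nu> + 1))) / 2 - (\<Lambda> (\<nu> + 1) - \<Lambda> \<nu>)"
    by (simp add: F_def field_simps)
  finally show ?thesis .
qed

section \<open>The increment of the principal value\<close>

text \<open>The majorant around the former pole at t = 1, assembled from two reflected and
  translated copies of \<open>1 / sqrt u\<close>.\<close>

lemma set_integrable_one_over_sqrt_dist_1:
  "set_integrable lborel {0<..} (\<lambda>t::real. if \<bar>1 - t\<bar> < 1 then 1 / sqrt \<bar>1 - t\<bar> else 0)"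
proof -
  define h where "h u = indicator {0<..<1} u *\<^sub>R (1 / sqrt u)" for u :: real
  have h: "integrable lborel h"
    using set_integrable_one_over_sqrt[of 1] by (simp add: set_integrable_def h_def[abs_def])
  have "integrable lborel (\<lambda>t. h (1 + (-1) * t) + h (-1 + 1 * t))"
    by (intro Bochner_Integration.integrable_add lborel_integrable_real_affine h) auto
  moreover have "h (1 + (-1) * t) + h (-1 + 1 * t) = indicator {0<..} t *\<^sub>R (if \<bar>1 - t\<bar> < 1 then 1 / sqrt \<bar>1 - t\<bar> else 0)" for t
    by (cases t "1::real" rule: linorder_cases) (auto simp: h_def indicator_def)
  ultimately show ?thesis by (simp add: set_integrable_def)
qed

text \<open>For x = 2 pi s the factor is sin (pi s), which vanishes at every integer s; this is what
  removes the poles.\<close>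

lemma sin_shift_diff: "sin (x * (\<nu> + 1)) - sin (x * \<nu>) = 2 * cos (x * (\<nu> + 1 / 2)) * sin (x / 2)" for x :: real
proof -
  have "x * (\<nu> + 1) = x * (\<nu> + 1 / 2) + x / 2" "x * \<nu> = x * (\<nu> + 1 / 2) - x / 2" by (simp_all add: algebra_simps)
  then show ?thesis by (simp only: sin_add sin_diff)
qed

text \<open>In the increment the sine factor lowers the pole at t = 1 to
  \<open>1 / sqrt |1 - t|\<close>, so the principal value is an absolutely convergent integral. It
  is split into its terms, each rescaled by s = n t, and the terms are resummed under one integral;
  rescaling preserves the integrals of the absolute values, so their summability carries
  over.\<close>

lemma pv_value_shift_integral:
  assumes \<alpha>: "\<alpha> > 0"
  shows "pv_value \<alpha> (\<nu> + 1) - pv_value \<alpha> \<nu> = 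
    (LBINT s:{0<..}. \<Sum>n. (sin (2 * pi * (\<nu> + 1) * s) - sin (2 * pi * \<nu> * s)) / (exp (2 * pi * s / \<alpha>) - 1) / ((real (Suc n))\<^sup>2 - s\<^sup>2))"
proof -
  let ?w = "\<lambda>n. sqrt (real (Suc n)) / (real (Suc n))\<^sup>2"
  define G where "G t = pv_majorant t + (if \<bar>1 - t\<bar> < 1 then 1 / sqrt \<bar>1 - t\<bar> else 0)" for t
  have G: "set_integrable lborel {0<..} G"
    unfolding G_def[abs_def] by (intro set_integral_add set_integrable_pv_majorant set_integrable_one_over_sqrt_dist_1)
  \<comment> \<open>The 2 comes from the sum-to-product formula, \<alpha> from
    \<open>planck\<close>, and sqrt (2 pi) from |sin x| <= sqrt (2 |x|).\<close>
  define C where "C = 2 * \<alpha> * sqrt (2 * pi)"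
  have C0: "C \<ge> 0" using \<alpha> by (simp add: C_def)
  have CG: "set_integrable lborel {0<..} (\<lambda>t. C * G t)" using G by (rule set_integrable_mult_right)
  define \<Delta> where "\<Delta> n t = sin (2 * pi * real (Suc n) * (\<nu> + 1) * t) - sin (2 * pi * real (Suc n) * \<nu> * t)" for n t
  define f where "f n t = planck \<alpha> (real (Suc n) * t) / (real (Suc n))\<^sup>2 * \<Delta> n t / (t * (1 - t\<^sup>2))" for n t
  have [measurable]: "f n \<in> borel_measurable borel" for n unfolding f_def[abs_def] \<Delta>_def by measurable
  have bd: "\<bar>f n t\<bar> \<le> ?w n * (C * G t)" if "t \<in> {0<..}" for n t
  proof (cases "t = 1")
    case True
    \<comment> \<open>At t = 1 division by zero makes \<open>f n t\<close> equal to 0.\<close>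
    have "0 \<le> G t" using that by (auto simp: G_def pv_majorant_def)
    then show ?thesis using C0 True by (simp add: f_def)
  next
    case t1: False
    have t: "t > 0" using that by simp
    define K where "K = real (Suc n)"
    have K: "K \<ge> 1" by (simp add: K_def)
    have sK: "sqrt K \<ge> 1" using K by simp
    have p: "\<bar>planck \<alpha> (K * t)\<bar> \<le> \<alpha>" using \<alpha> K t by (intro planck_le) auto
    have "\<Delta> n t = sin ((2 * pi * K * t) * (\<nu> + 1)) - sin ((2 * pi * K * t) * \<nu>)" by (simp only: \<Delta>_def K_def mult_ac)
    also have "\<dots> = 2 * cos ((2 * pi * K * t) * (\<nu> + 1 / 2)) * sin ((2 * pi * K * t) / 2)" by (rule sin_shift_diff)
    finally have "\<bar>\<Delta> n t\<bar> = 2 * \<bar>cos ((2 * pi * K * t) * (\<nu> + 1 / 2))\<bar> * \<bar>sin ((2 * pi * K * t) / 2)\<bar>" by (simp add: abs_mult)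
    also have "\<dots> \<le> 2 * 1 * \<bar>sin ((2 * pi * K * t) / 2)\<bar>" by (intro mult_mono) auto
    finally have \<Delta>1: "\<bar>\<Delta> n t\<bar> \<le> 2 * \<bar>sin (pi * K * t)\<bar>" by (simp add: mult.assoc)
    \<comment> \<open>Two bounds on the same sine: by its zero at t = 0, and in \<open>s2\<close> by
      its zero at t = 1, where the argument is K pi.\<close>
    have s1: "\<bar>sin (pi * K * t)\<bar> \<le> sqrt (2 * pi) * sqrt K * sqrt t"
      using abs_sin_diff_le_sqrt[of "pi * K * t" 0] K t by (simp add: real_sqrt_mult abs_mult mult_ac)
    have s2: "\<bar>sin (pi * K * t)\<bar> \<le> sqrt (2 * pi) * sqrt K * sqrt \<bar>1 - t\<bar>"
    proof -
      have "sin (pi * K) = 0" unfolding K_def by (subst mult.commute) (rule sin_npi)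
      then have "\<bar>sin (pi * K * t)\<bar> \<le> sqrt (2 * \<bar>pi * K * t - pi * K\<bar>)"
        using abs_sin_diff_le_sqrt[of "pi * K * t" "pi * K"] by simp
      also have "\<bar>pi * K * t - pi * K\<bar> = pi * K * \<bar>1 - t\<bar>"
      proof -
        have "pi * K * t - pi * K = pi * K * (t - 1)" by (simp add: algebra_simps)
        then show ?thesis using K by (simp add: abs_mult abs_minus_commute)
      qed
      finally show ?thesis by (simp add: real_sqrt_mult mult_ac)
    qed
    have ker: "2 * \<bar>sin (pi * K * t)\<bar> * \<bar>1 / (t * (1 - t\<^sup>2))\<bar> \<le> 2 * sqrt (2 * pi) * sqrt K * G t"
    proof (cases "t < 2")
      case True
      have "\<bar>1 / (t * (1 - t\<^sup>2))\<bar> \<le> \<bar>pv_weight t\<bar> + \<bar>1 / (2 * (1 - t))\<bar>"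
        unfolding pv_kernel_decomp[OF t t1] if_P[OF True] by (rule abs_triangle_ineq)
      also have "\<dots> \<le> 1 / t + 1 / \<bar>1 - t\<bar>"
      proof -
        have half: "0 \<le> y \<Longrightarrow> y / 2 \<le> y" for y :: real by simp
        have e: "\<bar>1 / (2 * (1 - t))\<bar> = (1 / \<bar>1 - t\<bar>) / 2" by (simp only: abs_divide abs_mult) simp
        have "\<bar>1 / (2 * (1 - t))\<bar> \<le> 1 / \<bar>1 - t\<bar>" unfolding e by (rule half) simp
        then show ?thesis by (intro add_mono abs_pv_weight_le(1)[OF t True])
      qed
      finally have "\<bar>sin (pi * K * t)\<bar> * \<bar>1 / (t * (1 - t\<^sup>2))\<bar> \<le> \<bar>sin (pi * K * t)\<bar> * (1 / t + 1 / \<bar>1 - t\<bar>)"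
        by (intro mult_left_mono) auto
      also have "\<dots> = \<bar>sin (pi * K * t)\<bar> * (1 / t) + \<bar>sin (pi * K * t)\<bar> * (1 / \<bar>1 - t\<bar>)" by (rule distrib_left)
      also have "\<dots> \<le> (sqrt (2 * pi) * sqrt K * sqrt t) * (1 / t) + (sqrt (2 * pi) * sqrt K * sqrt \<bar>1 - t\<bar>) * (1 / \<bar>1 - t\<bar>)"
        using s1 s2 t by (intro add_mono mult_right_mono) auto
      also have "\<dots> = sqrt (2 * pi) * sqrt K * (sqrt t / t + sqrt \<bar>1 - t\<bar> / \<bar>1 - t\<bar>)"
        by (simp add: distrib_left)
      also have "sqrt t / t + sqrt \<bar>1 - t\<bar> / \<bar>1 - t\<bar> = G t"
        using t t1 True by (simp add: G_def pv_majorant_def sqrt_divide_self)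
      finally show ?thesis by simp
    next
      case False
      have "\<bar>1 / (t * (1 - t\<^sup>2))\<bar> \<le> 1 / t\<^sup>2" using abs_pv_weight_le(2)[OF t] False by (simp add: pv_weight_def)
      then have "2 * \<bar>sin (pi * K * t)\<bar> * \<bar>1 / (t * (1 - t\<^sup>2))\<bar> \<le> 2 * 1 * (1 / t\<^sup>2)" by (intro mult_mono) auto
      also have "\<dots> \<le> 2 * (sqrt (2 * pi) * sqrt K) * (1 / t\<^sup>2)"
      proof -
        have "sqrt (2 * pi) \<ge> 1" using pi_gt3 by simp
        then have "1 * 1 \<le> sqrt (2 * pi) * sqrt K" using sK by (intro mult_mono) auto
        then show ?thesis by (intro mult_right_mono mult_left_mono) auto
      qed
      also have "1 / t\<^sup>2 = G t" using False by (simp add: G_def pv_majorant_def)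
      finally show ?thesis by (simp add: mult_ac)
    qed
    have "\<bar>f n t\<bar> = (\<bar>planck \<alpha> (K * t)\<bar> / K\<^sup>2) * (\<bar>\<Delta> n t\<bar> * \<bar>1 / (t * (1 - t\<^sup>2))\<bar>)"
      by (simp add: f_def K_def abs_mult)
    also have "\<dots> \<le> (\<alpha> / K\<^sup>2) * (2 * \<bar>sin (pi * K * t)\<bar> * \<bar>1 / (t * (1 - t\<^sup>2))\<bar>)"
      using p \<Delta>1 \<alpha> by (intro mult_mono divide_right_mono mult_right_mono) auto
    also have "\<dots> \<le> (\<alpha> / K\<^sup>2) * (2 * sqrt (2 * pi) * sqrt K * G t)"
      using ker \<alpha> by (intro mult_left_mono) auto
    also have "\<dots> = sqrt K / K\<^sup>2 * (C * G t)" by (simp add: C_def)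
    finally show ?thesis by (simp add: K_def)
  qed
  note sw = set_integral_sums_dominated[OF _ _ bd summable_sqrt_over_square CG]
  have fint: "set_integrable lborel {0<..} (f n)" for n by (rule sw(1)) auto
  have fSint: "set_integrable lborel {0<..} (\<lambda>t. \<Sum>n. f n t)" by (rule sw(2)) auto
  have fsums: "(\<lambda>n. LBINT t:{0<..}. f n t) sums (LBINT t:{0<..}. \<Sum>n. f n t)" by (rule sw(3)) auto
  have fabs: "summable (\<lambda>n. LBINT t:{0<..}. \<bar>f n t\<bar>)" by (rule sw(4)) auto
  have pt: "M_integrand \<alpha> (\<nu> + 1) t - M_integrand \<alpha> \<nu> t = (\<Sum>n. f n t)" if "t \<in> {0<..}" for t
  proof -
    have t: "t > 0" using that by simp
    let ?p = "\<lambda>\<nu> n. planck \<alpha> (real (Suc n) * t) / (real (Suc n))\<^sup>2 * sin (2 * pi * real (Suc n) * \<nu> * t)"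
    have sm: "summable (?p (\<nu> + 1))" "summable (?p \<nu>)"
      using planck_series_bounds(1)[OF \<alpha>, of t] t by auto
    have "M_integrand \<alpha> (\<nu> + 1) t - M_integrand \<alpha> \<nu> t = (planck_series \<alpha> (\<nu> + 1) t - planck_series \<alpha> \<nu> t) / (t * (1 - t\<^sup>2))"
      using M_integrand_eq[OF \<alpha> t] by (simp add: diff_divide_distrib)
    also have "\<dots> = (\<Sum>n. (?p (\<nu> + 1) n - ?p \<nu> n) / (t * (1 - t\<^sup>2)))"
      unfolding planck_series_def by (simp only: suminf_diff[OF sm] suminf_divide[OF summable_diff[OF sm]])
    also have "\<dots> = (\<Sum>n. f n t)"
      by (rule suminf_cong) (simp only: f_def \<Delta>_def right_diff_distrib)
    finally show ?thesis .
  qed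
  \<comment> \<open>The increment is a principal value of an integrable function, so uniqueness
    identifies it with the ordinary integral.\<close>
  have "has_pv_integral (\<lambda>t. M_integrand \<alpha> (\<nu> + 1) t - M_integrand \<alpha> \<nu> t) {0<..} 1 (pv_value \<alpha> (\<nu> + 1) - pv_value \<alpha> \<nu>)"
    by (intro has_pv_integral_diff has_pv_integral_M_integrand \<alpha>)
  also have "?this \<longleftrightarrow> has_pv_integral (\<lambda>t. \<Sum>n. f n t) {0<..} 1 (pv_value \<alpha> (\<nu> + 1) - pv_value \<alpha> \<nu>)"
    by (rule has_pv_integral_cong) (rule pt)
  finally have "has_pv_integral (\<lambda>t. \<Sum>n. f n t) {0<..} 1 (pv_value \<alpha> (\<nu> + 1) - pv_value \<alpha> \<nu>)" .
  moreover have "has_pv_integral (\<lambda>t. \<Sum>n. f n t) {0<..} 1 (LBINT t:{0<..}. \<Sum>n. f n t)"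
    by (rule has_pv_integral_set_integrable[OF fSint]) simp
  ultimately have eq1: "pv_value \<alpha> (\<nu> + 1) - pv_value \<alpha> \<nu> = (LBINT t:{0<..}. \<Sum>n. f n t)"
    by (rule has_pv_integral_unique)

  define F where "F n s = (sin (2 * pi * (\<nu> + 1) * s) - sin (2 * pi * \<nu> * s)) / (exp (2 * pi * s / \<alpha>) - 1) / ((real (Suc n))\<^sup>2 - s\<^sup>2)" for n s
  have [measurable]: "F n \<in> borel_measurable borel" for n unfolding F_def[abs_def] by measurable
  \<comment> \<open>The factor n is the Jacobian of s = n t. At t = 1 both sides vanish through
    division by zero.\<close>
  have scale: "real (Suc n) * F n (real (Suc n) * t) = f n t" if t: "t > 0" for n t
  proof -
    define K where "K = real (Suc n)"
    have K: "K > 0" by (simp add: K_def)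
    have e: "K\<^sup>2 - (K * t)\<^sup>2 = K\<^sup>2 * (1 - t\<^sup>2)" by (simp add: power_mult_distrib algebra_simps)
    have d: "sin (2 * pi * (\<nu> + 1) * (K * t)) - sin (2 * pi * \<nu> * (K * t)) = \<Delta> n t"
      by (simp only: \<Delta>_def K_def mult_ac)
    have "K * F n (K * t) = K * (\<Delta> n t / (exp (2 * pi * (K * t) / \<alpha>) - 1) / (K\<^sup>2 * (1 - t\<^sup>2)))"
      unfolding F_def K_def[symmetric] d e ..
    also have "\<dots> = f n t"
      using t K unfolding f_def K_def[symmetric] planck_def by (simp add: power2_eq_square)
    finally show ?thesis by (simp add: K_def)
  qed
  define g where "g n s = indicator {0<..} s *\<^sub>R F n s" for n s
  have gK: "real (Suc n) * g n (0 + real (Suc n) * t) = indicator {0<..} t *\<^sub>R f n t" for n t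
    using scale[of t n] by (auto simp: g_def indicator_def zero_less_mult_iff simp del: of_nat_Suc)
  have gint: "integrable lborel (g n)" for n
  proof -
    have "integrable lborel (\<lambda>t. real (Suc n) * g n (0 + real (Suc n) * t))"
      unfolding gK using fint[of n] by (simp add: set_integrable_def)
    then have "integrable lborel (\<lambda>t. g n (0 + real (Suc n) * t))" by (simp del: of_nat_Suc add_0_left)
    then show ?thesis by (subst (asm) lborel_integrable_real_affine_iff) auto
  qed
  have gval: "(\<integral>s. g n s \<partial>lborel) = (LBINT t:{0<..}. f n t)" for n
  proof -
    have "(\<integral>s. g n s \<partial>lborel) = (\<integral>t. real (Suc n) * g n (0 + real (Suc n) * t) \<partial>lborel)"
      by (subst lborel_integral_real_affine[of "real (Suc n)" "g n" 0]) (simp_all del: of_nat_Suc)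
    then show ?thesis unfolding gK set_lebesgue_integral_def .
  qed
  have gabs: "(\<integral>s. norm (g n s) \<partial>lborel) = (LBINT t:{0<..}. \<bar>f n t\<bar>)" for n
  proof -
    have "(\<integral>s. norm (g n s) \<partial>lborel) = (\<integral>t. \<bar>real (Suc n) * g n (0 + real (Suc n) * t)\<bar> \<partial>lborel)"
      by (subst lborel_integral_real_affine[of "real (Suc n)" "\<lambda>s. norm (g n s)" 0]) (simp_all add: abs_mult del: of_nat_Suc)
    then show ?thesis unfolding gK set_lebesgue_integral_def by (simp add: abs_mult)
  qed
  \<comment> \<open>Off the integers the cotangent series converges, and its terms are eventually
    positive, so it converges absolutely.\<close>
  have gsm: "AE s in lborel. summable (\<lambda>n. norm (g n s))"
    using AE_no_multiple_in_Ints
  proof eventually_elim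
    case (elim s)
    have "s \<notin> \<int>" using elim[rule_format, of 0] by simp
    then have "summable (\<lambda>n. 1 / ((real (Suc n))\<^sup>2 - s\<^sup>2))"
      using cot_partial_fractions_real sums_summable by blast
    moreover have "\<forall>\<^sub>F n in sequentially. 1 / ((real (Suc n))\<^sup>2 - s\<^sup>2) = \<bar>1 / ((real (Suc n))\<^sup>2 - s\<^sup>2)\<bar>"
    proof -
      have "\<forall>\<^sub>F n in sequentially. \<bar>s\<bar> \<le> real n"
        using eventually_ge_at_top[of "nat \<lceil>\<bar>s\<bar>\<rceil>"] by eventually_elim linarith
      then show ?thesis
      proof eventually_elim
        case (elim n)
        then have "s\<^sup>2 \<le> (real (Suc n))\<^sup>2" by (intro abs_le_square_iff[THEN iffD1]) auto
        then show ?case by simp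
      qed
    qed
    ultimately have "summable (\<lambda>n. \<bar>1 / ((real (Suc n))\<^sup>2 - s\<^sup>2)\<bar>)"
      using summable_cong by fastforce
    then have "summable (\<lambda>n. \<bar>(sin (2 * pi * (\<nu> + 1) * s) - sin (2 * pi * \<nu> * s)) / (exp (2 * pi * s / \<alpha>) - 1)\<bar> * \<bar>1 / ((real (Suc n))\<^sup>2 - s\<^sup>2)\<bar>)"
      by (rule summable_mult)
    then have "summable (\<lambda>n. \<bar>F n s\<bar>)" by (simp add: F_def abs_mult)
    then show ?case by (auto simp: g_def indicator_def)
  qed
  have "(\<lambda>n. \<integral>s. g n s \<partial>lborel) sums (\<integral>s. (\<Sum>n. g n s) \<partial>lborel)"
    by (rule sums_integral[OF gint gsm]) (unfold gabs, rule fabs)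
  then have "(LBINT t:{0<..}. \<Sum>n. f n t) = (\<integral>s. (\<Sum>n. g n s) \<partial>lborel)"
    using fsums unfolding gval by (rule sums_unique2[rotated])
  also have "\<dots> = (LBINT s:{0<..}. \<Sum>n. F n s)"
    unfolding set_lebesgue_integral_def by (rule Bochner_Integration.integral_cong) (auto simp: g_def indicator_def)
  finally show ?thesis unfolding eq1 F_def .
qed

lemma trapezoid_sine:
  fixes s \<nu> :: real
  assumes s: "s \<noteq> 0"
  shows "(LBINT u:{\<nu>..\<nu> + 1}. (u - \<nu> - 1 / 2) * sin (2 * pi * u * s)) =
    (sin (2 * pi * (\<nu> + 1) * s) - sin (2 * pi * \<nu> * s)) / (4 * pi\<^sup>2 * s\<^sup>2)
    - (cos (2 * pi * (\<nu> + 1) * s) + cos (2 * pi * \<nu> * s)) / (4 * pi * s)"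
proof -
  define b where "b = 2 * pi * s"
  have b: "b \<noteq> 0" using s by (simp add: b_def)
  define p where "p = 1 / b\<^sup>2"
  define r where "r = 1 / b"
  define F where "F u = p * sin (b * u) - r * ((u - \<nu> - 1 / 2) * cos (b * u))" for u
  have dF: "(F has_real_derivative (u - \<nu> - 1 / 2) * sin (b * u)) (at u)" for u
  proof -
    have "(F has_real_derivative p * (cos (b * u) * b) - r * ((1 * cos (b * u)) + (- sin (b * u) * b) * (u - \<nu> - 1 / 2))) (at u)"
      unfolding F_def[abs_def] by (auto intro!: derivative_eq_intros)
    also have "p * (cos (b * u) * b) - r * ((1 * cos (b * u)) + (- sin (b * u) * b) * (u - \<nu> - 1 / 2)) = (u - \<nu> - 1 / 2) * sin (b * u)"
      using b by (simp add: p_def r_def power2_eq_square distrib_left right_diff_distrib left_diff_distrib diff_divide_distrib)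
    finally show ?thesis .
  qed
  have "(LBINT u:{\<nu>..\<nu> + 1}. (u - \<nu> - 1 / 2) * sin (b * u)) = F (\<nu> + 1) - F \<nu>"
    unfolding set_lebesgue_integral_def
  proof (rule integral_FTC_atLeastAtMost)
    show "(F has_vector_derivative (u - \<nu> - 1 / 2) * sin (b * u)) (at u within {\<nu>..\<nu> + 1})" for u
      using has_field_derivative_at_within[OF dF[of u]] by (simp only: has_real_derivative_iff_has_vector_derivative)
  qed (auto intro!: continuous_intros)
  also have "\<dots> = (sin (b * (\<nu> + 1)) - sin (b * \<nu>)) / b\<^sup>2 - (cos (b * (\<nu> + 1)) + cos (b * \<nu>)) / (2 * b)"
    by (simp add: F_def p_def r_def add_divide_distrib diff_divide_distrib)
  finally show ?thesis using s by (simp add: b_def power_mult_distrib mult_ac)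
qed

text \<open>The difference of the two sines is 2 c sin (pi s) and the sum of the two cosines is 2 c
  cos (pi s) with the same c. Multiplying the difference by cot (pi s) therefore yields the cosine
  sum, without poles, and both terms match \<open>trapezoid_sine\<close> up to the factor 2
  pi^2.\<close>

lemma cot_series_trapezoid:
  fixes s :: real
  assumes s: "s \<notin> \<int>"
  shows "(\<Sum>n. (sin (2 * pi * (\<nu> + 1) * s) - sin (2 * pi * \<nu> * s)) / E / ((real (Suc n))\<^sup>2 - s\<^sup>2)) =
    2 * pi\<^sup>2 * (LBINT u:{\<nu>..\<nu> + 1}. (u - \<nu> - 1 / 2) * sin (2 * pi * u * s)) / E"
proof -
  have s0: "s \<noteq> 0" using s by auto
  have sn: "sin (pi * s) \<noteq> 0"
  proof
    assume "sin (pi * s) = 0"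
    then obtain i :: int where "pi * s = of_int i * pi" unfolding sin_zero_iff_int2 by blast
    then have "s = of_int i" by simp
    then show False using s by simp
  qed
  define x where "x = 2 * pi * s"
  define S where "S = sin (x * (\<nu> + 1)) - sin (x * \<nu>)"
  define c where "c = cos (x * (\<nu> + 1 / 2))"
  have S: "S = 2 * c * sin (pi * s)" unfolding S_def c_def sin_shift_diff by (simp add: x_def)
  have C: "cos (x * (\<nu> + 1)) + cos (x * \<nu>) = 2 * c * cos (pi * s)"
  proof -
    have "x * (\<nu> + 1) = x * (\<nu> + 1 / 2) + x / 2" "x * \<nu> = x * (\<nu> + 1 / 2) - x / 2" by (simp_all add: algebra_simps)
    then have "cos (x * (\<nu> + 1)) + cos (x * \<nu>) = 2 * c * cos (x / 2)" by (simp only: cos_add cos_diff c_def)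
    then show ?thesis by (simp add: x_def)
  qed
  have "(\<lambda>n. S / E * (1 / ((real (Suc n))\<^sup>2 - s\<^sup>2))) sums (S / E * (1 / (2 * s\<^sup>2) - pi * cos (pi * s) / (2 * s * sin (pi * s))))"
    by (intro sums_mult cot_partial_fractions_real s)
  then have "(\<Sum>n. S / E / ((real (Suc n))\<^sup>2 - s\<^sup>2)) = S * (1 / (2 * s\<^sup>2) - pi * cos (pi * s) / (2 * s * sin (pi * s))) / E"
    by (simp add: sums_iff)
  also have "S * (1 / (2 * s\<^sup>2) - pi * cos (pi * s) / (2 * s * sin (pi * s))) = S / (2 * s\<^sup>2) - pi * (2 * c * cos (pi * s)) / (2 * s)"
    using sn unfolding S right_diff_distrib by simp
  also have "\<dots> = 2 * pi\<^sup>2 * (S / (4 * pi\<^sup>2 * s\<^sup>2) - (2 * c * cos (pi * s)) / (4 * pi * s))"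
    using s0 by (simp add: right_diff_distrib power2_eq_square)
  also have "S / (4 * pi\<^sup>2 * s\<^sup>2) - (2 * c * cos (pi * s)) / (4 * pi * s) = (LBINT u:{\<nu>..\<nu> + 1}. (u - \<nu> - 1 / 2) * sin (2 * pi * u * s))"
    unfolding trapezoid_sine[OF s0] C[symmetric] S_def by (simp add: x_def mult_ac)
  finally show ?thesis by (simp add: S_def x_def mult_ac)
qed

text \<open>Fubini applied to the double integral over s and u, with the sine transform inside. The
  factor pi / 2 is 2 pi^2 times the 1 / (4 pi) of the transform.\<close>

lemma pv_value_shift:
  assumes \<alpha>: "\<alpha> > 0" and \<Lambda>: "\<And>x. (\<Lambda> has_real_derivative ln (exp_quotient \<alpha> x)) (at x)"
  shows "pv_value \<alpha> (\<nu> + 1) - pv_value \<alpha> \<nu> = 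
    pi / 2 * ((ln (exp_quotient \<alpha> \<nu>) + ln (exp_quotient \<alpha> (\<nu> + 1))) / 2 - (\<Lambda> (\<nu> + 1) - \<Lambda> \<nu>))"
proof -
  define E where "E s = exp (2 * pi * s / \<alpha>) - 1" for s
  have [measurable]: "E \<in> borel_measurable borel" unfolding E_def[abs_def] by measurable
  define h where "h s u = indicator {0<..} s * (indicator {\<nu>..\<nu> + 1} u * ((u - \<nu> - 1 / 2) * sin (2 * pi * u * s) / E s))" for s u
  \<comment> \<open>Half, as the bound on |u - \<nu> - 1/2|, times 2 pi (|\<nu>| + 1) from |sin x|
    <= |x|; the remaining s / E s is \<open>planck\<close>.\<close>
  define B where "B = pi * (\<bar>\<nu>\<bar> + 1)"
  have hm: "(\<lambda>(s, u). h s u) \<in> borel_measurable (lborel \<Otimes>\<^sub>M lborel)"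
    unfolding h_def case_prod_unfold by measurable
  have hb: "\<bar>h s u\<bar> \<le> indicator {0<..} s * planck \<alpha> s * B * indicator {\<nu>..\<nu> + 1} u" for s u
  proof (cases "s > 0 \<and> u \<in> {\<nu>..\<nu> + 1}")
    case True
    then have s: "s > 0" and u: "\<nu> \<le> u" "u \<le> \<nu> + 1" by auto
    have Es: "E s > 0" using s \<alpha> by (simp add: E_def)
    have "\<bar>sin (2 * pi * u * s)\<bar> \<le> 2 * pi * \<bar>u\<bar> * s"
      using abs_sin_x_le_abs_x[of "2 * pi * u * s"] s by (simp add: abs_mult)
    also have "\<dots> \<le> 2 * pi * (\<bar>\<nu>\<bar> + 1) * s" using u s by (intro mult_right_mono mult_left_mono) auto
    finally have "\<bar>sin (2 * pi * u * s)\<bar> \<le> 2 * pi * (\<bar>\<nu>\<bar> + 1) * s" .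
    moreover have "\<bar>u - \<nu> - 1 / 2\<bar> \<le> 1 / 2" using u by linarith
    ultimately have "\<bar>u - \<nu> - 1 / 2\<bar> * \<bar>sin (2 * pi * u * s)\<bar> / E s \<le> (1 / 2) * (2 * pi * (\<bar>\<nu>\<bar> + 1) * s) / E s"
      using Es by (intro divide_right_mono mult_mono) auto
    also have "\<dots> = planck \<alpha> s * B" using s by (simp add: planck_def E_def B_def)
    finally show ?thesis using True Es by (simp add: h_def abs_mult)
  next
    case False
    then show ?thesis by (auto simp: h_def)
  qed
  have hu: "integrable lborel (\<lambda>u. h s u)" for s
  proof (rule Bochner_Integration.integrable_bound)
    show "integrable lborel (\<lambda>u. indicator {0<..} s * planck \<alpha> s * B * indicator {\<nu>..\<nu> + 1} u)"
      by (intro integrable_mult_right integrable_real_indicator) auto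
    show "(\<lambda>u. h s u) \<in> borel_measurable lborel" unfolding h_def by measurable
    show "AE u in lborel. norm (h s u) \<le> norm (indicator {0<..} s * planck \<alpha> s * B * indicator {\<nu>..\<nu> + 1} u)"
      by (intro AE_I2) (use hb[of s] abs_ge_self order_trans in \<open>simp only: real_norm_def, blast\<close>)
  qed
  have hi: "integrable (lborel \<Otimes>\<^sub>M lborel) (\<lambda>(s, u). h s u)"
  proof (rule lborel_pair.Fubini_integrable[OF hm])
    have "integrable lborel (\<lambda>s. \<integral>u. \<bar>h s u\<bar> \<partial>lborel)"
    proof (rule Bochner_Integration.integrable_bound)
      show "integrable lborel (\<lambda>s. indicator {0<..} s *\<^sub>R planck \<alpha> s * B)"
        using planck_integral(1)[OF \<alpha>] by (simp add: set_integrable_def)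
      show "(\<lambda>s. \<integral>u. \<bar>h s u\<bar> \<partial>lborel) \<in> borel_measurable lborel"
        using hm by (intro lborel.borel_measurable_lebesgue_integral) (simp add: case_prod_unfold)
      show "AE s in lborel. norm (\<integral>u. \<bar>h s u\<bar> \<partial>lborel) \<le> norm (indicator {0<..} s *\<^sub>R planck \<alpha> s * B)"
      proof (rule AE_I2)
        fix s
        have "(\<integral>u. \<bar>h s u\<bar> \<partial>lborel) \<le> (\<integral>u. indicator {0<..} s * planck \<alpha> s * B * indicator {\<nu>..\<nu> + 1} u \<partial>lborel)"
          by (intro integral_mono integrable_abs hu hb integrable_mult_right integrable_real_indicator) auto
        also have "\<dots> = indicator {0<..} s * planck \<alpha> s * B" by simp
        finally have "(\<integral>u. \<bar>h s u\<bar> \<partial>lborel) \<le> indicator {0<..} s * planck \<alpha> s * B" .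
        moreover have "0 \<le> (\<integral>u. \<bar>h s u\<bar> \<partial>lborel)" by (rule integral_nonneg_AE) auto
        ultimately show "norm (\<integral>u. \<bar>h s u\<bar> \<partial>lborel) \<le> norm (indicator {0<..} s *\<^sub>R planck \<alpha> s * B)" by simp
      qed
    qed
    then show "integrable lborel (\<lambda>s. \<integral>u. norm (case (s, u) of (s, u) \<Rightarrow> h s u) \<partial>lborel)" by simp
  qed (use hu in auto)
  have "pv_value \<alpha> (\<nu> + 1) - pv_value \<alpha> \<nu> =
     (LBINT s:{0<..}. \<Sum>n. (sin (2 * pi * (\<nu> + 1) * s) - sin (2 * pi * \<nu> * s)) / E s / ((real (Suc n))\<^sup>2 - s\<^sup>2))"
    unfolding E_def by (rule pv_value_shift_integral[OF \<alpha>])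
  also have "\<dots> = (\<integral>s. 2 * pi\<^sup>2 * (\<integral>u. h s u \<partial>lborel) \<partial>lborel)"
    unfolding set_lebesgue_integral_def
  proof (rule integral_cong_AE)
    show "(\<lambda>s. 2 * pi\<^sup>2 * (\<integral>u. h s u \<partial>lborel)) \<in> borel_measurable lborel"
      using lborel.borel_measurable_lebesgue_integral[OF hm] by simp
    show "AE s in lborel. indicator {0<..} s *\<^sub>R (\<Sum>n. (sin (2 * pi * (\<nu> + 1) * s) - sin (2 * pi * \<nu> * s)) / E s / ((real (Suc n))\<^sup>2 - s\<^sup>2)) =
        2 * pi\<^sup>2 * (\<integral>u. h s u \<partial>lborel)"
      using AE_no_multiple_in_Ints
    proof eventually_elim
      case (elim s)
      have "s \<notin> \<int>" using elim[rule_format, of 0] by simp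
      note cot_series_trapezoid[OF this, of \<nu> "E s"]
      moreover have "(\<integral>u. h s u \<partial>lborel) = indicator {0<..} s * ((LBINT u:{\<nu>..\<nu> + 1}. (u - \<nu> - 1 / 2) * sin (2 * pi * u * s)) / E s)"
        unfolding h_def set_lebesgue_integral_def by simp
      ultimately show ?case by simp
    qed
  qed measurable
  also have "\<dots> = 2 * pi\<^sup>2 * (\<integral>u. (\<integral>s. h s u \<partial>lborel) \<partial>lborel)"
    using lborel_pair.Fubini_integral[OF hi] by simp
  also have "(\<integral>u. (\<integral>s. h s u \<partial>lborel) \<partial>lborel) = (1 / (4 * pi)) * ((ln (exp_quotient \<alpha> \<nu>) + ln (exp_quotient \<alpha> (\<nu> + 1))) / 2 - (\<Lambda> (\<nu> + 1) - \<Lambda> \<nu>))"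
  proof -
    define k where "k u = (u - \<nu> - 1 / 2) * (\<alpha> / 4 + (2 * pi * \<alpha> / (exp (2 * pi * \<alpha> * u) - 1) - 1 / u) / (4 * pi))" for u
    have [measurable]: "k \<in> borel_measurable borel" unfolding k_def[abs_def] by measurable
    have ae: "AE u in lborel. (\<integral>s. h s u \<partial>lborel) = indicator {\<nu>..\<nu> + 1} u *\<^sub>R k u"
      using AE_lborel_singleton[of 0]
    proof eventually_elim
      case (elim u)
      have "(\<integral>s. h s u \<partial>lborel) = (\<integral>s. (indicator {\<nu>..\<nu> + 1} u * (u - \<nu> - 1 / 2)) * (indicator {0<..} s * (sin (2 * pi * u * s) / E s)) \<partial>lborel)"
        by (rule Bochner_Integration.integral_cong) (simp_all add: h_def)
      also have "\<dots> = (indicator {\<nu>..\<nu> + 1} u * (u - \<nu> - 1 / 2)) * (LBINT s:{0<..}. sin (2 * pi * u * s) / E s)"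
        unfolding set_lebesgue_integral_def real_scaleR_def by (rule Bochner_Integration.integral_mult_right_zero)
      finally show ?case using bose_sine_transform[OF \<alpha> elim] unfolding E_def k_def by simp
    qed
    have hsi: "integrable lborel (\<lambda>u. \<integral>s. h s u \<partial>lborel)"
      using lborel_pair.integrable_snd[OF hi] .
    have hsm: "(\<lambda>u. \<integral>s. h s u \<partial>lborel) \<in> borel_measurable lborel"
      using hsi by (rule borel_measurable_integrable)
    have km: "(\<lambda>u. indicator {\<nu>..\<nu> + 1} u *\<^sub>R k u) \<in> borel_measurable lborel" by measurable
    \<comment> \<open>Integrability of \<open>k\<close>, also across u = 0, is inherited from
      Fubini's theorem through almost everywhere equality.\<close>
    have int: "set_integrable lborel {\<nu>..\<nu> + 1} k"
      unfolding set_integrable_def using hsi integrable_cong_AE[OF hsm km ae] by blast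
    have "(\<integral>u. (\<integral>s. h s u \<partial>lborel) \<partial>lborel) = (LBINT u:{\<nu>..\<nu> + 1}. k u)"
      unfolding set_lebesgue_integral_def by (rule integral_cong_AE[OF hsm km ae])
    also have "\<dots> = integral {\<nu>..\<nu> + 1} k" by (rule set_borel_integral_eq_integral(2)[OF int])
    also have "\<dots> = (1 / (4 * pi)) * ((ln (exp_quotient \<alpha> \<nu>) + ln (exp_quotient \<alpha> (\<nu> + 1))) / 2 - (\<Lambda> (\<nu> + 1) - \<Lambda> \<nu>))"
    proof (rule integral_unique)
      \<comment> \<open>The weight has mean zero over the interval, which removes the constant
        \<alpha> / 4.\<close>
      have "((\<lambda>u. u - \<nu> - 1 / 2) has_integral (((\<nu> + 1)\<^sup>2 / 2 - (\<nu> + 1 / 2) * (\<nu> + 1)) - (\<nu>\<^sup>2 / 2 - (\<nu> + 1 / 2) * \<nu>))) {\<nu>..\<nu> + 1}"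
        by (rule fundamental_theorem_of_calculus)
           (auto intro!: derivative_eq_intros simp flip: has_real_derivative_iff_has_vector_derivative)
      also have "((\<nu> + 1)\<^sup>2 / 2 - (\<nu> + 1 / 2) * (\<nu> + 1)) - (\<nu>\<^sup>2 / 2 - (\<nu> + 1 / 2) * \<nu>) = 0"
        by (simp add: power2_eq_square field_simps)
      finally have 1: "((\<lambda>u. u - \<nu> - 1 / 2) has_integral 0) {\<nu>..\<nu> + 1}" .
      have "((\<lambda>u. \<alpha> / 4 * (u - \<nu> - 1 / 2) + 1 / (4 * pi) * ((u - \<nu> - 1 / 2) * (2 * pi * \<alpha> / (exp (2 * pi * \<alpha> * u) - 1) - 1 / u))) has_integral
        (\<alpha> / 4 * 0 + 1 / (4 * pi) * ((ln (exp_quotient \<alpha> \<nu>) + ln (exp_quotient \<alpha> (\<nu> + 1))) / 2 - (\<Lambda> (\<nu> + 1) - \<Lambda> \<nu>)))) {\<nu>..\<nu> + 1}"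
        by (intro has_integral_add has_integral_mult_right 1 trapezoid_ln_exp_quotient[OF \<alpha> \<Lambda>])
      moreover have "\<alpha> / 4 * (u - \<nu> - 1 / 2) + 1 / (4 * pi) * ((u - \<nu> - 1 / 2) * (2 * pi * \<alpha> / (exp (2 * pi * \<alpha> * u) - 1) - 1 / u)) = k u" for u
        by (simp only: k_def distrib_left) simp
      ultimately show "(k has_integral (1 / (4 * pi)) * ((ln (exp_quotient \<alpha> \<nu>) + ln (exp_quotient \<alpha> (\<nu> + 1))) / 2 - (\<Lambda> (\<nu> + 1) - \<Lambda> \<nu>))) {\<nu>..\<nu> + 1}"
        by (simp only: mult_zero_right add_0_left)
    qed
    finally show ?thesis .
  qed
  also have "2 * pi\<^sup>2 * (1 / (4 * pi) * y) = pi / 2 * y" for y :: real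
    by (simp add: power2_eq_square)
  finally show ?thesis .
qed

section \<open>Periodicity and asymptotics in the parameter\<close>

text \<open>For the last claim, the tail is the whole product divided by a partial product; the
  whole is positive, so the ratio tends to 1.\<close>

lemma qpochhammer_inf_props:
  assumes x: "0 < x" "x < 1" and q: "0 < q" "q < 1"
  shows "convergent_prod (\<lambda>n. 1 - x * q ^ n)" "qpochhammer_inf x q > 0"
    and "qpochhammer_inf x q = qpochhammer_inf (x * q ^ N) q * (\<Prod>i<N. 1 - x * q ^ i)"
    and "(\<lambda>N. qpochhammer_inf (x * q ^ N) q) \<longlonglongrightarrow> 1"
proof -
  let ?f = "\<lambda>n. 1 - x * q ^ n"
  have pos: "?f n > 0" for n
  proof -
    have "x * q ^ n \<le> x * 1" using x q by (intro mult_left_mono power_le_one) auto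
    then show ?thesis using x by linarith
  qed
  have "summable (\<lambda>n. x * q ^ n)" using q by (intro summable_mult summable_geometric) auto
  then have "abs_convergent_prod ?f" using x q by (simp add: abs_convergent_prod_conv_summable)
  then show conv: "convergent_prod ?f" by (rule abs_convergent_prod_imp_convergent_prod)
  show P: "qpochhammer_inf x q > 0" unfolding qpochhammer_inf_def by (rule less_0_prodinf[OF conv pos])
  show split: "qpochhammer_inf x q = qpochhammer_inf (x * q ^ N) q * (\<Prod>i<N. ?f i)" for N
  proof -
    have "?f i \<noteq> 0" for i using pos[of i] by simp
    then show ?thesis using prodinf_split_initial_segment[OF conv, of N]
      by (simp add: qpochhammer_inf_def power_add mult_ac)
  qed
  have "(\<lambda>n. \<Prod>i<Suc n. ?f i) \<longlonglongrightarrow> qpochhammer_inf x q"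
    unfolding qpochhammer_inf_def lessThan_Suc_atMost by (rule convergent_prod_LIMSEQ[OF conv])
  then have "(\<lambda>n. \<Prod>i<n. ?f i) \<longlonglongrightarrow> qpochhammer_inf x q" by (subst (asm) filterlim_sequentially_Suc)
  then have "(\<lambda>n. qpochhammer_inf x q / (\<Prod>i<n. ?f i)) \<longlonglongrightarrow> qpochhammer_inf x q / qpochhammer_inf x q"
    using P by (intro tendsto_divide tendsto_const) auto
  moreover have "qpochhammer_inf x q / (\<Prod>i<n. ?f i) = qpochhammer_inf (x * q ^ n) q" for n
  proof -
    have "(\<Prod>i<n. ?f i) > 0" using pos by (intro prod_pos) auto
    then have nz: "(\<Prod>i<n. ?f i) \<noteq> 0" by linarith
    show ?thesis unfolding nonzero_divide_eq_eq[OF nz] by (rule split)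
  qed
  ultimately show "(\<lambda>N. qpochhammer_inf (x * q ^ N) q) \<longlonglongrightarrow> 1" using P by simp
qed

text \<open>Adding \<nu> cancels the -1 in the integrand; what remains tends to 2 pi \<alpha> times
  the integral of \<open>planck (1 / \<alpha>)\<close>, which is 1 / (24 \<alpha>^2).\<close>

lemma bose_interval_integral_tendsto:
  assumes \<alpha>: "\<alpha> > 0"
  shows "((\<lambda>\<nu>. (LBINT t=0..ereal \<nu>. (2 * pi * \<alpha> * t / (exp (2 * pi * \<alpha> * t) - 1) - 1)) + \<nu>) \<longlongrightarrow> pi / (12 * \<alpha>)) at_top"
proof -
  let ?p = "planck (1 / \<alpha>)"
  have \<beta>: "1 / \<alpha> > 0" using \<alpha> by simp
  note pint = planck_integral(1)[OF \<beta>]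
  have "((\<lambda>y. \<integral>t. indicator {..y} t *\<^sub>R (indicator {0<..} t *\<^sub>R ?p t) \<partial>lborel) \<longlongrightarrow> (\<integral>t. indicator {0<..} t *\<^sub>R ?p t \<partial>lborel)) at_top"
    using pint unfolding set_integrable_def by (intro tendsto_integral_at_top) auto
  then have "((\<lambda>y. 2 * pi * \<alpha> * (\<integral>t. indicator {..y} t *\<^sub>R (indicator {0<..} t *\<^sub>R ?p t) \<partial>lborel)) \<longlongrightarrow> 2 * pi * \<alpha> * (LBINT t:{0<..}. ?p t)) at_top"
    unfolding set_lebesgue_integral_def by (intro tendsto_mult tendsto_const)
  also have "2 * pi * \<alpha> * (LBINT t:{0<..}. ?p t) = pi / (12 * \<alpha>)"
    unfolding planck_integral(2)[OF \<beta>] using \<alpha> by (simp add: power2_eq_square)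
  finally have "((\<lambda>y. 2 * pi * \<alpha> * (\<integral>t. indicator {..y} t *\<^sub>R (indicator {0<..} t *\<^sub>R ?p t) \<partial>lborel)) \<longlongrightarrow> pi / (12 * \<alpha>)) at_top" .
  moreover have "\<forall>\<^sub>F \<nu> in at_top. 2 * pi * \<alpha> * (\<integral>t. indicator {..\<nu>} t *\<^sub>R (indicator {0<..} t *\<^sub>R ?p t) \<partial>lborel)
     = (LBINT t=0..ereal \<nu>. (2 * pi * \<alpha> * t / (exp (2 * pi * \<alpha> * t) - 1) - 1)) + \<nu>"
    using eventually_gt_at_top[of 0]
  proof eventually_elim
    case (elim \<nu>)
    have i1: "set_integrable lborel {0<..<\<nu>} (\<lambda>t. 2 * pi * \<alpha> * ?p t)"
      by (intro set_integrable_mult_right set_integrable_subset[OF pint]) auto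
    have i2: "set_integrable lborel {0<..<\<nu>} (\<lambda>t. 1::real)"
      using elim by (auto simp: set_integrable_def intro!: integrable_real_indicator)
    have "(LBINT t=0..ereal \<nu>. (2 * pi * \<alpha> * t / (exp (2 * pi * \<alpha> * t) - 1) - 1)) = (LBINT t:{0<..<\<nu>}. 2 * pi * \<alpha> * t / (exp (2 * pi * \<alpha> * t) - 1) - 1)"
      using elim by (simp add: interval_lebesgue_integral_def einterval_eq zero_ereal_def)
    also have "\<dots> = (LBINT t:{0<..<\<nu>}. 2 * pi * \<alpha> * ?p t - 1)"
      by (rule set_lebesgue_integral_cong) (auto simp: planck_def mult_ac)
    also have "\<dots> = (LBINT t:{0<..<\<nu>}. 2 * pi * \<alpha> * ?p t) - (LBINT t:{0<..<\<nu>}. 1)"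
      by (rule set_integral_diff(2)[OF i1 i2])
    also have "(LBINT t:{0<..<\<nu>}. 1) = \<nu>" using elim by (simp add: set_lebesgue_integral_def)
    also have "(LBINT t:{0<..<\<nu>}. 2 * pi * \<alpha> * ?p t) = 2 * pi * \<alpha> * (LBINT t:{0<..<\<nu>}. ?p t)" by simp
    also have "(LBINT t:{0<..<\<nu>}. ?p t) = (\<integral>t. indicator {..\<nu>} t *\<^sub>R (indicator {0<..} t *\<^sub>R ?p t) \<partial>lborel)"
      unfolding set_lebesgue_integral_def
    proof (rule integral_cong_AE)
      show "AE t in lborel. indicator {0<..<\<nu>} t *\<^sub>R ?p t = indicator {..\<nu>} t *\<^sub>R (indicator {0<..} t *\<^sub>R ?p t)"
        using AE_lborel_singleton[of \<nu>] by eventually_elim (auto simp: indicator_def)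
    qed measurable
    finally show ?case by simp
  qed
  ultimately show ?thesis by (rule Lim_transform_eventually)
qed

text \<open>With y = \<nu> + N, ln (\<open>exp_quotient\<close>) splits into an exponentially small
  part and - ln y. The latter supplies the term (y + 1/2) ln y of Stirling's formula, and the linear
  term y of that formula cancels against the growth of the interval integral.\<close>

lemma elementary_part_tendsto:
  assumes \<alpha>: "\<alpha> > 0" and \<nu>: "\<nu> > -1"
  shows "(\<lambda>N. ln (sqrt (2 * pi) / Gamma (\<nu> + real N + 1)) - (\<nu> + real N + 1 / 2) * ln (exp_quotient \<alpha> (\<nu> + real N))
    + (LBINT t=0..ereal (\<nu> + real N). (2 * pi * \<alpha> * t / (exp (2 * pi * \<alpha> * t) - 1) - 1))) \<longlonglongrightarrow> pi / (12 * \<alpha>)"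
proof -
  define J where "J \<nu> = (LBINT t=0..ereal \<nu>. (2 * pi * \<alpha> * t / (exp (2 * pi * \<alpha> * t) - 1) - 1))" for \<nu>
  have at: "filterlim (\<lambda>N. \<nu> + real N) at_top sequentially"
    by (rule filterlim_tendsto_add_at_top[OF tendsto_const filterlim_real_sequentially])
  have 1: "(\<lambda>N. J (\<nu> + real N) + (\<nu> + real N)) \<longlonglongrightarrow> pi / (12 * \<alpha>)"
    unfolding J_def by (rule filterlim_compose[OF bose_interval_integral_tendsto[OF \<alpha>] at])
  have "((\<lambda>x. (x + 1 / 2) * ln (1 - exp (- ((2 * pi * \<alpha>) * x)))) \<longlongrightarrow> 0) at_top"
  proof -
    have "((\<lambda>x. (x + 1 / 2) * ln (1 - exp (- (c * x)))) \<longlongrightarrow> 0) at_top" if "c > 0" for c :: real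
      using that by real_asymp
    then show ?thesis using \<alpha> by simp
  qed
  then have 2: "(\<lambda>N. (\<nu> + real N + 1 / 2) * ln (1 - exp (- ((2 * pi * \<alpha>) * (\<nu> + real N))))) \<longlonglongrightarrow> 0"
    by (rule filterlim_compose[OF _ at])
  note 3 = stirling_Gamma[OF \<nu>]
  have "(\<lambda>N. ln (2 * pi) / 2 - (ln (Gamma (\<nu> + real N + 1)) - (\<nu> + real N + 1 / 2) * ln (\<nu> + real N) + (\<nu> + real N))
     - (\<nu> + real N + 1 / 2) * ln (1 - exp (- ((2 * pi * \<alpha>) * (\<nu> + real N)))) + (J (\<nu> + real N) + (\<nu> + real N)))
    \<longlonglongrightarrow> ln (2 * pi) / 2 - ln (2 * pi) / 2 - 0 + pi / (12 * \<alpha>)"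
    by (intro tendsto_add tendsto_diff tendsto_const 1 2 3)
  moreover have "\<forall>\<^sub>F N in sequentially. ln (2 * pi) / 2 - (ln (Gamma (\<nu> + real N + 1)) - (\<nu> + real N + 1 / 2) * ln (\<nu> + real N) + (\<nu> + real N))
     - (\<nu> + real N + 1 / 2) * ln (1 - exp (- ((2 * pi * \<alpha>) * (\<nu> + real N)))) + (J (\<nu> + real N) + (\<nu> + real N)) =
     ln (sqrt (2 * pi) / Gamma (\<nu> + real N + 1)) - (\<nu> + real N + 1 / 2) * ln (exp_quotient \<alpha> (\<nu> + real N)) + J (\<nu> + real N)"
    using eventually_gt_at_top[of 0]
  proof eventually_elim
    case (elim N)
    define y where "y = \<nu> + real N"
    have y: "y > 0" using elim \<nu> by (simp add: y_def)
    have G: "Gamma (y + 1) > 0" using y by simp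
    have "exp (- (2 * pi * \<alpha> * y)) < 1" using y \<alpha> by simp
    then have e1: "ln (exp_quotient \<alpha> y) = ln (1 - exp (- (2 * pi * \<alpha> * y))) - ln y"
      using y by (simp add: exp_quotient_def ln_divide_pos mult_ac)
    have e2: "ln (sqrt (2 * pi) / Gamma (y + 1)) = ln (2 * pi) / 2 - ln (Gamma (y + 1))"
      using G by (simp add: ln_divide_pos ln_sqrt)
    show ?case unfolding y_def[symmetric] e1 e2 by (simp add: algebra_simps)
  qed
  ultimately have "(\<lambda>N. ln (sqrt (2 * pi) / Gamma (\<nu> + real N + 1)) - (\<nu> + real N + 1 / 2) * ln (exp_quotient \<alpha> (\<nu> + real N)) + J (\<nu> + real N))
    \<longlonglongrightarrow> ln (2 * pi) / 2 - ln (2 * pi) / 2 - 0 + pi / (12 * \<alpha>)"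
    by (rule Lim_transform_eventually)
  then show ?thesis by (simp add: J_def)
qed

lemma cos_term_shift: "cos_term \<alpha> (\<nu> + 1) n = cos_term \<alpha> \<nu> n"
proof -
  have "2 * real n * pi * (\<nu> + 1) = 2 * real n * pi * \<nu> + real n * (2 * pi)" by (simp add: algebra_simps)
  then have "cos (2 * real n * pi * (\<nu> + 1)) = cos (2 * real n * pi * \<nu>)" by (simp only: sin_cos_plus_of_nat_2pi)
  then show ?thesis by (simp add: cos_term_def)
qed

text \<open>The conjuncts before the identity certify that the product, the series, the integral and
  the principal value in it are genuine and not default values.\<close>

theorem theorem1:
  fixes \<alpha> \<nu> q x :: real
  assumes "\<alpha> > 0" and "\<nu> > -1"
    and "q = exp (- 2 * pi * \<alpha>)"
    and "x = exp (- 2 * pi * (1 + \<nu>) * \<alpha>)"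
  shows "convergent_prod (\<lambda>n. 1 - x * q ^ n) \<and>
    summable (\<lambda>n. cos_term \<alpha> \<nu> (Suc n)) \<and>
    (\<forall>t>0. summable (\<lambda>n. sin_term \<alpha> \<nu> t (Suc n))) \<and>
    interval_lebesgue_integrable lborel 0 (ereal \<nu>)
      (\<lambda>t. 2 * pi * \<alpha> * t / (exp (2 * pi * \<alpha> * t) - 1) - 1) \<and>
    (\<exists>I. has_pv_integral (M_integrand \<alpha> \<nu>) {0<..} 1 I) \<and>
    ln (qpochhammer_inf x q) =
      - pi / (12 * \<alpha>) + ln (sqrt (2 * pi) / Gamma (\<nu> + 1)) + pi / 12 * \<alpha>
      - (\<nu> + 1 / 2) * ln (exp_quotient \<alpha> \<nu>)
      + (LBINT t=0..ereal \<nu>. (2 * pi * \<alpha> * t / (exp (2 * pi * \<alpha> * t) - 1) - 1))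
      + M \<alpha> \<nu>"
proof -
  note \<alpha> = assms(1)
  obtain \<Lambda> where \<Lambda>: "\<And>x. (\<Lambda> has_real_derivative ln (exp_quotient \<alpha> x)) (at x)"
    using ln_exp_quotient_antiderivative[OF \<alpha>] by blast
  define X where "X \<mu> = exp (- 2 * pi * (1 + \<mu>) * \<alpha>)" for \<mu>
  define J where "J \<mu> = (LBINT t=0..ereal \<mu>. (2 * pi * \<alpha> * t / (exp (2 * pi * \<alpha> * t) - 1) - 1))" for \<mu>
  define C where "C \<mu> = (\<Sum>n. cos_term \<alpha> \<mu> (Suc n))" for \<mu>
  define S where "S \<mu> = ln (sqrt (2 * pi) / Gamma (\<mu> + 1)) - (\<mu> + 1 / 2) * ln (exp_quotient \<alpha> \<mu>) + J \<mu>" for \<mu>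
  define D where "D \<mu> = ln (qpochhammer_inf (X \<mu>) q)
     - (- pi / (12 * \<alpha>) + pi / 12 * \<alpha> + S \<mu> - C \<mu> - 2 / pi * pv_value \<alpha> \<mu>)" for \<mu>
  have q: "0 < q" "q < 1" using \<alpha> by (auto simp: assms(3))
  have X01: "0 < X \<mu>" "X \<mu> < 1" if "\<mu> > -1" for \<mu> using \<alpha> that by (auto simp: X_def)
  have XN: "X (\<mu> + real N) = X \<mu> * q ^ N" for \<mu> N
    by (simp add: X_def assms(3) algebra_simps flip: exp_add exp_of_nat_mult)
  have Mv: "M \<alpha> \<nu> = - C \<nu> - 2 / pi * pv_value \<alpha> \<nu>"
    unfolding M_def C_def pv_integral_eq[OF has_pv_integral_M_integrand[OF \<alpha>]] ..

  have C_shift: "C (\<mu> + 1) = C \<mu>" for \<mu> unfolding C_def cos_term_shift ..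
  have D_shift: "D (\<mu> + 1) = D \<mu>" if \<mu>: "\<mu> > -1" for \<mu>
  proof -
    define l0 where "l0 = ln (exp_quotient \<alpha> \<mu>)"
    define l1 where "l1 = ln (exp_quotient \<alpha> (\<mu> + 1))"
    note qp = qpochhammer_inf_props[OF X01[OF \<mu>] q]
    have "qpochhammer_inf (X \<mu>) q = qpochhammer_inf (X (\<mu> + 1)) q * (1 - X \<mu>)"
      using qp(3)[of 1] XN[of \<mu> 1] by simp
    then have L: "ln (qpochhammer_inf (X \<mu>) q) = ln (qpochhammer_inf (X (\<mu> + 1)) q) + ln (1 - X \<mu>)"
      using X01[OF \<mu>] qpochhammer_inf_props(2)[OF X01[of "\<mu> + 1"] q] \<mu> by (simp add: ln_mult_pos)
    \<comment> \<open>The numerator of \<open>exp_quotient\<close> at \<mu> + 1 is 1 - X \<mu>, the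
      first factor of the infinite product.\<close>
    have l1: "l1 = ln (1 - X \<mu>) - ln (\<mu> + 1)"
      using \<mu> X01[OF \<mu>] by (simp add: l1_def exp_quotient_def X_def add.commute ln_divide_pos)
    have "Gamma (\<mu> + 1 + 1) = (\<mu> + 1) * Gamma (\<mu> + 1)"
      using \<mu> by (intro Gamma_plus1) (auto elim!: nonpos_Ints_cases)
    then have G: "ln (sqrt (2 * pi) / Gamma (\<mu> + 1 + 1)) = ln (sqrt (2 * pi) / Gamma (\<mu> + 1)) - ln (\<mu> + 1)"
      using \<mu> by (simp add: ln_divide_pos ln_mult_pos)
    have J: "J y = y * ln (exp_quotient \<alpha> y) - (\<Lambda> y - \<Lambda> 0)" for y
      unfolding J_def by (rule bose_interval_integral(2)[OF \<alpha> \<Lambda>])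
    have I: "2 / pi * pv_value \<alpha> (\<mu> + 1) = 2 / pi * pv_value \<alpha> \<mu> + ((l0 + l1) / 2 - (\<Lambda> (\<mu> + 1) - \<Lambda> \<mu>))"
    proof -
      have "pv_value \<alpha> (\<mu> + 1) = pv_value \<alpha> \<mu> + pi / 2 * ((l0 + l1) / 2 - (\<Lambda> (\<mu> + 1) - \<Lambda> \<mu>))"
        using pv_value_shift[OF \<alpha> \<Lambda>, of \<mu>] unfolding l0_def l1_def by linarith
      then show ?thesis by (simp add: distrib_left)
    qed
    \<comment> \<open>The first two terms balance the factor split off the product, and the
      trapezoidal error balances the increment of the principal value.\<close>
    have "S (\<mu> + 1) - S \<mu> = - ln (\<mu> + 1) - l1 + ((l0 + l1) / 2 - (\<Lambda> (\<mu> + 1) - \<Lambda> \<mu>))"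
      unfolding S_def J G l0_def[symmetric] l1_def[symmetric] by (simp add: field_simps)
    then show ?thesis unfolding D_def C_shift I using L l1 by linarith
  qed
  have D_N: "D (\<nu> + real N) = D \<nu>" for N
  proof (induction N)
    case (Suc N)
    have "D (\<nu> + real N + 1) = D (\<nu> + real N)" using assms(2) by (intro D_shift) linarith
    then show ?case using Suc by (simp add: add_ac)
  qed simp
  have C_N: "C (\<nu> + real N) = C \<nu>" for N
  proof (induction N)
    case (Suc N)
    then show ?case using C_shift[of "\<nu> + real N"] by (simp add: add_ac)
  qed simp

  have "(\<lambda>N. ln (qpochhammer_inf (X \<nu> * q ^ N) q)) \<longlonglongrightarrow> ln 1"
    by (intro tendsto_ln qpochhammer_inf_props(4) X01 q assms(2)) simp
  then have limL: "(\<lambda>N. ln (qpochhammer_inf (X (\<nu> + real N)) q)) \<longlonglongrightarrow> 0" by (simp add: XN)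
  have limS: "(\<lambda>N. S (\<nu> + real N)) \<longlonglongrightarrow> pi / (12 * \<alpha>)"
    unfolding S_def J_def by (rule elementary_part_tendsto[OF \<alpha> assms(2)])
  \<comment> \<open>Solving the definition of \<open>D\<close> for the principal value: as
    \<open>D\<close> is constant along the sequence, convergence follows from the limits of the
    other terms.\<close>
  have pv_N: "pv_value \<alpha> (\<nu> + real N) = pi / 2 * (D \<nu> - pi / (12 * \<alpha>) + pi / 12 * \<alpha> + S (\<nu> + real N) - C \<nu> - ln (qpochhammer_inf (X (\<nu> + real N)) q))" for N
    using D_N[of N] unfolding D_def[of "\<nu> + real N"] C_N by (simp add: field_simps)
  have "(\<lambda>N. pv_value \<alpha> (\<nu> + real N)) \<longlonglongrightarrow> pi / 2 * (D \<nu> - pi / (12 * \<alpha>) + pi / 12 * \<alpha> + pi / (12 * \<alpha>) - C \<nu> - 0)"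
    unfolding pv_N by (intro tendsto_intros limL limS)
  \<comment> \<open>The ordinary limit equals the Cesaro limit computed analytically, and the
    comparison determines \<open>D \<nu>\<close>.\<close>
  from cesaro_tendsto[OF this] have "pi / 2 * (D \<nu> - pi / (12 * \<alpha>) + pi / 12 * \<alpha> + pi / (12 * \<alpha>) - C \<nu> - 0) = pi\<^sup>2 * \<alpha> / 24 - pi / 2 * C \<nu>"
    using cesaro_pv_value[OF \<alpha>, of \<nu>] unfolding C_def[symmetric] by (rule LIMSEQ_unique)
  also have "\<dots> = pi / 2 * (pi / 12 * \<alpha> - C \<nu>)" by (simp add: power2_eq_square field_simps)
  finally have "D \<nu> = 0" by simp
  then have "ln (qpochhammer_inf x q) = - pi / (12 * \<alpha>) + ln (sqrt (2 * pi) / Gamma (\<nu> + 1)) + pi / 12 * \<alpha>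
      - (\<nu> + 1 / 2) * ln (exp_quotient \<alpha> \<nu>) + J \<nu> + M \<alpha> \<nu>"
    unfolding D_def S_def Mv X_def assms(4)[symmetric] by linarith
  then show ?thesis
    using qpochhammer_inf_props(1)[OF X01[OF assms(2)] q] summable_cos_term[OF \<alpha>] summable_sin_term[OF \<alpha>]
      bose_interval_integral(1)[OF \<alpha> \<Lambda>] has_pv_integral_M_integrand[OF \<alpha>]
    unfolding J_def X_def assms(4)[symmetric] by blast
qed

end
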